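(* Let $X_1,X_2,\ldots$ be a time homogeneous, $\phi$-irreducible, aperiodic Markov chain with Polish state space $\Omega$, Markov kernel $P(x,dy)$ and unique stationary distribution $\pi$, with pseudo spectral gap $\gamma_{\mathrm{ps}}$. (1) If the chain is uniformly ergodic, then for $0\le\epsilon<1$, $$\gamma_{\mathrm{ps}}\ge\frac{1-\epsilon}{\tau(\epsilon)},\quad\text{in particular,}\quad\gamma_{\mathrm{ps}}\ge\frac{1}{2t_{\mathrm{mix}}}.$$ (2) For an arbitrary initial distribution $q$ on $\Omega$, $$d_{\mathrm{TV}}\left(q\boldsymbol{P}^n,\pi\right)\le\frac12(1-\gamma_{\mathrm{ps}})^{(n-1/\gamma_{\mathrm{ps}})/2}\cdot\sqrt{N_q-1}.$$ (3) If the state space is finite, then for $0\le\epsilon\le1$, $$t_{\mathrm{mix}}(\epsilon)\le\frac{1+2\log(1/(2\epsilon))+\log(1/\pi_{\min})}{\gamma_{\mathrm{ps}}},\quad\text{in particular,}\quad t_{\mathrm{mix}}\le\frac{1+2\log(2)+\log(1/\pi_{\min})}{\gamma_{\mathrm{ps}}},$$ where $\pi_{\min}=\min_{x\in\Omega}\pi(x)$.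
   Context: $L^2(\pi)$ is the Hilbert space of complex valued functions on $\Omega$ square integrable with respect to $\pi$, with $\langle f,g\rangle_\pi=\int f g^*\,d\pi$. $\boldsymbol{P}$ is the operator $(\boldsymbol{P}f)(x)=\int f(y)P(x,dy)$ on $L^2(\pi)$, and $\boldsymbol{P}^*$ its adjoint. On measures, $\mu\boldsymbol{P}(A)=\int P(x,A)\,\mu(dx)$. For a self-adjoint Markov operator $\boldsymbol{Q}$ on $L^2(\pi)$ with spectrum $S_2\subset\mathbb{R}$, the spectral gap is $\gamma(\boldsymbol{Q}):=1-\sup\{\lambda\in S_2:\lambda\ne1\}$ if the eigenvalue $1$ has multiplicity $1$, and $\gamma(\boldsymbol{Q}):=0$ otherwise. The pseudo spectral gap is $\gamma_{\mathrm{ps}}:=\max_{k\ge1}\{\gamma((\boldsymbol{P}^* )^k\boldsymbol{P}^k)/k\}$. $d_{\mathrm{TV}}(P,Q)=\sup_A|P(A)-Q(A)|$. Let $d(t):=\sup_{x\in\Omega}d_{\mathrm{TV}}(P^t(x,\cdot),\pi)$, $t_{\mathrm{mix}}(\epsilon):=\min\{t\ge 0:d(t)\le\epsilon\}$ ($t$ integer), $t_{\mathrm{mix}}:=t_{\mathrm{mix}}(1/4)$; and $\overline d(t):=\sup_{x,y\in\Omega}d_{\mathrm{TV}}(P^t(x,\cdot),P^t(y,\cdot))$, $\tau(\epsilon):=\min\{t\in\mathbb{N}:\overline d(t)\le\epsilon\}$. The chain is uniformly ergodic if $d(n)\le M\rho^n$, $n\ge1$, for some $\rho<1$, $M<\infty$.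 For a distribution $q$ on $\Omega$ absolutely continuous with respect to $\pi$, $N_q:=\mathbb{E}_\pi\left[(dq/d\pi)^2\right]$; otherwise $N_q:=\infty$. The bound in (2) is understood for $\gamma_{\mathrm{ps}}>0$, and its right hand side is read as $+\infty$ if $N_q=\infty$. In (1), when $\tau(\epsilon)=\infty$ the bound reads $\gamma_{\mathrm{ps}}\ge0$. In (3), $\log(1/0)=+\infty$. $\phi$-irreducible: there is a non-zero $\sigma$-finite measure $\phi$ on $\Omega$ such that for all $A$ with $\phi(A)>0$ and all $x\in\Omega$ there is $n\ge1$ with $P^n(x,A)>0$. Aperiodic: there are no $d\ge2$ and disjoint $\Omega_1,\ldots,\Omega_d\subset\Omega$ with $\pi(\Omega_1)>0$, $P(x,\Omega_{i+1})=1$ for $x\in\Omega_i$ ($i\le d-1$), and $P(x,\Omega_1)=1$ for $x\in\Omega_d$. *)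

theory Defs
  imports "HOL-Probability.Probability"
begin

section \<open>The space of square integrable functions and its operators\<close>

text \<open>Elements of \<open>L\<^sup>2(\<pi>)\<close> are handled through representatives: an operator acts on square integrable
  functions, and every equation between elements of \<open>L\<^sup>2(\<pi>)\<close> is an equation almost everywhere.\<close>

definition L2 :: "'a measure \<Rightarrow> ('a \<Rightarrow> complex) set" where
  "L2 \<pi> = {f \<in> borel_measurable \<pi>. integrable \<pi> (\<lambda>x. (cmod (f x))\<^sup>2)}"

definition L2_inner :: "'a measure \<Rightarrow> ('a \<Rightarrow> complex) \<Rightarrow> ('a \<Rightarrow> complex) \<Rightarrow> complex" where
  "L2_inner \<pi> f g = (\<integral>x. f x * cnj (g x) \<partial>\<pi>)"

definition L2_norm :: "'a measure \<Rightarrow> ('a \<Rightarrow> complex) \<Rightarrow> real" where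
  "L2_norm \<pi> f = sqrt (\<integral>x. (cmod (f x))\<^sup>2 \<partial>\<pi>)"

text \<open>Linearity and boundedness together force \<open>T\<close> to respect equality almost everywhere.\<close>

definition bounded_op :: "'a measure \<Rightarrow> (('a \<Rightarrow> complex) \<Rightarrow> ('a \<Rightarrow> complex)) \<Rightarrow> bool" where
  "bounded_op \<pi> T \<longleftrightarrow>
     (\<forall>f\<in>L2 \<pi>. T f \<in> L2 \<pi>) \<and>
     (\<forall>f\<in>L2 \<pi>. \<forall>g\<in>L2 \<pi>. AE x in \<pi>. T (\<lambda>y. f y + g y) x = T f x + T g x) \<and>
     (\<forall>c. \<forall>f\<in>L2 \<pi>. AE x in \<pi>. T (\<lambda>y. c * f y) x = c * T f x) \<and>
     (\<exists>C. \<forall>f\<in>L2 \<pi>. L2_norm \<pi> (T f) \<le> C * L2_norm \<pi> f)"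

text \<open>The adjoint is determined up to equality almost everywhere; the choice operator picks
  representatives.\<close>

definition adjoint_op ::
  "'a measure \<Rightarrow> (('a \<Rightarrow> complex) \<Rightarrow> ('a \<Rightarrow> complex)) \<Rightarrow> (('a \<Rightarrow> complex) \<Rightarrow> ('a \<Rightarrow> complex))" where
  "adjoint_op \<pi> T =
     (SOME R. (\<forall>g\<in>L2 \<pi>. R g \<in> L2 \<pi>) \<and>
              (\<forall>f\<in>L2 \<pi>. \<forall>g\<in>L2 \<pi>. L2_inner \<pi> (T f) g = L2_inner \<pi> f (R g)))"

definition L2_spectrum :: "'a measure \<Rightarrow> (('a \<Rightarrow> complex) \<Rightarrow> ('a \<Rightarrow> complex)) \<Rightarrow> complex set" where
  "L2_spectrum \<pi> T =
     {l. \<not> (\<exists>R. bounded_op \<pi> R \<and>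
            (\<forall>f\<in>L2 \<pi>. (AE x in \<pi>. R (\<lambda>y. T f y - l * f y) x = f x) \<and>
                       (AE x in \<pi>. T (R f) x - l * R f x = f x)))}"

definition eigenspace ::
  "'a measure \<Rightarrow> (('a \<Rightarrow> complex) \<Rightarrow> ('a \<Rightarrow> complex)) \<Rightarrow> complex \<Rightarrow> ('a \<Rightarrow> complex) set" where
  "eigenspace \<pi> T l = {f \<in> L2 \<pi>. AE x in \<pi>. T f x = l * f x}"

definition simple_eigenvalue ::
  "'a measure \<Rightarrow> (('a \<Rightarrow> complex) \<Rightarrow> ('a \<Rightarrow> complex)) \<Rightarrow> complex \<Rightarrow> bool" where
  "simple_eigenvalue \<pi> T l \<longleftrightarrow>
     (\<exists>f\<in>eigenspace \<pi> T l. \<not> (AE x in \<pi>. f x = 0) \<and>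
        (\<forall>g\<in>eigenspace \<pi> T l. \<exists>c. AE x in \<pi>. g x = c * f x))"

text \<open>The supremum is taken in the extended reals. It is over the empty set, and hence the gap is
  \<open>\<infinity>\<close>, only if \<open>L\<^sup>2(\<pi>)\<close> is one-dimensional (\<open>\<pi>\<close> a point mass). The spectrum of a self-adjoint
  operator is real, so \<open>Re\<close> merely changes the type.\<close>

definition spectral_gap ::
  "'a measure \<Rightarrow> (('a \<Rightarrow> complex) \<Rightarrow> ('a \<Rightarrow> complex)) \<Rightarrow> ereal" where
  "spectral_gap \<pi> Q =
     (if simple_eigenvalue \<pi> Q 1 then 1 - (SUP l\<in>L2_spectrum \<pi> Q - {1}. ereal (Re l)) else 0)"

section \<open>Markov kernels\<close>

definition markov_kernel :: "('a::polish_space \<Rightarrow> 'a measure) \<Rightarrow> bool" where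
  "markov_kernel P \<longleftrightarrow> P \<in> borel \<rightarrow>\<^sub>M prob_algebra borel"

definition distribution :: "'a::polish_space measure \<Rightarrow> bool" where
  "distribution \<mu> \<longleftrightarrow> prob_space \<mu> \<and> sets \<mu> = sets borel"

definition kernel_op ::
  "('a::polish_space \<Rightarrow> 'a measure) \<Rightarrow> ('a \<Rightarrow> complex) \<Rightarrow> ('a \<Rightarrow> complex)" where
  "kernel_op P f = (\<lambda>x. \<integral>y. f y \<partial>P x)"

text \<open>\<open>push P n \<mu>\<close> is \<open>\<mu> P\<^sup>n\<close>; the monadic bind \<open>\<mu> \<bind> P\<close> is the measure
  \<open>A \<mapsto> \<integral> P(x, A) \<mu>(dx)\<close>.\<close>

definition push :: "('a::polish_space \<Rightarrow> 'a measure) \<Rightarrow> nat \<Rightarrow> 'a measure \<Rightarrow> 'a measure" where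
  "push P n \<mu> = ((\<lambda>\<nu>. \<nu> \<bind> P) ^^ n) \<mu>"

definition kernel_pow :: "('a::polish_space \<Rightarrow> 'a measure) \<Rightarrow> nat \<Rightarrow> 'a \<Rightarrow> 'a measure" where
  "kernel_pow P n x = push P n (return borel x)"

definition stationary :: "('a::polish_space \<Rightarrow> 'a measure) \<Rightarrow> 'a measure \<Rightarrow> bool" where
  "stationary P \<pi> \<longleftrightarrow> distribution \<pi> \<and> \<pi> \<bind> P = \<pi>"

definition phi_irreducible :: "('a::polish_space \<Rightarrow> 'a measure) \<Rightarrow> bool" where
  "phi_irreducible P \<longleftrightarrow>
     (\<exists>\<phi>. sets \<phi> = sets borel \<and> sigma_finite_measure \<phi> \<and> emeasure \<phi> UNIV \<noteq> 0 \<and>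
          (\<forall>A\<in>sets borel. emeasure \<phi> A > 0 \<longrightarrow>
             (\<forall>x. \<exists>n\<ge>1. measure (kernel_pow P n x) A > 0)))"

definition aperiodic :: "('a::polish_space \<Rightarrow> 'a measure) \<Rightarrow> 'a measure \<Rightarrow> bool" where
  "aperiodic P \<pi> \<longleftrightarrow>
     \<not> (\<exists>(d::nat)\<ge>2. \<exists>S :: nat \<Rightarrow> 'a set.
          (\<forall>i\<in>{1..d}. S i \<in> sets borel) \<and> disjoint_family_on S {1..d} \<and>
          measure \<pi> (S 1) > 0 \<and>
          (\<forall>i\<in>{1..d - 1}. \<forall>x\<in>S i. measure (P x) (S (i + 1)) = 1) \<and>
          (\<forall>x\<in>S d. measure (P x) (S 1) = 1))"

text \<open>The maximum over \<open>k\<close> in the definition of the pseudo spectral gap exists (the \<open>k\<close>-th term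
  is nonnegative and at most \<open>1 / k\<close>, unless all terms are \<open>\<infinity>\<close>), so it is the supremum.\<close>

definition pseudo_spectral_gap ::
  "('a::polish_space \<Rightarrow> 'a measure) \<Rightarrow> 'a measure \<Rightarrow> ereal" where
  "pseudo_spectral_gap P \<pi> =
     (SUP k\<in>{1::nat..}.
        spectral_gap \<pi> ((adjoint_op \<pi> (kernel_op P) ^^ k) \<circ> (kernel_op P ^^ k)) / ereal (real k))"

section \<open>Mixing\<close>

definition d_TV :: "'a::polish_space measure \<Rightarrow> 'a measure \<Rightarrow> real" where
  "d_TV \<mu> \<nu> = (SUP A\<in>sets borel. \<bar>measure \<mu> A - measure \<nu> A\<bar>)"

definition mix_dist :: "('a::polish_space \<Rightarrow> 'a measure) \<Rightarrow> 'a measure \<Rightarrow> nat \<Rightarrow> real" where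
  "mix_dist P \<pi> t = (SUP x. d_TV (kernel_pow P t x) \<pi>)"

definition mix_dist_bar :: "('a::polish_space \<Rightarrow> 'a measure) \<Rightarrow> nat \<Rightarrow> real" where
  "mix_dist_bar P t = (SUP (x, y)\<in>UNIV. d_TV (kernel_pow P t x) (kernel_pow P t y))"

text \<open>In \<open>enat\<close> the infimum of a nonempty set is its minimum, and that of the empty set is \<open>\<infinity>\<close>.\<close>

definition t_mix :: "('a::polish_space \<Rightarrow> 'a measure) \<Rightarrow> 'a measure \<Rightarrow> real \<Rightarrow> enat" where
  "t_mix P \<pi> \<epsilon> = (INF t\<in>{t. mix_dist P \<pi> t \<le> \<epsilon>}. enat t)"

definition tau :: "('a::polish_space \<Rightarrow> 'a measure) \<Rightarrow> real \<Rightarrow> enat" where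
  "tau P \<epsilon> = (INF t\<in>{t. mix_dist_bar P t \<le> \<epsilon>}. enat t)"

definition uniformly_ergodic :: "('a::polish_space \<Rightarrow> 'a measure) \<Rightarrow> 'a measure \<Rightarrow> bool" where
  "uniformly_ergodic P \<pi> \<longleftrightarrow>
     (\<exists>(\<rho>::real) (M::real). \<rho> < 1 \<and> (\<forall>n\<ge>1. mix_dist P \<pi> n \<le> M * \<rho> ^ n))"

definition N_init :: "'a::polish_space measure \<Rightarrow> 'a measure \<Rightarrow> ennreal" where
  "N_init \<pi> q =
     (if absolutely_continuous \<pi> q then \<integral>\<^sup>+x. (RN_deriv \<pi> q x)\<^sup>2 \<partial>\<pi> else \<infinity>)"

definition pi_min :: "'a::polish_space measure \<Rightarrow> real" where
  "pi_min \<pi> = Min (range (\<lambda>x. measure \<pi> {x}))"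

text \<open>Real powers of a base in \<open>[0, \<infinity>)\<close> with \<open>0\<^sup>0 = 1\<close> and \<open>0\<^sup>a = \<infinity>\<close> for \<open>a < 0\<close>, whereas
  \<open>powr\<close> has \<open>0 powr a = 0\<close> for every \<open>a\<close>. The base \<open>-\<infinity>\<close> (pseudo spectral gap \<open>\<infinity>\<close>, so \<open>\<pi>\<close> is
  a point mass) gets the value \<open>0\<close>; it is then multiplied by \<open>sqrt (N\<^sub>q - 1) = 0\<close>.\<close>

definition epowr :: "ereal \<Rightarrow> ereal \<Rightarrow> ereal" where
  "epowr b a =
     (if b = 0 then (if a < 0 then \<infinity> else if a = 0 then 1 else 0)
      else ereal (real_of_ereal b powr real_of_ereal a))"

end

theory Submission
  imports Defs "HOL-Library.Function_Algebras"
begin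

text \<open>For (1) let \<open>Q = (P\<^sup>*)\<^sup>t P\<^sup>t\<close> with \<open>t = \<tau>(\<epsilon>)\<close>. Its iterates shrink the oscillation of
  bounded functions geometrically with ratio \<open>\<epsilon>\<close>; since the norms of the iterates of a self-adjoint operator are
  log-convex, the asymptotic rate already bounds a single step, so \<open>Q\<close> has norm at most \<open>\<epsilon>\<close> on
  the centred functions and a Neumann series bounds the spectrum.

  For (2) and (3) the gap of \<open>Q = (P\<^sup>*)\<^sup>k P\<^sup>k\<close> must be turned back into a contraction of \<open>P\<^sup>k\<close> on centred
  functions. Without the spectral theorem: if no \<open>\<lambda>\<close> in \<open>(\<mu>, 1)\<close> is spectral, then
  \<open>\<parallel>(Q - c) f\<parallel> \<ge> r \<parallel>f\<parallel>\<close> for the midpoint \<open>c\<close> and half-length \<open>r\<close> of that interval, which says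
  \<open>B\<^sup>2 \<ge> (1 - \<mu>) B\<close> for \<open>B = 1 - Q\<close>. The Cauchy-Schwarz inequality for the form of \<open>B\<close> gives
  \<open>B \<ge> 1 - \<mu>\<close> on the range of \<open>B\<close>, which is dense in the complement of the constants because
  \<open>Q\<^sup>n g\<close> tends to zero there. The contraction is then tested on \<open>1\<^sub>A - \<pi>(A)\<close>, whose norm is at
  most \<open>1 / 2\<close>.\<close>

section \<open>Self-adjoint operators on semi-inner product spaces\<close>

text \<open>The spectral hypothesis is pointwise: every \<open>l\<close> outside the spectrum has
  its own bounded resolvent, and no estimate uniform in \<open>l\<close> is given. The uniform lower
  bound for \<open>Q - c\<close> on the whole interval has to be extracted from these separate
  bounds, which is the task of \<open>selfadjoint_lower_bound\<close>. Operators act on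
  representatives, so their algebra is valid only up to null functions. The abstract spaces
  therefore admit null vectors; this also lets the form of a positive operator serve as a second
  inner product on the same space. The adjoint of \<open>P\<close> comes from a Riesz representation
  and not from a kernel, so the bounds that it preserves are obtained by duality with indicators
  instead of averaging. The loss \<open>1 / \<gamma>\<close> in the exponent of (2) and the summand
  1 in (3) have one origin: the contraction is available once per block of \<open>k\<close> steps,
  an incomplete block is wasted, and \<open>k * \<gamma> \<le> 1\<close> for the maximising
  \<open>k\<close>.\<close>

locale semi_inner =
  fixes V :: "'v::ab_group_add set" and sc :: "real \<Rightarrow> 'v \<Rightarrow> 'v" and ip :: "'v \<Rightarrow> 'v \<Rightarrow> real"
  assumes zero_in: "0 \<in> V"
    and add_in: "x \<in> V \<Longrightarrow> y \<in> V \<Longrightarrow> x + y \<in> V"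
    and diff_in: "x \<in> V \<Longrightarrow> y \<in> V \<Longrightarrow> x - y \<in> V"
    and sc_in: "x \<in> V \<Longrightarrow> sc a x \<in> V"
    and ip_add: "x \<in> V \<Longrightarrow> y \<in> V \<Longrightarrow> z \<in> V \<Longrightarrow> ip (x + y) z = ip x z + ip y z"
    and ip_sc: "x \<in> V \<Longrightarrow> y \<in> V \<Longrightarrow> ip (sc a x) y = a * ip x y"
    and ip_sym: "x \<in> V \<Longrightarrow> y \<in> V \<Longrightarrow> ip x y = ip y x"
    and ip_pos: "x \<in> V \<Longrightarrow> 0 \<le> ip x x"
begin

section \<open>Cauchy-Schwarz inequality and the seminorm\<close>

lemmas in_V = zero_in add_in diff_in sc_in

lemma ip_diff: "x \<in> V \<Longrightarrow> y \<in> V \<Longrightarrow> z \<in> V \<Longrightarrow> ip (x - y) z = ip x z - ip y z"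
  using ip_add[of "x - y" y z] diff_in[of x y] by simp

lemma ip_add_right: "x \<in> V \<Longrightarrow> y \<in> V \<Longrightarrow> z \<in> V \<Longrightarrow> ip z (x + y) = ip z x + ip z y"
  using ip_add ip_sym add_in by metis

lemma ip_diff_right: "x \<in> V \<Longrightarrow> y \<in> V \<Longrightarrow> z \<in> V \<Longrightarrow> ip z (x - y) = ip z x - ip z y"
  using ip_diff ip_sym diff_in by metis

lemma ip_sc_right: "x \<in> V \<Longrightarrow> y \<in> V \<Longrightarrow> ip y (sc a x) = a * ip y x"
  using ip_sc ip_sym sc_in by metis

lemmas ip_lin = ip_add ip_diff ip_add_right ip_diff_right ip_sc ip_sc_right

lemma ip_Cauchy_Schwarz:
  assumes "x \<in> V" "y \<in> V"
  shows "(ip x y)\<^sup>2 \<le> ip x x * ip y y"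
proof (cases "ip y y = 0")
  case False
  define t where "t = - ip x y / ip y y"
  have "0 \<le> ip (x + sc t y) (x + sc t y)"
    using assms by (intro ip_pos in_V)
  also have "\<dots> = ip x x + 2 * t * ip x y + t\<^sup>2 * ip y y"
    using assms ip_sym[of x y] by (simp add: ip_lin in_V power2_eq_square algebra_simps)
  also have "\<dots> = ip x x - (ip x y)\<^sup>2 / ip y y"
    using False by (simp add: t_def power2_eq_square field_simps)
  finally have "(ip x y)\<^sup>2 / ip y y \<le> ip x x" by simp
  then show ?thesis
    using False ip_pos[of y] assms by (simp add: field_simps)
next
  case True
  \<comment> \<open>For a null vector \<open>y\<close> the quadratic in \<open>t\<close> becomes
    affine, and being bounded for all \<open>t\<close> it has slope zero: the value of
    \<open>t\<close> used below would give \<open>ip x x + 1 \<le> ip x x\<close>.\<close>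
  have "2 * t * ip x y \<le> ip x x" for t
  proof -
    have "0 \<le> ip (x - sc t y) (x - sc t y)"
      using assms by (intro ip_pos in_V)
    also have "\<dots> = ip x x - 2 * t * ip x y"
      using assms ip_sym[of x y] True by (simp add: ip_lin in_V algebra_simps)
    finally show ?thesis by simp
  qed
  from this[of "(ip x x + 1) / (2 * ip x y)"] have "ip x y = 0" by (cases "ip x y = 0") auto
  then show ?thesis using True by simp
qed

definition nrm :: "'v \<Rightarrow> real" where "nrm x = sqrt (ip x x)"

lemma nrm_nonneg: "x \<in> V \<Longrightarrow> 0 \<le> nrm x"
  by (simp add: nrm_def ip_pos)

lemma nrm_sq: "x \<in> V \<Longrightarrow> (nrm x)\<^sup>2 = ip x x"
  by (simp add: nrm_def ip_pos)

lemma abs_ip_le: "x \<in> V \<Longrightarrow> y \<in> V \<Longrightarrow> \<bar>ip x y\<bar> \<le> nrm x * nrm y"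
  using ip_Cauchy_Schwarz[of x y] unfolding nrm_def
  by (metis real_sqrt_abs real_sqrt_le_mono real_sqrt_mult)

lemma ip_le: "x \<in> V \<Longrightarrow> y \<in> V \<Longrightarrow> ip x y \<le> nrm x * nrm y"
  using abs_ip_le[of x y] by simp

lemma nrm_triangle:
  assumes "x \<in> V" "y \<in> V" shows "nrm (x + y) \<le> nrm x + nrm y"
proof (rule power2_le_imp_le)
  have "(nrm (x + y))\<^sup>2 = ip x x + 2 * ip x y + ip y y"
    using assms ip_sym[of x y] by (simp add: nrm_sq ip_lin in_V)
  also have "\<dots> \<le> (nrm x + nrm y)\<^sup>2"
    using ip_le[of x y] assms by (simp add: power2_sum nrm_sq)
  finally show "(nrm (x + y))\<^sup>2 \<le> (nrm x + nrm y)\<^sup>2" .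
qed (use assms nrm_nonneg in simp)

lemma nrm_sc: "x \<in> V \<Longrightarrow> nrm (sc a x) = \<bar>a\<bar> * nrm x"
  by (simp add: nrm_def ip_lin in_V real_sqrt_mult mult.assoc[symmetric])

lemma nrm_diff_commute: "x \<in> V \<Longrightarrow> y \<in> V \<Longrightarrow> nrm (x - y) = nrm (y - x)"
  by (simp add: nrm_def ip_lin in_V)

lemma nrm_triangle_diff:
  assumes "x \<in> V" "y \<in> V" shows "nrm (x - y) \<le> nrm x + nrm y"
proof -
  have "nrm (0 - y) = nrm (y - 0)" by (intro nrm_diff_commute zero_in assms)
  moreover have "0 - y \<in> V" by (intro in_V assms)
  ultimately show ?thesis using nrm_triangle[of x "0 - y"] assms by simp
qed

lemma nrm_diff_triangle:
  assumes "x \<in> V" "y \<in> V" "z \<in> V" shows "nrm (x - z) \<le> nrm (x - y) + nrm (y - z)"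
  using nrm_triangle[of "x - y" "y - z"] assms in_V by simp

lemma nrm_le_add_diff:
  assumes "x \<in> V" "y \<in> V" shows "nrm x \<le> nrm y + nrm (x - y)"
  using nrm_triangle[of "y" "x - y"] assms in_V by simp

text \<open>Equality in the quotient by the null vectors.\<close>

definition eqv :: "'v \<Rightarrow> 'v \<Rightarrow> bool" where
  "eqv x y \<longleftrightarrow> (\<forall>z\<in>V. ip x z = ip y z)"

lemma eqv_iff:
  assumes "x \<in> V" "y \<in> V" shows "eqv x y \<longleftrightarrow> nrm (x - y) = 0"
proof
  assume "eqv x y"
  then show "nrm (x - y) = 0"
    using assms in_V by (simp add: eqv_def nrm_def ip_diff)
next
  assume *: "nrm (x - y) = 0"
  show "eqv x y"
    unfolding eqv_def
  proof
    fix z assume "z \<in> V"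
    then show "ip x z = ip y z"
      using abs_ip_le[of "x - y" z] * assms in_V by (simp add: ip_diff)
  qed
qed

lemma eqv_ip: "eqv x y \<Longrightarrow> z \<in> V \<Longrightarrow> ip x z = ip y z"
  by (simp add: eqv_def)

lemma eqv_ip_right: "eqv x y \<Longrightarrow> x \<in> V \<Longrightarrow> y \<in> V \<Longrightarrow> z \<in> V \<Longrightarrow> ip z x = ip z y"
  using ip_sym by (metis eqv_ip)

lemma eqv_nrm: "eqv x y \<Longrightarrow> x \<in> V \<Longrightarrow> y \<in> V \<Longrightarrow> nrm x = nrm y"
  unfolding nrm_def using eqv_ip eqv_ip_right by metis

text \<open>Having an adjoint makes a map linear up to null vectors, so that linearity need not be
  assumed separately.\<close>

definition adj :: "('v \<Rightarrow> 'v) \<Rightarrow> ('v \<Rightarrow> 'v) \<Rightarrow> bool" where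
  "adj T S \<longleftrightarrow> (\<forall>x\<in>V. T x \<in> V) \<and> (\<forall>x\<in>V. S x \<in> V) \<and> (\<forall>x\<in>V. \<forall>y\<in>V. ip (T x) y = ip x (S y))"

lemma adj_in: "adj T S \<Longrightarrow> x \<in> V \<Longrightarrow> T x \<in> V"
  and adj_ip: "adj T S \<Longrightarrow> x \<in> V \<Longrightarrow> y \<in> V \<Longrightarrow> ip (T x) y = ip x (S y)"
  by (auto simp: adj_def)

lemma adj_sym: "adj T S \<Longrightarrow> adj S T"
  unfolding adj_def using ip_sym by metis

lemma adj_comp: "adj T S \<Longrightarrow> adj T' S' \<Longrightarrow> adj (T \<circ> T') (S' \<circ> S)"
  unfolding adj_def by auto

lemma adj_funpow: "adj T S \<Longrightarrow> adj (T ^^ n) (S ^^ n)"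
proof (induction n)
  case 0 then show ?case by (simp add: adj_def)
next
  case (Suc n) then show ?case
    using adj_comp[of T S "T ^^ n" "S ^^ n"] funpow_Suc_right[of n S] by (metis funpow.simps(2))
qed

lemma adj_diff_sc: "adj T S \<Longrightarrow> adj (\<lambda>x. T x - sc a x) (\<lambda>x. S x - sc a x)"
  unfolding adj_def by (simp add: in_V ip_lin)

lemma adj_cong:
  assumes "adj T S" "eqv x y" "x \<in> V" "y \<in> V" shows "eqv (T x) (T y)"
  using assms unfolding adj_def eqv_def by auto

lemma adj_add: "adj T S \<Longrightarrow> x \<in> V \<Longrightarrow> y \<in> V \<Longrightarrow> eqv (T (x + y)) (T x + T y)"
  unfolding adj_def eqv_def by (simp add: in_V ip_lin)

lemma adj_diff: "adj T S \<Longrightarrow> x \<in> V \<Longrightarrow> y \<in> V \<Longrightarrow> eqv (T (x - y)) (T x - T y)"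
  unfolding adj_def eqv_def by (simp add: in_V ip_lin)

lemma adj_sc: "adj T S \<Longrightarrow> x \<in> V \<Longrightarrow> eqv (T (sc a x)) (sc a (T x))"
  unfolding adj_def eqv_def by (simp add: in_V ip_lin)

lemma adj_diff_nrm_le:
  assumes T: "adj T S" and K: "\<And>x. x \<in> V \<Longrightarrow> nrm (T x) \<le> K * nrm x" and xy: "x \<in> V" "y \<in> V"
  shows "nrm (T x - T y) \<le> K * nrm (x - y)"
  using K[of "x - y"] eqv_nrm[OF adj_diff[OF T xy]] adj_in[OF T] in_V xy by simp

text \<open>Makes the Cauchy-Schwarz inequality available for the form of \<open>A\<close>. That
  form is degenerate in general, even if \<open>ip\<close> is not.\<close>

lemma positive_form:
  assumes A: "adj A A" and pos: "\<And>x. x \<in> V \<Longrightarrow> 0 \<le> ip (A x) x"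
  shows "semi_inner V sc (\<lambda>x y. ip (A x) y)"
proof
  fix x y z assume xyz: "x \<in> V" "y \<in> V" "z \<in> V"
  show "ip (A (x + y)) z = ip (A x) z + ip (A y) z"
    using eqv_ip[OF adj_add[OF A xyz(1,2)] xyz(3)] adj_in[OF A] xyz by (simp add: ip_lin)
next
  fix x y a assume xy: "x \<in> V" "y \<in> V"
  show "ip (A (sc a x)) y = a * ip (A x) y"
    using eqv_ip[OF adj_sc[OF A xy(1)] xy(2)] adj_in[OF A] xy by (simp add: ip_lin)
  show "ip (A x) y = ip (A y) x"
    using adj_ip[OF A xy] ip_sym adj_in[OF A] xy by simp
qed (use in_V pos in auto)

text \<open>The Cauchy-Schwarz inequality for the form of \<open>A\<close>, applied to
  \<open>x\<close> and \<open>A x\<close>, bounds the fourth power of \<open>nrm (A x)\<close> by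
  \<open>ip (A x) x * ip (A (A x)) (A x)\<close>; the last factor is at most \<open>K\<close> times
  the square of \<open>nrm (A x)\<close>.\<close>

lemma positive_nrm_sq_le:
  assumes A: "adj A A" and pos: "\<And>x. x \<in> V \<Longrightarrow> 0 \<le> ip (A x) x"
    and K: "\<And>x. x \<in> V \<Longrightarrow> nrm (A x) \<le> K * nrm x" and x: "x \<in> V"
  shows "(nrm (A x))\<^sup>2 \<le> K * ip (A x) x"
proof -
  interpret F: semi_inner V sc "\<lambda>x y. ip (A x) y" by (rule positive_form[OF A pos])
  have Ax: "A x \<in> V" "A (A x) \<in> V" using adj_in[OF A] x by auto
  have "((nrm (A x))\<^sup>2)\<^sup>2 \<le> ip (A x) x * ip (A (A x)) (A x)"
    using F.ip_Cauchy_Schwarz[of x "A x"] x Ax by (simp add: nrm_sq)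
  also have "\<dots> \<le> ip (A x) x * (K * (nrm (A x))\<^sup>2)"
  proof (rule mult_left_mono[OF _ pos[OF x]])
    have "ip (A (A x)) (A x) \<le> nrm (A (A x)) * nrm (A x)" using ip_le Ax by blast
    also have "\<dots> \<le> (K * nrm (A x)) * nrm (A x)"
      using K[of "A x"] Ax nrm_nonneg by (intro mult_right_mono) auto
    finally show "ip (A (A x)) (A x) \<le> K * (nrm (A x))\<^sup>2" by (simp add: power2_eq_square)
  qed
  finally have *: "(nrm (A x))\<^sup>2 * (nrm (A x))\<^sup>2 \<le> (K * ip (A x) x) * (nrm (A x))\<^sup>2"
    by (simp add: power2_eq_square algebra_simps)
  show ?thesis
  proof (cases "nrm (A x) = 0")
    case True
    show ?thesis
    proof (cases "K \<ge> 0")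
      case True then show ?thesis using \<open>nrm (A x) = 0\<close> pos[OF x] by simp
    next
      \<comment> \<open>\<open>K\<close> is not assumed nonnegative; a negative \<open>K\<close>
        forces \<open>x\<close> to be null.\<close>
      case False
      then have "nrm x = 0" using K[OF x] nrm_nonneg[OF x] nrm_nonneg[OF Ax(1)]
        by (smt (verit) mult_neg_pos)
      then have "ip (A x) x = 0" using abs_ip_le[OF Ax(1) x] by simp
      then show ?thesis using True by simp
    qed
  next
    case False
    then have "(nrm (A x))\<^sup>2 > 0" by simp
    then show ?thesis using * mult_right_le_imp_le by blast
  qed
qed

text \<open>Used with \<open>y = Q x\<close>, where it derives \<open>Q \<le> 1\<close> from
  \<open>Q\<^sup>2 \<le> Q\<close>.\<close>

lemma firmly_nonexpansive_form_le:
  assumes "x \<in> V" "y \<in> V" "ip y y \<le> ip y x" shows "ip y x \<le> ip x x"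
proof -
  have "0 \<le> ip (x - y) (x - y)" by (intro ip_pos in_V assms)
  also have "\<dots> = ip x x - 2 * ip y x + ip y y"
    using assms(1,2) ip_sym[of x y] by (simp add: ip_lin in_V)
  finally show ?thesis using assms(3) by simp
qed

text \<open>Take the largest \<sigma> with \<open>D\<^sup>2 \<ge> \<sigma>\<close>. If it were below
  \<open>r\<^sup>2\<close>, both roots of \<open>D\<^sup>2 - \<sigma>\<close> would lie in the range
  covered by \<open>res\<close>, so this positive operator would be bounded below in norm, hence in
  form, and \<sigma> could be enlarged.\<close>

lemma selfadjoint_lower_bound:
  assumes D: "adj D D" and K: "\<And>x. x \<in> V \<Longrightarrow> nrm (D x) \<le> K * nrm x" and r: "0 \<le> r"
    and res: "\<And>l. \<bar>l\<bar> < r \<Longrightarrow> \<exists>\<kappa>>0. \<forall>x\<in>V. \<kappa> * nrm x \<le> nrm (D x - sc l x)"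
    and x: "x \<in> V"
  shows "r\<^sup>2 * ip x x \<le> ip (D x) (D x)"
proof -
  \<comment> \<open>Without the cap \<open>r\<^sup>2\<close> the set would be unbounded when all
    vectors are null.\<close>
  define M where "M = {\<sigma>. 0 \<le> \<sigma> \<and> \<sigma> \<le> r\<^sup>2 \<and> (\<forall>x\<in>V. \<sigma> * ip x x \<le> ip (D x) (D x))}"
  define \<sigma> where "\<sigma> = Sup M"
  have DV: "D x \<in> V" if "x \<in> V" for x using adj_in[OF D that] .
  have bdd: "bdd_above M" unfolding M_def by (rule bdd_aboveI[of _ "r\<^sup>2"]) auto
  have M0: "0 \<in> M" unfolding M_def by (rule CollectI) (use DV ip_pos in simp)
  have \<sigma>M: "\<sigma> \<in> M"
    unfolding M_def
  proof (safe)
    show "0 \<le> \<sigma>" unfolding \<sigma>_def by (rule cSup_upper[OF M0 bdd])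
    show "\<sigma> \<le> r\<^sup>2" unfolding \<sigma>_def
    proof (rule cSup_least)
      show "M \<noteq> {}" using M0 by blast
    qed (simp add: M_def)
    fix x assume x: "x \<in> V"
    show "\<sigma> * ip x x \<le> ip (D x) (D x)"
    proof (cases "ip x x = 0")
      case True then show ?thesis using DV ip_pos x by simp
    next
      case False
      then have p: "ip x x > 0" using ip_pos[OF x] by simp
      have "\<sigma> \<le> ip (D x) (D x) / ip x x"
        unfolding \<sigma>_def
      proof (rule cSup_least)
        show "M \<noteq> {}" using M0 by blast
      qed (use x p in \<open>auto simp: M_def field_simps\<close>)
      then show ?thesis using p by (simp add: field_simps)
    qed
  qed
  have "\<sigma> = r\<^sup>2"
  proof (rule ccontr)
    assume "\<sigma> \<noteq> r\<^sup>2"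
    with \<sigma>M have \<sigma>: "0 \<le> \<sigma>" "\<sigma> < r\<^sup>2" "\<And>x. x \<in> V \<Longrightarrow> \<sigma> * ip x x \<le> ip (D x) (D x)" by (auto simp: M_def)
    define \<rho> where "\<rho> = sqrt \<sigma>"
    have \<rho>: "0 \<le> \<rho>" "\<rho>\<^sup>2 = \<sigma>" "\<rho> < r" using \<sigma> r unfolding \<rho>_def
      by (auto intro: real_less_lsqrt)
    obtain k1 where k1: "k1 > 0" "\<And>x. x \<in> V \<Longrightarrow> k1 * nrm x \<le> nrm (D x - sc \<rho> x)"
      using res[of \<rho>] \<rho> by auto
    obtain k2 where k2: "k2 > 0" "\<And>x. x \<in> V \<Longrightarrow> k2 * nrm x \<le> nrm (D x - sc (-\<rho>) x)"
      using res[of "-\<rho>"] \<rho> by auto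
    define A where "A = (\<lambda>x. (D \<circ> D) x - sc \<sigma> x)"
    have A: "adj A A" unfolding A_def by (intro adj_diff_sc adj_comp D)
    have Aip: "ip (A x) x = ip (D x) (D x) - \<sigma> * ip x x" if "x \<in> V" for x
      using that DV adj_ip[OF D, of "D x" x] by (simp add: A_def ip_lin in_V)
    have Apos: "0 \<le> ip (A x) x" if "x \<in> V" for x
      using Aip[OF that] \<sigma>(3)[OF that] by simp
    \<comment> \<open>\<open>A\<close> is the product of \<open>D - \<rho>\<close> and
      \<open>D + \<rho>\<close> up to null vectors, so the two lower bounds multiply.\<close>
    have Alow: "k1 * k2 * nrm x \<le> nrm (A x)" if x: "x \<in> V" for x
    proof -
      let ?y = "D x - sc (-\<rho>) x"
      have y: "?y \<in> V" by (intro in_V DV x)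
      have "k1 * k2 * nrm x \<le> k1 * nrm ?y" using k2(2)[OF x] k1(1) by simp
      also have "\<dots> \<le> nrm (D ?y - sc \<rho> ?y)" by (rule k1(2)[OF y])
      also have "\<dots> = nrm (A x)"
      proof (rule eqv_nrm)
        have Dy: "ip (D ?y) z = ip (D (D x)) z + \<rho> * ip (D x) z" if z: "z \<in> V" for z
          using adj_ip[OF D y z] adj_ip[OF D DV[OF x] z] adj_ip[OF D x z] x z DV
          by (simp add: ip_lin in_V)
        show "eqv (D ?y - sc \<rho> ?y) (A x)"
          unfolding eqv_def A_def using x y DV in_V \<rho>(2)
          by (simp add: ip_lin Dy power2_eq_square algebra_simps)
      qed (auto intro!: in_V DV x adj_in[OF A])
      finally show ?thesis .
    qed
    have Knn: "\<bar>K\<bar> * nrm x \<ge> nrm (D x)" if "x \<in> V" for x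
      by (rule order_trans[OF K[OF that]]) (use nrm_nonneg[OF that] in \<open>auto intro: mult_right_mono\<close>)
    \<comment> \<open>\<open>K\<^sup>2 + \<sigma>\<close> bounds the norm of \<open>A\<close>; the
      summand 1 makes the divisor in \<open>\<delta>\<close> positive.\<close>
    define L where "L = K\<^sup>2 + \<sigma> + 1"
    have L: "L > 0" using \<sigma> by (auto simp: L_def intro: add_nonneg_pos)
    have Abd: "nrm (A x) \<le> L * nrm x" if x: "x \<in> V" for x
    proof -
      have "nrm (A x) \<le> nrm (D (D x)) + nrm (sc \<sigma> x)"
        unfolding A_def comp_def by (rule nrm_triangle_diff) (intro in_V DV x)+
      also have "\<dots> \<le> \<bar>K\<bar> * (\<bar>K\<bar> * nrm x) + \<sigma> * nrm x"
        using Knn[OF DV[OF x]] mult_left_mono[OF Knn[OF x], of "\<bar>K\<bar>"] \<sigma> x by (simp add: nrm_sc)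
      also have "\<dots> \<le> L * nrm x" using nrm_nonneg[OF x]
        by (simp add: L_def algebra_simps power2_eq_square)
      finally show ?thesis .
    qed
    \<comment> \<open>Squaring \<open>Alow\<close> and comparing with
      \<open>positive_nrm_sq_le\<close> gives \<open>A \<ge> \<delta>\<close>, that is
      \<open>D\<^sup>2 \<ge> \<sigma> + \<delta>\<close>.\<close>
    define \<delta> where "\<delta> = (k1 * k2)\<^sup>2 / L"
    have \<delta>: "\<delta> > 0" using k1 k2 L by (simp add: \<delta>_def)
    have better: "(\<sigma> + \<delta>) * ip x x \<le> ip (D x) (D x)" if x: "x \<in> V" for x
    proof -
      have "(k1 * k2)\<^sup>2 * ip x x = (k1 * k2 * nrm x)\<^sup>2" using x by (simp add: power_mult_distrib nrm_sq)
      also have "\<dots> \<le> (nrm (A x))\<^sup>2"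
        by (rule power_mono[OF Alow[OF x]]) (use k1 k2 nrm_nonneg[OF x] in simp)
      also have "\<dots> \<le> L * ip (A x) x" by (rule positive_nrm_sq_le[OF A Apos Abd x])
      finally have "\<delta> * ip x x \<le> ip (A x) x" using L by (simp add: \<delta>_def field_simps)
      then show ?thesis using Aip[OF x] by (simp add: algebra_simps)
    qed
    define \<sigma>' where "\<sigma>' = min (\<sigma> + \<delta>) (r\<^sup>2)"
    have "\<sigma>' \<in> M"
      unfolding M_def
    proof safe
      show "0 \<le> \<sigma>'" "\<sigma>' \<le> r\<^sup>2" using \<sigma> \<delta> by (auto simp: \<sigma>'_def)
      fix x assume x: "x \<in> V"
      have "\<sigma>' * ip x x \<le> (\<sigma> + \<delta>) * ip x x" using ip_pos[OF x] by (intro mult_right_mono) (auto simp: \<sigma>'_def)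
      also note better[OF x]
      finally show "\<sigma>' * ip x x \<le> ip (D x) (D x)" .
    qed
    then have "\<sigma>' \<le> \<sigma>" unfolding \<sigma>_def by (rule cSup_upper[OF _ bdd])
    then show False using \<delta> \<sigma>(2) by (auto simp: \<sigma>'_def min_def split: if_splits)
  qed
  with \<sigma>M x show ?thesis by (auto simp: M_def)
qed

text \<open>Successive ratios of the norms do not decrease, so a first ratio above \<open>q\<close>
  would make the norms outgrow every multiple of \<open>q ^ n\<close>. The constant \<open>C\<close>
  may depend on \<open>x\<close> and disappears from the conclusion; this is what permits wasteful
  constants in the oscillation estimates.\<close>

lemma nrm_iterate_log_convex:
  assumes Q: "adj Q Q" and x: "x \<in> V" and C: "\<And>n. nrm ((Q ^^ n) x) \<le> C * q ^ n" and q: "0 \<le> q"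
  shows "nrm (Q x) \<le> q * nrm x"
proof -
  define a where "a n = nrm ((Q ^^ n) x)" for n
  have V: "(Q ^^ n) x \<in> V" for n using adj_in[OF adj_funpow[OF Q] x] .
  have a0: "a n \<ge> 0" for n unfolding a_def by (rule nrm_nonneg[OF V])
  have conv: "(a (Suc n))\<^sup>2 \<le> a n * a (Suc (Suc n))" for n
  proof -
    have "(a (Suc n))\<^sup>2 = ip ((Q ^^ n) x) ((Q ^^ Suc (Suc n)) x)"
      using adj_ip[OF Q V[of n] V[of "Suc n"]] V[of "Suc n"] by (simp add: a_def nrm_sq)
    also have "\<dots> \<le> a n * a (Suc (Suc n))" unfolding a_def by (rule ip_le[OF V V])
    finally show ?thesis .
  qed
  show ?thesis
  proof (cases "a 0 = 0 \<or> a 1 = 0")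
    case True
    have "a 1 = 0"
    proof (cases "a 0 = 0")
      case z: True
      have "(a 1)\<^sup>2 = ip x (Q (Q x))"
        using adj_ip[OF Q x V[of 1]] V[of 1] by (simp add: a_def nrm_sq)
      also have "\<dots> \<le> a 0 * a 2"
        using ip_le[OF V[of 0] V[of 2]] by (simp add: a_def numeral_2_eq_2)
      finally show ?thesis using z by simp
    qed (use True in auto)
    then show ?thesis using a0[of 0] q by (simp add: a_def)
  next
    case False
    then have pos0: "a 0 > 0" "a 1 > 0" using a0[of 0] a0[of 1] by auto
    define t where "t = a 1 / a 0"
    have t: "t > 0" using pos0 by (simp add: t_def)
    have step: "a n > 0 \<and> a (Suc n) \<ge> t * a n" for n
    proof (induction n)
      case 0 then show ?case using pos0 by (simp add: t_def)
    next
      case (Suc n)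
      then have p: "a n > 0" "a (Suc n) \<ge> t * a n" by auto
      then have p': "a (Suc n) > 0" using t by (smt (verit) mult_pos_pos)
      have "t * a n * a (Suc n) \<le> (a (Suc n))\<^sup>2" using p(2) p' by (simp add: power2_eq_square)
      also have "\<dots> \<le> a n * a (Suc (Suc n))" by (rule conv)
      finally have "t * a (Suc n) \<le> a (Suc (Suc n))" using p(1) by (simp add: algebra_simps)
      then show ?case using p' by simp
    qed
    have pw: "a 0 * t ^ n \<le> a n" for n
    proof (induction n)
      case (Suc n)
      have "a 0 * t ^ Suc n = t * (a 0 * t ^ n)" by simp
      also have "\<dots> \<le> t * a n" using Suc t by simp
      also have "\<dots> \<le> a (Suc n)" using step by simp
      finally show ?case .
    qed simp
    have "t \<le> q"
    proof (rule ccontr)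
      assume "\<not> t \<le> q"
      then have lt: "q < t" by simp
      have "a 0 * t ^ n \<le> C * q ^ n" for n using pw[of n] C[of n] by (simp add: a_def)
      then have b: "a 0 \<le> C * (q / t) ^ n" for n using t
        by (simp add: power_divide pos_le_divide_eq)
      have "(\<lambda>n. C * (q / t) ^ n) \<longlonglongrightarrow> C * 0"
        by (intro tendsto_mult tendsto_const LIMSEQ_power_zero) (use lt q t in simp)
      then have "a 0 \<le> C * 0" using b by (intro LIMSEQ_le_const[of _ "C * 0"]) auto
      then show False using pos0 by simp
    qed
    then show ?thesis using pos0 by (simp add: t_def a_def field_simps)
  qed
qed

end

section \<open>Complete spaces: Riesz representation, Neumann series, limits of iterates\<close>

locale semi_hilbert = semi_inner +
  assumes complete: "\<And>u. (\<And>n. u n \<in> V) \<Longrightarrow>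
     (\<And>e. e > 0 \<Longrightarrow> \<exists>N. \<forall>m\<ge>N. \<forall>n\<ge>N. nrm (u m - u n) < e) \<Longrightarrow> \<exists>x\<in>V. (\<lambda>n. nrm (u n - x)) \<longlonglongrightarrow> 0"
begin

lemma ip_tendsto:
  assumes "\<And>n. u n \<in> V" "x \<in> V" "z \<in> V" "(\<lambda>n. nrm (u n - x)) \<longlonglongrightarrow> 0"
  shows "(\<lambda>n. ip (u n) z) \<longlonglongrightarrow> ip x z"
proof -
  have "(\<lambda>n. ip (u n) z - ip x z) \<longlonglongrightarrow> 0"
  proof (rule Lim_null_comparison[OF always_eventually])
    show "\<forall>n. norm (ip (u n) z - ip x z) \<le> nrm (u n - x) * nrm z"
      using abs_ip_le[of "u _ - x" z] assms in_V by (simp add: ip_diff)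
    show "(\<lambda>n. nrm (u n - x) * nrm z) \<longlonglongrightarrow> 0" using tendsto_mult_left_zero[OF assms(4)] .
  qed
  then show ?thesis by (simp add: LIM_zero_iff)
qed

lemma nrm_tendsto:
  assumes "\<And>n. u n \<in> V" "x \<in> V" "(\<lambda>n. nrm (u n - x)) \<longlonglongrightarrow> 0"
  shows "(\<lambda>n. nrm (u n)) \<longlonglongrightarrow> nrm x"
proof -
  have "(\<lambda>n. nrm (u n) - nrm x) \<longlonglongrightarrow> 0"
  proof (rule Lim_null_comparison[OF always_eventually])
    show "\<forall>n. norm (nrm (u n) - nrm x) \<le> nrm (u n - x)"
    proof
      fix n
      show "norm (nrm (u n) - nrm x) \<le> nrm (u n - x)"
        using nrm_le_add_diff[of "u n" x] nrm_le_add_diff[of x "u n"] nrm_diff_commute[of x "u n"] assms(1)[of n] assms(2)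
        by (simp add: abs_le_iff)
    qed
  qed (rule assms(3))
  then show ?thesis by (simp add: LIM_zero_iff)
qed

text \<open>The representing vector minimises \<open>J\<close>. The parallelogram law makes a
  minimising sequence Cauchy, and the first variation of \<open>J\<close> at the minimum
  vanishes.\<close>

lemma riesz_representation:
  assumes add: "\<And>x y. x \<in> V \<Longrightarrow> y \<in> V \<Longrightarrow> \<phi> (x + y) = \<phi> x + \<phi> y"
    and sc: "\<And>a x. x \<in> V \<Longrightarrow> \<phi> (sc a x) = a * \<phi> x"
    and bd: "\<And>x. x \<in> V \<Longrightarrow> \<bar>\<phi> x\<bar> \<le> K * nrm x"
  shows "\<exists>z\<in>V. \<forall>x\<in>V. \<phi> x = ip x z"
proof -
  define J where "J x = ip x x - 2 * \<phi> x" for x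
  define I where "I = Inf (J ` V)"
  have bdd: "bdd_below (J ` V)"
  proof (rule bdd_belowI2[of _ "- K\<^sup>2"])
    fix x assume x: "x \<in> V"
    have "J x \<ge> (nrm x)\<^sup>2 - 2 * (K * nrm x)" using bd[OF x] x by (simp add: J_def nrm_sq)
    moreover have "(nrm x)\<^sup>2 - 2 * (K * nrm x) = (nrm x - K)\<^sup>2 - K\<^sup>2" by (simp add: power2_eq_square algebra_simps)
    ultimately show "- K\<^sup>2 \<le> J x" using zero_le_power2[of "nrm x - K"] by linarith
  qed
  have I_le: "I \<le> J x" if "x \<in> V" for x
    unfolding I_def using cInf_lower[OF imageI[OF that] bdd] .
  have "\<exists>x\<in>V. J x < I + 1 / real (Suc n)" for n
  proof -
    have "Inf (J ` V) < I + 1 / real (Suc n)" by (simp add: I_def)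
    then show ?thesis using cInf_lessD[of "J ` V"] zero_in by auto
  qed
  then obtain u where u: "\<And>n. u n \<in> V" "\<And>n. J (u n) < I + 1 / real (Suc n)" by metis
  have par: "(nrm (u m - u n))\<^sup>2 \<le> 2 * (1 / real (Suc m)) + 2 * (1 / real (Suc n))" for m n
  proof -
    have h: "sc (1/2) (u m + u n) \<in> V" by (intro in_V u)
    have "4 * J (sc (1/2) (u m + u n)) = ip (u m + u n) (u m + u n) - 4 * (\<phi> (u m) + \<phi> (u n))"
      using u by (simp add: J_def ip_lin in_V sc add field_simps)
    moreover have "(nrm (u m - u n))\<^sup>2 = 2 * ip (u m) (u m) + 2 * ip (u n) (u n) - ip (u m + u n) (u m + u n)"
      using u by (simp add: nrm_sq in_V ip_lin)
    ultimately have "(nrm (u m - u n))\<^sup>2 = 2 * J (u m) + 2 * J (u n) - 4 * J (sc (1/2) (u m + u n))"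
      by (simp add: J_def)
    then show ?thesis using u(2)[of m] u(2)[of n] I_le[OF h] by linarith
  qed
  obtain z where z: "z \<in> V" "(\<lambda>n. nrm (u n - z)) \<longlonglongrightarrow> 0"
  proof -
    have "\<exists>N. \<forall>m\<ge>N. \<forall>n\<ge>N. nrm (u m - u n) < e" if e: "e > 0" for e
    proof -
      obtain N where N: "4 / real (Suc N) < e\<^sup>2"
      proof -
        have "(\<lambda>n. 4 / real (Suc n)) \<longlonglongrightarrow> 0" by (rule LIMSEQ_Suc[OF lim_const_over_n])
        then have "eventually (\<lambda>n. 4 / real (Suc n) < e\<^sup>2) sequentially" by (rule order_tendstoD) (use e in simp)
        then show ?thesis using that by (auto simp: eventually_sequentially)
      qed
      have "nrm (u m - u n) < e" if mn: "m \<ge> N" "n \<ge> N" for m n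
      proof (rule power2_less_imp_less)
        have "1 / real (Suc m) \<le> 1 / real (Suc N)" "1 / real (Suc n) \<le> 1 / real (Suc N)"
          using mn by (auto simp: frac_le)
        moreover have "4 / real (Suc N) = 4 * (1 / real (Suc N))" by simp
        ultimately show "(nrm (u m - u n))\<^sup>2 < e\<^sup>2" using par[of m n] N by linarith
      qed (use e in simp)
      then show ?thesis by blast
    qed
    then show ?thesis using complete[of u] u(1) that by blast
  qed
  have Jz: "J z \<le> I"
  proof -
    have "(\<lambda>n. (nrm (u n))\<^sup>2) \<longlonglongrightarrow> (nrm z)\<^sup>2"
      by (intro tendsto_power nrm_tendsto u z)
    moreover have "(\<lambda>n. \<phi> (u n)) \<longlonglongrightarrow> \<phi> z"
    proof -
      have "(\<lambda>n. \<phi> (u n) - \<phi> z) \<longlonglongrightarrow> 0"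
      proof (rule Lim_null_comparison[OF always_eventually])
        show "\<forall>n. norm (\<phi> (u n) - \<phi> z) \<le> K * nrm (u n - z)"
        proof
          fix n
          have "\<phi> (u n - z) = \<phi> (u n) - \<phi> z" using add[of "u n - z" z] u(1)[of n] z(1) by (simp add: in_V)
          then show "norm (\<phi> (u n) - \<phi> z) \<le> K * nrm (u n - z)"
            using bd[of "u n - z"] u(1)[of n] z(1) by (simp add: in_V)
        qed
        show "(\<lambda>n. K * nrm (u n - z)) \<longlonglongrightarrow> 0" using tendsto_mult_right_zero[OF z(2)] .
      qed
      then show ?thesis by (simp add: LIM_zero_iff)
    qed
    ultimately have lim: "(\<lambda>n. J (u n)) \<longlonglongrightarrow> J z"
      unfolding J_def nrm_sq[OF u(1)] nrm_sq[OF z(1)] by (intro tendsto_diff tendsto_mult_left)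
    have "(\<lambda>n. I + 1 / real (Suc n)) \<longlonglongrightarrow> I + 0"
      by (intro tendsto_add tendsto_const LIMSEQ_Suc[OF lim_const_over_n])
    then have "(\<lambda>n. I + 1 / real (Suc n)) \<longlonglongrightarrow> I" by simp
    from LIMSEQ_le[OF lim this] show ?thesis by (meson u(2) less_imp_le)
  qed
  have "\<phi> x = ip x z" if x: "x \<in> V" for x
  proof -
    define d where "d = ip x z - \<phi> x"
    have q: "0 \<le> 2 * t * d + t\<^sup>2 * ip x x" for t
    proof -
      have "J (z + sc t x) = J z + 2 * t * d + t\<^sup>2 * ip x x"
        using x z(1) ip_sym[OF x z(1)]
        by (simp add: J_def d_def ip_lin in_V add sc power2_eq_square algebra_simps)
      moreover have "I \<le> J (z + sc t x)" by (intro I_le in_V x z(1))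
      ultimately show ?thesis using Jz by linarith
    qed
    have "d = 0"
    proof (rule ccontr)
      assume d: "d \<noteq> 0"
      \<comment> \<open>The summand 1 avoids a division by zero for null \<open>x\<close>; the value
        \<open>t = - d / w\<close> still makes the quadratic at most
        \<open>- d\<^sup>2 / w\<close>.\<close>
      define w where "w = ip x x + 1"
      have p: "w > 0" using ip_pos[OF x] by (simp add: w_def)
      have "0 \<le> 2 * (- d / w) * d + (- d / w)\<^sup>2 * ip x x" by (rule q)
      also have "\<dots> \<le> 2 * (- d / w) * d + (- d / w)\<^sup>2 * w"
        by (intro add_left_mono mult_left_mono) (auto simp: w_def)
      also have "\<dots> = - (d\<^sup>2 / w)" using p by (simp add: power2_eq_square field_simps)
      finally show False using d p by (simp add: field_simps)
    qed
    then show ?thesis by (simp add: d_def)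
  qed
  then show ?thesis using z(1) by blast
qed

lemma adjoint_exists:
  assumes T: "\<And>x. x \<in> V \<Longrightarrow> T x \<in> V"
    and add: "\<And>x y. x \<in> V \<Longrightarrow> y \<in> V \<Longrightarrow> eqv (T (x + y)) (T x + T y)"
    and sc: "\<And>a x. x \<in> V \<Longrightarrow> eqv (T (sc a x)) (sc a (T x))"
    and bd: "\<And>x. x \<in> V \<Longrightarrow> nrm (T x) \<le> K * nrm x"
  shows "\<exists>S. adj T S"
proof -
  have "\<exists>z\<in>V. \<forall>x\<in>V. ip (T x) y = ip x z" if y: "y \<in> V" for y
  proof (rule riesz_representation)
    fix x assume x: "x \<in> V"
    have "\<bar>ip (T x) y\<bar> \<le> nrm (T x) * nrm y" by (rule abs_ip_le[OF T[OF x] y])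
    also have "\<dots> \<le> K * nrm x * nrm y" using bd[OF x] nrm_nonneg[OF y] by (rule mult_right_mono)
    finally show "\<bar>ip (T x) y\<bar> \<le> (K * nrm y) * nrm x" by (simp add: algebra_simps)
  next
    fix x x' assume x: "x \<in> V" "x' \<in> V"
    show "ip (T (x + x')) y = ip (T x) y + ip (T x') y"
      using eqv_ip[OF add[OF x] y] T x y by (simp add: ip_lin)
  next
    fix a x assume x: "x \<in> V"
    show "ip (T (sc a x)) y = a * ip (T x) y"
      using eqv_ip[OF sc[OF x] y] T x y by (simp add: ip_lin)
  qed
  then obtain S where "\<And>y. y \<in> V \<Longrightarrow> S y \<in> V" "\<And>x y. y \<in> V \<Longrightarrow> x \<in> V \<Longrightarrow> ip (T x) y = ip x (S y)" by metis
  then show ?thesis using T unfolding adj_def by blast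
qed

lemma neumann_series:
  assumes T: "adj T S" and q: "0 \<le> q" "q < 1" and bd: "\<And>x. x \<in> V \<Longrightarrow> nrm (T x) \<le> q * nrm x"
    and y: "y \<in> V"
  shows "\<exists>x\<in>V. eqv (x - T x) y"
proof -
  \<comment> \<open>The partial sums of the series, up to null vectors, written as a fixed point
    iteration.\<close>
  define u where "u n = ((\<lambda>x. y + T x) ^^ n) 0" for n
  have u_Suc: "u (Suc n) = y + T (u n)" for n by (simp add: u_def)
  have u: "u n \<in> V" for n
    by (induction n) (auto simp: u_def zero_in intro!: add_in y adj_in[OF T])
  have step: "nrm (u (Suc n) - u n) \<le> q ^ n * nrm y" for n
  proof (induction n)
    case 0
    \<comment> \<open>\<open>T\<close> is linear only up to null vectors, so \<open>T 0\<close> need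
      not be 0.\<close>
    have "nrm (T 0) \<le> q * nrm 0" by (rule bd[OF zero_in])
    moreover have "nrm 0 = 0" using ip_diff[of y y 0] y zero_in by (simp add: nrm_def)
    ultimately have "nrm (T 0) \<le> 0" by simp
    then show ?case using nrm_triangle[OF y adj_in[OF T zero_in]] by (simp add: u_def)
  next
    case (Suc n)
    have "u (Suc (Suc n)) - u (Suc n) = T (u (Suc n)) - T (u n)" by (simp add: u_Suc)
    then have "nrm (u (Suc (Suc n)) - u (Suc n)) \<le> q * nrm (u (Suc n) - u n)"
      using adj_diff_nrm_le[OF T bd u u] by simp
    also have "\<dots> \<le> q * (q ^ n * nrm y)" using Suc q by (intro mult_left_mono) auto
    finally show ?case by simp
  qed
  define K where "K = nrm y / (1 - q)"
  have K: "K \<ge> 0" using nrm_nonneg[OF y] q by (simp add: K_def)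
  \<comment> \<open>The exact geometric sum is what the induction on \<open>k\<close> reproduces;
    the factor \<open>1 - q ^ k\<close> is dropped afterwards.\<close>
  have tail: "nrm (u (n + k) - u n) \<le> K * q ^ n * (1 - q ^ k)" for n k
  proof (induction k)
    case 0 then show ?case using u[of n] ip_diff[of "u n" "u n" 0] zero_in by (simp add: nrm_def)
  next
    case (Suc k)
    have "nrm (u (n + Suc k) - u n) \<le> nrm (u (Suc (n + k)) - u (n + k)) + nrm (u (n + k) - u n)"
      using nrm_diff_triangle[OF u u u, of "Suc (n + k)" n "n + k"] by simp
    also have "\<dots> \<le> q ^ (n + k) * nrm y + K * q ^ n * (1 - q ^ k)"
      using step[of "n + k"] Suc by linarith
    also have "\<dots> = K * q ^ n * (1 - q ^ Suc k)"
      using q by (simp add: K_def power_add field_simps)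
    finally show ?case .
  qed
  have tail': "nrm (u (n + k) - u n) \<le> K * q ^ n" for n k
    using tail[of n k] K q by (smt (verit) mult_left_le mult_nonneg_nonneg zero_le_power)
  have lim0: "(\<lambda>n. K * q ^ n) \<longlonglongrightarrow> 0"
    using tendsto_mult_right_zero[OF LIMSEQ_power_zero[of q]] q by simp
  obtain x where x: "x \<in> V" "(\<lambda>n. nrm (u n - x)) \<longlonglongrightarrow> 0"
  proof -
    have "\<exists>N. \<forall>m\<ge>N. \<forall>n\<ge>N. nrm (u m - u n) < e" if e: "e > 0" for e
    proof -
      obtain N where N: "K * q ^ N < e / 2"
        using order_tendstoD(2)[OF lim0, of "e / 2"] e by (auto simp: eventually_sequentially)
      have "nrm (u m - u n) < e" if "m \<ge> N" "n \<ge> N" for m n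
      proof -
        have "nrm (u m - u n) \<le> nrm (u m - u N) + nrm (u N - u n)" by (rule nrm_diff_triangle[OF u u u])
        also have "\<dots> = nrm (u (N + (m - N)) - u N) + nrm (u (N + (n - N)) - u N)"
          using that nrm_diff_commute[OF u u, of N n] by simp
        also have "\<dots> \<le> K * q ^ N + K * q ^ N" by (intro add_mono tail')
        finally show ?thesis using N by simp
      qed
      then show ?thesis by blast
    qed
    then show ?thesis using complete[of u] u that by blast
  qed
  have "nrm (x - T x - y) \<le> 0"
  proof (rule LIMSEQ_le_const)
    show "(\<lambda>n. nrm (u (Suc n) - x) + q * nrm (u n - x)) \<longlonglongrightarrow> 0"
      using tendsto_add[OF LIMSEQ_Suc[OF x(2)] tendsto_mult_right_zero[OF x(2), of q]] by simp
    show "\<exists>N. \<forall>n\<ge>N. nrm (x - T x - y) \<le> nrm (u (Suc n) - x) + q * nrm (u n - x)"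
    proof (intro exI allI impI)
      fix n
      have Tx: "T x \<in> V" "T (u n) \<in> V" using adj_in[OF T] x u by auto
      have eq: "x - T x - y = (x - u (Suc n)) + (T (u n) - T x)" by (simp add: u_Suc)
      have "nrm (x - T x - y) \<le> nrm (x - u (Suc n)) + nrm (T (u n) - T x)"
        unfolding eq by (rule nrm_triangle) (intro in_V x u Tx)+
      then show "nrm (x - T x - y) \<le> nrm (u (Suc n) - x) + q * nrm (u n - x)"
        using adj_diff_nrm_le[OF T bd u[of n] x(1)] nrm_diff_commute[OF x(1) u, of "Suc n"] by simp
    qed
  qed
  moreover have xT: "x - T x \<in> V" using x(1) adj_in[OF T] by (simp add: diff_in)
  ultimately have "nrm (x - T x - y) = 0" using nrm_nonneg[OF diff_in[OF xT y]] by simp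
  then have "eqv (x - T x) y" by (simp add: eqv_iff[OF xT y])
  then show ?thesis using x by blast
qed

text \<open>Fixed vectors are limits of the iterates, so the iterates of a vector orthogonal to all of
  them vanish in the limit; this makes the range of \<open>1 - Q\<close> dense in that orthogonal complement.\<close>

lemma positive_iterates_tendsto_zero:
  assumes Q: "adj Q Q" and Q1: "\<And>x. x \<in> V \<Longrightarrow> ip (Q x) (Q x) \<le> ip (Q x) x"
    and g: "g \<in> V" and orth: "\<And>x. x \<in> V \<Longrightarrow> eqv (Q x) x \<Longrightarrow> ip x g = 0"
  shows "(\<lambda>n. nrm ((Q ^^ n) g)) \<longlonglongrightarrow> 0"
proof -
  have QV: "Q x \<in> V" if "x \<in> V" for x using adj_in[OF Q that] .
  have Q2: "ip (Q x) x \<le> ip x x" if "x \<in> V" for x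
    by (rule firmly_nonexpansive_form_le[OF that QV[OF that] Q1[OF that]])
  define u where "u n = (Q ^^ n) g" for n
  have u: "u n \<in> V" for n unfolding u_def by (rule adj_in[OF adj_funpow[OF Q] g])
  have u_Suc: "u (Suc n) = Q (u n)" for n by (simp add: u_def)
  \<comment> \<open>The moments of \<open>Q\<close> at \<open>g\<close>. By self-adjointness the
    inner product of two iterates depends only on the sum of their indices, so convergence of this
    one real sequence controls all distances.\<close>
  define a where "a n = ip (u n) g" for n
  have au: "ip (u m) (u n) = a (m + n)" for m n
    unfolding a_def u_def using adj_ip[OF adj_funpow[OF Q, of n], of "(Q ^^ m) g" g] u[of m] g
    by (simp add: u_def funpow_add add.commute[of m])
  have a_even: "a (2 * n) = ip (u n) (u n)" and a_odd: "a (Suc (2 * n)) = ip (Q (u n)) (u n)"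
    and a_even2: "a (2 * Suc n) = ip (Q (u n)) (Q (u n))" for n
    using au[of n n] au[of "Suc n" n] au[of "Suc n" "Suc n"] by (simp_all add: u_Suc mult_2)
  \<comment> \<open>At \<open>u k\<close>, leaving an even index is \<open>Q \<le> 1\<close> and
    leaving an odd index is \<open>Q\<^sup>2 \<le> Q\<close>.\<close>
  have dec1: "a (Suc n) \<le> a n" for n
  proof (cases "even n")
    case True then obtain k where "n = 2 * k" by (elim evenE)
    then show ?thesis using a_even[of k] a_odd[of k] Q2[OF u[of k]] by simp
  next
    case False then obtain k where "n = 2 * k + 1" by (elim oddE)
    then show ?thesis using a_even2[of k] a_odd[of k] Q1[OF u[of k]] by simp
  qed
  have a0: "0 \<le> a n" for n
  proof -
    have "0 \<le> a (2 * n)" unfolding a_even by (rule ip_pos[OF u])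
    also have "\<dots> \<le> a n" by (rule lift_Suc_antimono_le[of a, OF dec1]) simp
    finally show ?thesis .
  qed
  have "decseq a" using dec1 by (simp add: decseq_Suc_iff)
  then obtain L where L: "a \<longlonglongrightarrow> L" using decseq_convergent[of a 0] a0 by blast
  obtain x where x: "x \<in> V" "(\<lambda>n. nrm (u n - x)) \<longlonglongrightarrow> 0"
  proof -
    have "\<exists>N. \<forall>m\<ge>N. \<forall>n\<ge>N. nrm (u m - u n) < e" if e: "e > 0" for e
    proof -
      \<comment> \<open>A quarter, because the squared distance combines moments with weights 1, -2
        and 1, and the contributions of \<open>L\<close> cancel.\<close>
      obtain N where N: "\<And>n. n \<ge> N \<Longrightarrow> \<bar>a n - L\<bar> < e\<^sup>2 / 4"
        using LIMSEQ_D[OF L, of "e\<^sup>2 / 4"] e by auto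
      have "nrm (u m - u n) < e" if "m \<ge> N" "n \<ge> N" for m n
      proof (rule power2_less_imp_less)
        have "(nrm (u m - u n))\<^sup>2 = a (m + m) - 2 * a (m + n) + a (n + n)"
          using u au[of m m] au[of m n] au[of n m] au[of n n] by (simp add: nrm_sq in_V ip_lin add.commute)
        then show "(nrm (u m - u n))\<^sup>2 < e\<^sup>2"
          using N[of "m + m"] N[of "m + n"] N[of "n + n"] that unfolding abs_less_iff by linarith
      qed (use e in simp)
      then show ?thesis by blast
    qed
    then show ?thesis using complete[of u] u that by blast
  qed
  have fix_x: "eqv (Q x) x"
    unfolding eqv_def
  proof
    fix z assume z: "z \<in> V"
    have "(\<lambda>n. ip (u (Suc n)) z) \<longlonglongrightarrow> ip x z" using LIMSEQ_Suc[OF ip_tendsto[OF u x(1) z x(2)]] .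
    moreover have "(\<lambda>n. ip (u (Suc n)) z) \<longlonglongrightarrow> ip (Q x) z"
      using ip_tendsto[OF u x(1) QV[OF z] x(2)] adj_ip[OF Q u z] adj_ip[OF Q x(1) z] by (simp add: u_Suc)
    ultimately show "ip (Q x) z = ip x z" using LIMSEQ_unique by blast
  qed
  \<comment> \<open>The limit \<open>x\<close> is fixed by \<open>Q\<close>, hence orthogonal to
    \<open>g\<close> and to every iterate of \<open>g\<close>, and therefore to itself.\<close>
  have "ip (u n) x = 0" for n
  proof (induction n)
    case 0 then show ?case using orth[OF x(1) fix_x] ip_sym[OF g x(1)] by (simp add: u_def)
  next
    case (Suc n)
    have "ip (u (Suc n)) x = ip (u n) (Q x)" using adj_ip[OF Q u x(1)] by (simp add: u_Suc)
    also have "\<dots> = ip (u n) x" using eqv_ip_right[OF fix_x QV[OF x(1)] x(1) u] .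
    finally show ?case using Suc by simp
  qed
  then have "ip x x = 0" using ip_tendsto[OF u x(1) x(1) x(2)] LIMSEQ_unique[OF _ tendsto_const] by fastforce
  then have "nrm x = 0" by (simp add: nrm_def)
  then show ?thesis using nrm_tendsto[OF u x] by (simp add: u_def)
qed

text \<open>\<mu> may be negative. As \<open>ip (Q g) g\<close> is nonnegative, \<open>g\<close> is
  then null; this is how a gap above 1 is excluded later.\<close>

lemma spectral_gap_imp_contraction:
  assumes Q: "adj Q Q" and Q1: "\<And>x. x \<in> V \<Longrightarrow> ip (Q x) (Q x) \<le> ip (Q x) x"
    and \<mu>: "\<mu> < 1"
    and res: "\<And>l. \<mu> < l \<Longrightarrow> l < 1 \<Longrightarrow> \<exists>\<kappa>>0. \<forall>x\<in>V. \<kappa> * nrm x \<le> nrm (Q x - sc l x)"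
    and g: "g \<in> V" and orth: "\<And>x. x \<in> V \<Longrightarrow> eqv (Q x) x \<Longrightarrow> ip x g = 0"
  shows "ip (Q g) g \<le> \<mu> * ip g g"
proof -
  have QV: "Q x \<in> V" if "x \<in> V" for x using adj_in[OF Q that] .
  have Q2: "ip (Q x) x \<le> ip x x" if "x \<in> V" for x
    by (rule firmly_nonexpansive_form_le[OF that QV[OF that] Q1[OF that]])
  have contr: "nrm (Q x) \<le> nrm x" if "x \<in> V" for x
    using order_trans[OF Q1 Q2] that by (simp add: nrm_def)
  define c where "c = (1 + \<mu>) / 2"
  define r where "r = (1 - \<mu>) / 2"
  define \<delta> where "\<delta> = 1 - \<mu>"
  define B where "B x = x - Q x" for x
  have BV: "B x \<in> V" if "x \<in> V" for x using that QV in_V by (simp add: B_def)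
  have B: "adj B B" unfolding adj_def B_def using QV adj_ip[OF Q] by (simp add: in_V ip_lin)
  have Bpos: "0 \<le> ip (B x) x" if "x \<in> V" for x
    using Q2[OF that] that QV by (simp add: B_def ip_lin)
  \<comment> \<open>The open interval of radius \<open>r\<close> around \<open>c\<close> is exactly
    the one from \<mu> to 1, so \<open>res\<close> applies at \<open>c + l\<close> whenever
    \<open>\<bar>l\<bar> < r\<close>.\<close>
  have low: "r\<^sup>2 * ip x x \<le> ip (Q x - sc c x) (Q x - sc c x)" if x: "x \<in> V" for x
  proof (rule selfadjoint_lower_bound[OF adj_diff_sc[OF Q] _ _ _ x])
    show "0 \<le> r" using \<mu> by (simp add: r_def)
    show "nrm (Q x - sc c x) \<le> (1 + \<bar>c\<bar>) * nrm x" if x: "x \<in> V" for x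
    proof -
      have "nrm (Q x - sc c x) \<le> nrm (Q x) + nrm (sc c x)"
        by (rule nrm_triangle_diff) (intro in_V x QV)+
      then show ?thesis using contr[OF x] x by (simp add: nrm_sc algebra_simps)
    qed
    fix l assume l: "\<bar>l\<bar> < r"
    have "\<mu> < c + l" "c + l < 1" using l by (auto simp: c_def r_def abs_less_iff field_simps)
    then obtain \<kappa> where \<kappa>: "\<kappa> > 0" "\<And>x. x \<in> V \<Longrightarrow> \<kappa> * nrm x \<le> nrm (Q x - sc (c + l) x)"
      using res[of "c + l"] by blast
    have "nrm (Q x - sc c x - sc l x) = nrm (Q x - sc (c + l) x)" if x: "x \<in> V" for x
      by (rule eqv_nrm) (use x QV in_V in \<open>auto simp: eqv_def ip_lin algebra_simps\<close>)
    then show "\<exists>\<kappa>>0. \<forall>x\<in>V. \<kappa> * nrm x \<le> nrm (Q x - sc c x - sc l x)" using \<kappa> by auto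
  qed
  \<comment> \<open>Since \<open>c\<^sup>2 - r\<^sup>2 = \<mu>\<close> and
    \<open>2 * c = 1 + \<mu>\<close>, the bound \<open>low\<close> says that the product of
    \<open>1 - Q\<close> and \<open>\<mu> - Q\<close> is positive.\<close>
  have BB: "\<delta> * ip (B x) x \<le> ip (B x) (B x)" if x: "x \<in> V" for x
  proof -
    have "ip (Q x - sc c x) (Q x - sc c x) = ip (Q x) (Q x) - 2 * c * ip (Q x) x + c\<^sup>2 * ip x x"
      using x QV ip_sym[of x "Q x"] by (simp add: ip_lin in_V power2_eq_square algebra_simps)
    with low[OF x] have "r\<^sup>2 * ip x x \<le> ip (Q x) (Q x) - 2 * c * ip (Q x) x + c\<^sup>2 * ip x x" by simp
    moreover have r2: "r\<^sup>2 = c\<^sup>2 - \<mu>" and c2: "2 * c = 1 + \<mu>" by (simp_all add: r_def c_def power2_eq_square field_simps)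
    ultimately have "- \<mu> * ip x x \<le> ip (Q x) (Q x) - (1 + \<mu>) * ip (Q x) x"
      unfolding r2 c2 by (simp add: algebra_simps)
    moreover have hB: "ip (B x) x = ip x x - ip (Q x) x"
      and hBB: "ip (B x) (B x) = ip x x - 2 * ip (Q x) x + ip (Q x) (Q x)"
      using x QV ip_sym[of x "Q x"] by (simp_all add: ip_lin in_V B_def)
    ultimately show ?thesis unfolding \<delta>_def hB hBB by (simp add: algebra_simps)
  qed
  interpret F: semi_inner V sc "\<lambda>x y. ip (B x) y" by (rule positive_form[OF B Bpos])
  have \<delta>: "\<delta> > 0" using \<mu> by (simp add: \<delta>_def)
  \<comment> \<open>For \<open>h = B f\<close> the number \<open>ip h h\<close> is the form of
    \<open>B\<close> at \<open>f\<close> and \<open>h\<close>. In the Cauchy-Schwarz inequality for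
    that form, \<open>BB\<close> bounds the factor at \<open>f\<close> by
    \<open>ip h h / \<delta>\<close>, and one \<open>ip h h\<close> cancels.\<close>
  have range: "ip (Q (B f)) (B f) \<le> \<mu> * ip (B f) (B f)" if f: "f \<in> V" for f
  proof -
    let ?h = "B f"
    have h: "?h \<in> V" using BV f .
    have "(ip ?h ?h)\<^sup>2 \<le> ip (B f) f * ip (B ?h) ?h" using F.ip_Cauchy_Schwarz[OF f h] .
    also have "\<dots> \<le> (ip ?h ?h / \<delta>) * ip (B ?h) ?h"
      using BB[OF f] \<delta> Bpos[OF h] by (intro mult_right_mono) (auto simp: field_simps)
    finally have "\<delta> * ip ?h ?h * ip ?h ?h \<le> ip ?h ?h * ip (B ?h) ?h"
      using \<delta> by (simp add: field_simps power2_eq_square)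
    then have "\<delta> * ip ?h ?h \<le> ip (B ?h) ?h"
    proof (cases "ip ?h ?h = 0")
      case False
      then have "ip ?h ?h > 0" using ip_pos[OF h] by simp
      then show ?thesis using \<open>\<delta> * ip ?h ?h * ip ?h ?h \<le> ip ?h ?h * ip (B ?h) ?h\<close> by (simp add: mult.commute)
    qed (use Bpos[OF h] in simp)
    moreover have "ip (B ?h) ?h = ip ?h ?h - ip (Q ?h) ?h" using h QV by (simp add: B_def[of ?h] ip_lin)
    ultimately show ?thesis by (simp add: \<delta>_def algebra_simps)
  qed
  \<comment> \<open>By telescoping this is \<open>B\<close> applied to the sum of the first
    \<open>n\<close> iterates of \<open>g\<close>, up to null vectors.\<close>
  define u where "u n = g - (Q ^^ n) g" for n
  have QnV: "(Q ^^ n) g \<in> V" for n by (rule adj_in[OF adj_funpow[OF Q] g])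
  have u: "u n \<in> V" for n unfolding u_def by (intro in_V g QnV)
  have u_range: "\<exists>f\<in>V. eqv (B f) (u n)" for n
  proof (induction n)
    case 0
    have z0: "ip 0 z = 0" if "z \<in> V" for z using ip_diff[of 0 0 z] zero_in that by simp
    have "ip (0 - Q 0) z = 0" if "z \<in> V" for z
      using ip_diff[OF zero_in QV[OF zero_in] that] adj_ip[OF Q zero_in that] z0 QV that by simp
    then have "eqv (B 0) (u 0)" unfolding eqv_def B_def u_def using z0 by simp
    then show ?case using zero_in by blast
  next
    case (Suc n)
    then obtain f where f: "f \<in> V" "eqv (B f) (u n)" by blast
    have "eqv (B (f + (Q ^^ n) g)) (u (Suc n))"
      unfolding eqv_def
    proof
      fix z assume z: "z \<in> V"
      have "ip (B (f + (Q ^^ n) g)) z = ip (B f) z + ip (B ((Q ^^ n) g)) z"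
        using eqv_ip[OF adj_add[OF B f(1) QnV] z] BV f QnV z by (simp add: ip_lin)
      also have "\<dots> = ip (u n) z + ip (B ((Q ^^ n) g)) z" using eqv_ip[OF f(2) z] by simp
      also have "\<dots> = ip (u (Suc n)) z"
        using z g QnV QV by (simp add: u_def B_def ip_lin in_V)
      finally show "ip (B (f + (Q ^^ n) g)) z = ip (u (Suc n)) z" .
    qed
    then show ?case using add_in[OF f(1) QnV] by blast
  qed
  have bound: "ip (Q (u n)) (u n) \<le> \<mu> * ip (u n) (u n)" for n
  proof -
    obtain f where f: "f \<in> V" "eqv (B f) (u n)" using u_range by blast
    have "ip (Q (B f)) (B f) = ip (Q (u n)) (u n)"
      using eqv_ip[OF adj_cong[OF Q f(2) BV[OF f(1)] u] BV[OF f(1)]] eqv_ip_right[OF f(2) BV[OF f(1)] u QV[OF u[of n]]] by simp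
    moreover have "ip (B f) (B f) = ip (u n) (u n)"
      using eqv_ip[OF f(2) BV[OF f(1)]] eqv_ip_right[OF f(2) BV[OF f(1)] u u[of n]] by simp
    ultimately show ?thesis using range[OF f(1)] by simp
  qed
  have lim: "(\<lambda>n. nrm (u n - g)) \<longlonglongrightarrow> 0"
  proof -
    have "nrm (u n - g) = nrm ((Q ^^ n) g)" for n
      using nrm_diff_commute[OF u g, of n] by (simp add: u_def)
    then show ?thesis using positive_iterates_tendsto_zero[OF Q Q1 g orth] by simp
  qed
  have lim1: "(\<lambda>n. ip (u n) (u n)) \<longlonglongrightarrow> ip g g"
    using tendsto_power[OF nrm_tendsto[OF u g lim], of 2] u g by (simp add: nrm_sq)
  have lim2: "(\<lambda>n. ip (Q (u n)) (u n)) \<longlonglongrightarrow> ip (Q g) g"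
  proof -
    have limQ: "(\<lambda>n. nrm (Q (u n) - Q g)) \<longlonglongrightarrow> 0"
    proof (rule tendsto_sandwich[OF _ _ tendsto_const lim]; rule always_eventually; rule allI)
      fix n
      show "0 \<le> nrm (Q (u n) - Q g)" by (intro nrm_nonneg in_V u g QV)
      show "nrm (Q (u n) - Q g) \<le> nrm (u n - g)"
        using adj_diff_nrm_le[OF Q _ u g, of 1] contr by simp
    qed
    have "(\<lambda>n. ip (Q (u n)) (u n) - ip (Q g) (u n)) \<longlonglongrightarrow> 0"
    proof (rule Lim_null_comparison[OF always_eventually])
      show "\<forall>n. norm (ip (Q (u n)) (u n) - ip (Q g) (u n)) \<le> nrm (Q (u n) - Q g) * nrm (u n)"
        using abs_ip_le[of "Q (u _) - Q g" "u _"] u QV g in_V by (simp add: ip_diff)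
      show "(\<lambda>n. nrm (Q (u n) - Q g) * nrm (u n)) \<longlonglongrightarrow> 0"
        using tendsto_mult[OF limQ nrm_tendsto[OF u g lim]] by simp
    qed
    moreover have "(\<lambda>n. ip (Q g) (u n)) \<longlonglongrightarrow> ip (Q g) g"
      using ip_tendsto[OF u g QV[OF g] lim] ip_sym QV g u by simp
    ultimately show ?thesis using tendsto_add by fastforce
  qed
  show ?thesis
    by (rule LIMSEQ_le[OF lim2 tendsto_mult_left[OF lim1]]) (use bound in blast)
qed

end

section \<open>The space \<open>L\<^sup>2\<close>\<close>

lemma L2_measurable: "f \<in> L2 M \<Longrightarrow> f \<in> borel_measurable M"
  and L2_integrable: "f \<in> L2 M \<Longrightarrow> integrable M (\<lambda>x. (cmod (f x))\<^sup>2)"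
  and L2I: "f \<in> borel_measurable M \<Longrightarrow> integrable M (\<lambda>x. (cmod (f x))\<^sup>2) \<Longrightarrow> f \<in> L2 M"
  by (auto simp: L2_def)

lemma L2_mult_integrable:
  assumes "f \<in> L2 M" "g \<in> L2 M"
  shows "integrable M (\<lambda>x. f x * cnj (g x))"
proof (rule Bochner_Integration.integrable_bound)
  note [measurable] = L2_measurable[OF assms(1)] L2_measurable[OF assms(2)]
  show "integrable M (\<lambda>x. (cmod (f x))\<^sup>2 + (cmod (g x))\<^sup>2)"
    using assms by (intro Bochner_Integration.integrable_add L2_integrable)
  have "cnj \<in> borel_measurable borel"
    by (intro borel_measurable_continuous_onI continuous_intros)
  then show "(\<lambda>x. f x * cnj (g x)) \<in> borel_measurable M" by measurable
  have "cmod (f x) * cmod (g x) \<le> (cmod (f x))\<^sup>2 + (cmod (g x))\<^sup>2" for x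
    using sum_squares_bound[of "cmod (f x)" "cmod (g x)"]
      mult_nonneg_nonneg[OF norm_ge_zero norm_ge_zero, of "f x" "g x"] by linarith
  then show "AE x in M. norm (f x * cnj (g x)) \<le> norm ((cmod (f x))\<^sup>2 + (cmod (g x))\<^sup>2)"
    by (simp add: norm_mult)
qed

lemma L2_add:
  assumes "f \<in> L2 M" "g \<in> L2 M" shows "(\<lambda>x. f x + g x) \<in> L2 M"
proof (rule L2I)
  note [measurable] = L2_measurable[OF assms(1)] L2_measurable[OF assms(2)]
  show "(\<lambda>x. f x + g x) \<in> borel_measurable M" by measurable
  show "integrable M (\<lambda>x. (cmod (f x + g x))\<^sup>2)"
  proof (rule Bochner_Integration.integrable_bound)
    show "integrable M (\<lambda>x. 2 * (cmod (f x))\<^sup>2 + 2 * (cmod (g x))\<^sup>2)"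
      using assms by (intro Bochner_Integration.integrable_add integrable_mult_right L2_integrable)
    have "(cmod (f x + g x))\<^sup>2 \<le> 2 * (cmod (f x))\<^sup>2 + 2 * (cmod (g x))\<^sup>2" for x
    proof -
      have "(cmod (f x + g x))\<^sup>2 \<le> (cmod (f x) + cmod (g x))\<^sup>2"
        by (intro power_mono norm_triangle_ineq) simp
      then show ?thesis using sum_squares_bound[of "cmod (f x)" "cmod (g x)"] by (simp add: power2_sum)
    qed
    then show "AE x in M. norm ((cmod (f x + g x))\<^sup>2) \<le> norm (2 * (cmod (f x))\<^sup>2 + 2 * (cmod (g x))\<^sup>2)"
      by simp
  qed measurable
qed

lemma L2_cmult:
  assumes "f \<in> L2 M" shows "(\<lambda>x. c * f x) \<in> L2 M"
proof (rule L2I)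
  note [measurable] = L2_measurable[OF assms(1)]
  show "(\<lambda>x. c * f x) \<in> borel_measurable M" by measurable
  show "integrable M (\<lambda>x. (cmod (c * f x))\<^sup>2)"
    using L2_integrable[OF assms] by (simp add: norm_mult power_mult_distrib)
qed

lemma L2_diff:
  assumes "f \<in> L2 M" "g \<in> L2 M" shows "(\<lambda>x. f x - g x) \<in> L2 M"
  using L2_add[OF assms(1) L2_cmult[OF assms(2), of "-1"]] by simp

lemma L2_inner_add: "f \<in> L2 M \<Longrightarrow> g \<in> L2 M \<Longrightarrow> h \<in> L2 M \<Longrightarrow>
    L2_inner M (\<lambda>x. f x + g x) h = L2_inner M f h + L2_inner M g h"
  by (simp add: L2_inner_def distrib_right L2_mult_integrable)

lemma L2_inner_cmult: "L2_inner M (\<lambda>x. c * f x) h = c * L2_inner M f h"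
  by (simp add: L2_inner_def mult.assoc)

lemma L2_inner_commute: "L2_inner M f g = cnj (L2_inner M g f)"
proof -
  have "L2_inner M f g = (\<integral>x. cnj (g x * cnj (f x)) \<partial>M)"
    by (simp add: L2_inner_def mult.commute)
  also have "\<dots> = cnj (L2_inner M g f)" unfolding L2_inner_def by (rule Bochner_Integration.integral_cnj)
  finally show ?thesis .
qed

lemma L2_inner_self: "L2_inner M f f = complex_of_real (\<integral>x. (cmod (f x))\<^sup>2 \<partial>M)"
  unfolding L2_inner_def complex_norm_square[symmetric] by (rule integral_complex_of_real)

lemma L2_norm_sq: "(L2_norm M f)\<^sup>2 = (\<integral>x. (cmod (f x))\<^sup>2 \<partial>M)"
  by (simp add: L2_norm_def)

lemma nn_integral_L2: "f \<in> L2 M \<Longrightarrow> (\<integral>\<^sup>+x. ennreal ((cmod (f x))\<^sup>2) \<partial>M) = ennreal ((L2_norm M f)\<^sup>2)"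
  by (simp add: L2_norm_sq nn_integral_eq_integral L2_integrable)

lemma L2_norm_eq_0_iff:
  assumes "f \<in> L2 M" shows "L2_norm M f = 0 \<longleftrightarrow> (AE x in M. f x = 0)"
  using integral_nonneg_eq_0_iff_AE[OF L2_integrable[OF assms]] by (simp add: L2_norm_def)

text \<open>The complex space is treated as a real one. The complex inner product is recovered in
  \<open>L2_inner_eqI\<close> from the real parts for \<open>f\<close> and for \<open>\<i>\<close>
  times \<open>f\<close>.\<close>

abbreviation L2_ip :: "'a measure \<Rightarrow> ('a \<Rightarrow> complex) \<Rightarrow> ('a \<Rightarrow> complex) \<Rightarrow> real" where
  "L2_ip M f g \<equiv> Re (L2_inner M f g)"

abbreviation L2_sc :: "real \<Rightarrow> ('a \<Rightarrow> complex) \<Rightarrow> ('a \<Rightarrow> complex)" where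
  "L2_sc a f \<equiv> (\<lambda>x. complex_of_real a * f x)"

lemma fun_add_eq: "(f + g) = (\<lambda>x. f x + g x)" for f g :: "'a \<Rightarrow> 'b::plus"
  by (simp add: fun_eq_iff)

lemma fun_diff_eq: "(f - g) = (\<lambda>x. f x - g x)" for f g :: "'a \<Rightarrow> 'b::minus"
  by (simp add: fun_eq_iff)

lemma semi_inner_L2: "semi_inner (L2 M) L2_sc (L2_ip M)"
proof
  show "0 \<in> L2 M" by (auto intro!: L2I simp: zero_fun_def)
next
  fix f g :: "'a \<Rightarrow> complex" assume fg: "f \<in> L2 M" "g \<in> L2 M"
  show "f + g \<in> L2 M" unfolding fun_add_eq by (rule L2_add[OF fg])
  show "f - g \<in> L2 M" unfolding fun_diff_eq by (rule L2_diff[OF fg])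
  show "L2_ip M (L2_sc a f) g = a * L2_ip M f g" for a by (simp add: L2_inner_cmult)
  show "L2_ip M f g = L2_ip M g f" by (subst L2_inner_commute) simp
  fix h assume "h \<in> L2 M"
  then show "L2_ip M (f + g) h = L2_ip M f h + L2_ip M g h"
    unfolding fun_add_eq using L2_inner_add[OF fg] by simp
next
  fix f :: "'a \<Rightarrow> complex" and a assume f: "f \<in> L2 M"
  show "L2_sc a f \<in> L2 M" by (rule L2_cmult[OF f])
  show "0 \<le> L2_ip M f f" by (simp add: L2_inner_self)
qed

lemma L2_nrm: "semi_inner.nrm (L2_ip M) = L2_norm M"
  by (rule ext) (simp add: semi_inner.nrm_def[OF semi_inner_L2] L2_inner_self L2_norm_def)

lemma (in prob_space) L1_le_L2:
  assumes f: "f \<in> L2 M" shows "integrable M f" "(\<integral>x. cmod (f x) \<partial>M) \<le> L2_norm M f"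
proof -
  note [measurable] = L2_measurable[OF f]
  have one: "(\<lambda>x. 1) \<in> L2 M" by (rule L2I) auto
  have cf: "(\<lambda>x. complex_of_real (cmod (f x))) \<in> L2 M"
    by (rule L2I) (use L2_integrable[OF f] in auto)
  show "integrable M f" using L2_mult_integrable[OF f one] by simp
  have "L2_ip M (\<lambda>x. complex_of_real (cmod (f x))) (\<lambda>x. 1) \<le> L2_norm M (\<lambda>x. complex_of_real (cmod (f x))) * L2_norm M (\<lambda>x. 1)"
    using semi_inner.ip_le[OF semi_inner_L2 cf one] by (simp add: L2_nrm)
  then show "(\<integral>x. cmod (f x) \<partial>M) \<le> L2_norm M f"
    by (simp add: L2_inner_def L2_norm_def prob_space)
qed

text \<open>A rapidly converging subsequence has increments summable in \<open>L1\<close>, so it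
  converges almost everywhere; Fatou's lemma then transfers the Cauchy estimates to its
  limit.\<close>

lemma (in prob_space) L2_complete:
  assumes u: "\<And>n. u n \<in> L2 M"
    and cauchy: "\<And>e. e > 0 \<Longrightarrow> \<exists>N. \<forall>m\<ge>N. \<forall>n\<ge>N. L2_norm M (\<lambda>x. u m x - u n x) < e"
  shows "\<exists>f\<in>L2 M. (\<lambda>n. L2_norm M (\<lambda>x. u n x - f x)) \<longlonglongrightarrow> 0"
proof -
  have [measurable]: "u n \<in> borel_measurable M" for n by (rule L2_measurable[OF u])
  have "\<exists>N. \<forall>m\<ge>N. \<forall>n\<ge>N. L2_norm M (\<lambda>x. u m x - u n x) < (1/2)^k" for k
    by (rule cauchy) simp
  then obtain N where N: "\<And>k m n. m \<ge> N k \<Longrightarrow> n \<ge> N k \<Longrightarrow> L2_norm M (\<lambda>x. u m x - u n x) < (1/2)^k"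
    by metis
  \<comment> \<open>Summing makes the indices monotone while keeping them above
    \<open>N k\<close>.\<close>
  define r where "r k = (\<Sum>i\<le>k. N i)" for k
  have rN: "r k \<ge> N k" for k unfolding r_def by (rule member_le_sum) auto
  have rmono: "r j \<le> r k" if "j \<le> k" for j k unfolding r_def using that by (intro sum_mono2) auto
  define w where "w k x = cmod (u (r (Suc k)) x - u (r k) x)" for k x
  have [measurable]: "w k \<in> borel_measurable M" for k unfolding w_def by measurable
  have wint: "(\<integral>\<^sup>+x. ennreal (w k x) \<partial>M) \<le> ennreal ((1/2)^k)" for k
  proof -
    have d: "(\<lambda>x. u (r (Suc k)) x - u (r k) x) \<in> L2 M" by (rule L2_diff[OF u u])
    have "(\<integral>\<^sup>+x. ennreal (w k x) \<partial>M) = ennreal (\<integral>x. w k x \<partial>M)"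
      unfolding w_def using L1_le_L2(1)[OF d] by (intro nn_integral_eq_integral) auto
    also have "\<dots> \<le> ennreal ((1/2)^k)"
    proof (rule ennreal_leI)
      have "(\<integral>x. w k x \<partial>M) \<le> L2_norm M (\<lambda>x. u (r (Suc k)) x - u (r k) x)"
        unfolding w_def by (rule L1_le_L2(2)[OF d])
      also have "\<dots> < (1/2)^k" by (rule N) (use rN[of k] rmono[of k "Suc k"] in auto)
      finally show "(\<integral>x. w k x \<partial>M) \<le> (1/2)^k" by simp
    qed
    finally show ?thesis .
  qed
  have "(\<integral>\<^sup>+x. (\<Sum>k. ennreal (w k x)) \<partial>M) = (\<Sum>k. \<integral>\<^sup>+x. ennreal (w k x) \<partial>M)"
    by (rule nn_integral_suminf) measurable
  also have "\<dots> \<le> (\<Sum>k. ennreal ((1/2)^k))"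
    by (rule suminf_le[OF wint]) auto
  also have "\<dots> = ennreal (\<Sum>k. (1/2)^k)"
    by (rule suminf_ennreal2) (auto intro: summable_geometric)
  finally have fin: "(\<integral>\<^sup>+x. (\<Sum>k. ennreal (w k x)) \<partial>M) \<noteq> \<infinity>" by (auto simp: top_unique)
  have "AE x in M. (\<Sum>k. ennreal (w k x)) \<noteq> \<infinity>"
    by (rule nn_integral_noteq_infinite[OF _ fin]) measurable
  then have conv: "AE x in M. convergent (\<lambda>k. u (r k) x)"
  proof eventually_elim
    case (elim x)
    have "summable (\<lambda>k. w k x)"
      by (rule summable_suminf_not_top) (use elim in \<open>auto simp: w_def\<close>)
    then have "summable (\<lambda>k. u (r (Suc k)) x - u (r k) x)"
      unfolding w_def by (rule summable_norm_cancel)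
    then have "convergent (\<lambda>n. \<Sum>k<n. u (r (Suc k)) x - u (r k) x)"
      by (simp add: summable_iff_convergent)
    then have "convergent (\<lambda>n. u (r n) x - u (r 0) x)"
      by (simp add: sum_lessThan_telescope[of "\<lambda>k. u (r k) x"])
    then show ?case
      using convergent_diff_const_right_iff by blast
  qed
  define f where "f x = lim (\<lambda>k. u (r k) x)" for x
  have [measurable]: "f \<in> borel_measurable M"
    unfolding f_def by (rule borel_measurable_lim_metric) measurable
  have lim: "AE x in M. (\<lambda>k. u (r k) x) \<longlonglongrightarrow> f x"
    using conv by eventually_elim (simp add: f_def convergent_LIMSEQ_iff)
  \<comment> \<open>Fatou along the subsequence with \<open>n\<close> fixed. The extended integral
    is used since \<open>f\<close> is not yet known to be square integrable; that is a consequence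
    of this bound.\<close>
  have bound: "(\<integral>\<^sup>+x. ennreal ((cmod (u n x - f x))\<^sup>2) \<partial>M) \<le> ennreal (((1/2)^j)\<^sup>2)" if n: "n \<ge> r j" for n j
  proof -
    have "(\<integral>\<^sup>+x. ennreal ((cmod (u n x - f x))\<^sup>2) \<partial>M)
        = (\<integral>\<^sup>+x. liminf (\<lambda>k. ennreal ((cmod (u n x - u (r k) x))\<^sup>2)) \<partial>M)"
    proof (rule nn_integral_cong_AE)
      show "AE x in M. ennreal ((cmod (u n x - f x))\<^sup>2) = liminf (\<lambda>k. ennreal ((cmod (u n x - u (r k) x))\<^sup>2))"
        using lim
      proof eventually_elim
        case (elim x)
        have "(\<lambda>k. ennreal ((cmod (u n x - u (r k) x))\<^sup>2)) \<longlonglongrightarrow> ennreal ((cmod (u n x - f x))\<^sup>2)"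
          by (intro tendsto_ennrealI tendsto_power tendsto_norm tendsto_diff tendsto_const elim)
        then show ?case by (intro lim_imp_Liminf[symmetric]) auto
      qed
    qed
    also have "\<dots> \<le> liminf (\<lambda>k. \<integral>\<^sup>+x. ennreal ((cmod (u n x - u (r k) x))\<^sup>2) \<partial>M)"
      by (rule nn_integral_liminf) measurable
    also have "\<dots> \<le> ennreal (((1/2)^j)\<^sup>2)"
    proof -
      have "(\<integral>\<^sup>+x. ennreal ((cmod (u n x - u (r k) x))\<^sup>2) \<partial>M) \<le> ennreal (((1/2)^j)\<^sup>2)" if k: "k \<ge> j" for k
      proof -
        have "L2_norm M (\<lambda>x. u n x - u (r k) x) < (1/2)^j"
          by (rule N) (use rN[of j] rmono[OF k] n in auto)
        then have "(L2_norm M (\<lambda>x. u n x - u (r k) x))\<^sup>2 \<le> ((1/2)^j)\<^sup>2"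
          by (intro power_mono) (auto simp: L2_norm_def)
        then show ?thesis using nn_integral_L2[OF L2_diff[OF u u]] by (simp add: ennreal_leI)
      qed
      then have "eventually (\<lambda>k. (\<integral>\<^sup>+x. ennreal ((cmod (u n x - u (r k) x))\<^sup>2) \<partial>M) \<le> ennreal (((1/2)^j)\<^sup>2)) sequentially"
        unfolding eventually_sequentially by blast
      then have "Liminf sequentially (\<lambda>k. \<integral>\<^sup>+x. ennreal ((cmod (u n x - u (r k) x))\<^sup>2) \<partial>M) \<le> Liminf sequentially (\<lambda>k. ennreal (((1/2)^j)\<^sup>2))"
        by (rule Liminf_mono)
      then show ?thesis by (simp add: Liminf_const)
    qed
    finally show ?thesis .
  qed
  have dL2: "(\<lambda>x. u n x - f x) \<in> L2 M" if "n \<ge> r 0" for n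
  proof (rule L2I)
    show "integrable M (\<lambda>x. (cmod (u n x - f x))\<^sup>2)"
      by (rule integrableI_bounded) (use bound[OF that] in \<open>auto simp: ennreal_power top_unique less_top le_less_trans\<close>)
  qed measurable
  have fL2: "f \<in> L2 M"
    using L2_diff[OF u[of "r 0"] dL2[of "r 0"]] by simp
  have "(\<lambda>n. L2_norm M (\<lambda>x. u n x - f x)) \<longlonglongrightarrow> 0"
  proof (rule LIMSEQ_I)
    fix e :: real assume e: "e > 0"
    obtain j where j: "(1/2::real)^j < e" using real_arch_pow_inv[OF e, of "1/2"] by auto
    have "norm (L2_norm M (\<lambda>x. u n x - f x) - 0) < e" if n: "n \<ge> r j" for n
    proof -
      have "(L2_norm M (\<lambda>x. u n x - f x))\<^sup>2 \<le> ((1/2)^j)\<^sup>2"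
        using bound[OF n] nn_integral_L2[OF L2_diff[OF u[of n] fL2]] by (simp add: ennreal_le_iff)
      then have "L2_norm M (\<lambda>x. u n x - f x) \<le> (1/2)^j" by (rule power2_le_imp_le) simp
      then show ?thesis using j by (simp add: L2_norm_def)
    qed
    then show "\<exists>N. \<forall>n\<ge>N. norm (L2_norm M (\<lambda>x. u n x - f x) - 0) < e" by blast
  qed
  then show ?thesis using fL2 by blast
qed

text \<open>A separate name, so that the Hilbert space structure is attached to this locale and not
  to every probability space.\<close>

locale L2_prob_space = prob_space

sublocale L2_prob_space \<subseteq> semi_hilbert "L2 M" L2_sc "L2_ip M"
proof -
  interpret semi_inner "L2 M" L2_sc "L2_ip M" by (rule semi_inner_L2)
  show "semi_hilbert (L2 M) L2_sc (L2_ip M)"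
    by standard (use L2_complete in \<open>auto simp: L2_nrm fun_diff_eq\<close>)
qed

context L2_prob_space begin

lemma nrm_eq: "nrm f = L2_norm M f"
  by (simp add: L2_nrm)

lemma one_L2: "(\<lambda>x. c) \<in> L2 M"
  by (rule L2I) auto

lemma L2_norm_one: "L2_norm M (\<lambda>x. 1) = 1"
  by (simp add: L2_norm_def prob_space)

lemma eqv_iff_AE:
  assumes "f \<in> L2 M" "g \<in> L2 M" shows "eqv f g \<longleftrightarrow> (AE x in M. f x = g x)"
  using eqv_iff[OF assms] L2_norm_eq_0_iff[OF L2_diff[OF assms]]
  by (simp add: nrm_eq fun_diff_eq)

lemma L2_norm_nonneg: "0 \<le> L2_norm M f"
  by (simp add: L2_norm_def)

lemma L2_norm_cmult: "L2_norm M (\<lambda>x. c * f x) = cmod c * L2_norm M f"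
  by (simp add: L2_norm_def norm_mult power_mult_distrib real_sqrt_mult)

lemma L2_inner_eqI:
  assumes "f \<in> L2 M" "g \<in> L2 M" "f' \<in> L2 M" "g' \<in> L2 M"
    and re: "\<And>c. L2_ip M (\<lambda>x. c * f x) g = L2_ip M (\<lambda>x. c * f' x) g'"
  shows "L2_inner M f g = L2_inner M f' g'"
  using re[of 1] re[of \<i>] unfolding L2_inner_cmult by (auto simp: complex_eq_iff)

lemma L2_norm_cong: "AE x in M. f x = g x \<Longrightarrow> f \<in> L2 M \<Longrightarrow> g \<in> L2 M \<Longrightarrow> L2_norm M f = L2_norm M g"
  using eqv_iff_AE eqv_nrm nrm_eq by metis

lemma L2_cong:
  assumes "f \<in> L2 M" "g \<in> borel_measurable M" "AE x in M. f x = g x" shows "g \<in> L2 M"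
proof (rule L2I[OF assms(2)])
  have [measurable]: "f \<in> borel_measurable M" "g \<in> borel_measurable M" using assms L2_measurable by auto
  show "integrable M (\<lambda>x. (cmod (g x))\<^sup>2)"
    by (rule integrable_cong_AE_imp[OF L2_integrable[OF assms(1)]]) (use assms(3) in auto)
qed

end

section \<open>Spectral gap and contraction\<close>

text \<open>The complex counterpart of \<open>adj\<close>, which sees only real parts; homogeneity
  for complex scalars (\<open>L2_adjoint_scale\<close>) depends on it.\<close>

definition L2_adjoint :: "'a measure \<Rightarrow> (('a \<Rightarrow> complex) \<Rightarrow> 'a \<Rightarrow> complex) \<Rightarrow> (('a \<Rightarrow> complex) \<Rightarrow> 'a \<Rightarrow> complex) \<Rightarrow> bool" where
  "L2_adjoint M T S \<longleftrightarrow> (\<forall>f\<in>L2 M. T f \<in> L2 M) \<and> (\<forall>f\<in>L2 M. S f \<in> L2 M) \<and>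
     (\<forall>f\<in>L2 M. \<forall>g\<in>L2 M. L2_inner M (T f) g = L2_inner M f (S g))"

definition L2_centred :: "'a measure \<Rightarrow> ('a \<Rightarrow> complex) set" where
  "L2_centred M = {f \<in> L2 M. (\<integral>x. f x \<partial>M) = 0}"

lemma L2_adjoint_in: "L2_adjoint M T S \<Longrightarrow> f \<in> L2 M \<Longrightarrow> T f \<in> L2 M"
  and L2_adjoint_inner: "L2_adjoint M T S \<Longrightarrow> f \<in> L2 M \<Longrightarrow> g \<in> L2 M \<Longrightarrow> L2_inner M (T f) g = L2_inner M f (S g)"
  by (auto simp: L2_adjoint_def)

lemma L2_adjoint_sym: "L2_adjoint M T S \<Longrightarrow> L2_adjoint M S T"
  unfolding L2_adjoint_def by (metis L2_inner_commute)

lemma L2_adjoint_comp: "L2_adjoint M T S \<Longrightarrow> L2_adjoint M T' S' \<Longrightarrow> L2_adjoint M (T \<circ> T') (S' \<circ> S)"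
  unfolding L2_adjoint_def by auto

lemma L2_adjoint_funpow: "L2_adjoint M T S \<Longrightarrow> L2_adjoint M (T ^^ n) (S ^^ n)"
proof (induction n)
  case 0 then show ?case by (simp add: L2_adjoint_def)
next
  case (Suc n) then show ?case
    using L2_adjoint_comp[of M T S "T ^^ n" "S ^^ n"] funpow_Suc_right[of n S] by (metis funpow.simps(2))
qed

lemma L2_adjoint_cmult: "L2_adjoint M (\<lambda>f x. c * f x) (\<lambda>f x. cnj c * f x)"
  unfolding L2_adjoint_def
proof (intro conjI ballI)
  fix f g assume "f \<in> L2 M" "g \<in> L2 M"
  have "L2_inner M f (\<lambda>x. cnj c * g x) = c * L2_inner M f g"
    using L2_inner_cmult[of M "cnj c" g f]
    by (subst L2_inner_commute) (simp add: L2_inner_commute[of M f g])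
  then show "L2_inner M (\<lambda>x. c * f x) g = L2_inner M f (\<lambda>x. cnj c * g x)"
    by (simp add: L2_inner_cmult)
qed (auto intro: L2_cmult)

lemma L2_spectrum_bounded_below:
  assumes T: "\<And>f. f \<in> L2 M \<Longrightarrow> T f \<in> L2 M" and l: "l \<notin> L2_spectrum M T"
  shows "\<exists>\<kappa>>0. \<forall>f\<in>L2 M. \<kappa> * L2_norm M f \<le> L2_norm M (\<lambda>x. T f x - l * f x)"
proof -
  from l obtain R where R: "bounded_op M R" "\<And>f. f \<in> L2 M \<Longrightarrow> AE x in M. R (\<lambda>y. T f y - l * f y) x = f x"
    unfolding L2_spectrum_def by auto
  from R(1) obtain C where C: "\<And>f. f \<in> L2 M \<Longrightarrow> L2_norm M (R f) \<le> C * L2_norm M f"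
    unfolding bounded_op_def by blast
  from R(1) have RL: "\<And>f. f \<in> L2 M \<Longrightarrow> R f \<in> L2 M" unfolding bounded_op_def by blast
  \<comment> \<open>The bound \<open>C\<close> of the resolvent may be zero or negative, so it is
    enlarged to a positive number before inverting.\<close>
  have "1 / (\<bar>C\<bar> + 1) * L2_norm M f \<le> L2_norm M (\<lambda>x. T f x - l * f x)" if f: "f \<in> L2 M" for f
  proof -
    let ?g = "\<lambda>x. T f x - l * f x"
    have g: "?g \<in> L2 M" by (intro L2_diff L2_cmult T f)
    have "L2_norm M f = L2_norm M (R ?g)"
      unfolding L2_norm_def
      by (rule arg_cong[where f=sqrt], rule integral_cong_AE)
        (use R(2)[OF f] L2_measurable[OF f] L2_measurable[OF RL[OF g]] in auto)
    also have "\<dots> \<le> C * L2_norm M ?g" by (rule C[OF g])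
    also have "\<dots> \<le> (\<bar>C\<bar> + 1) * L2_norm M ?g" by (rule mult_right_mono) (auto simp: L2_norm_def)
    finally show ?thesis by (simp add: field_simps)
  qed
  then show ?thesis by (intro exI[of _ "1 / (\<bar>C\<bar> + 1)"]) auto
qed

section \<open>Operators with an adjoint, centred functions and the spectrum\<close>

context L2_prob_space begin

lemma L2_adjoint_adj: "L2_adjoint M T S \<Longrightarrow> adj T S"
  by (auto simp: L2_adjoint_def adj_def)

lemma L2_adjoint_add:
  assumes T: "L2_adjoint M T S" and "f \<in> L2 M" "g \<in> L2 M"
  shows "AE x in M. T (\<lambda>y. f y + g y) x = T f x + T g x"
  using adj_add[OF L2_adjoint_adj[OF T] assms(2,3)] assms L2_add L2_adjoint_in[OF T]
  by (subst (asm) eqv_iff_AE) (auto simp: fun_add_eq)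

lemma L2_adjoint_diff:
  assumes T: "L2_adjoint M T S" and "f \<in> L2 M" "g \<in> L2 M"
  shows "AE x in M. T (\<lambda>y. f y - g y) x = T f x - T g x"
  using adj_diff[OF L2_adjoint_adj[OF T] assms(2,3)] assms L2_diff L2_adjoint_in[OF T]
  by (subst (asm) eqv_iff_AE) (auto simp: fun_diff_eq)

lemma L2_adjoint_scale:
  assumes T: "L2_adjoint M T S" and f: "f \<in> L2 M"
  shows "AE x in M. T (\<lambda>y. c * f y) x = c * T f x"
proof -
  have "eqv (T (\<lambda>y. c * f y)) (\<lambda>x. c * T f x)"
    unfolding eqv_def using L2_adjoint_inner[OF T] f L2_cmult[OF f] by (auto simp: L2_inner_cmult)
  then show ?thesis using f L2_cmult L2_adjoint_in[OF T] by (subst (asm) eqv_iff_AE) auto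
qed

lemma L2_adjoint_AE_cong:
  assumes T: "L2_adjoint M T S" and "f \<in> L2 M" "g \<in> L2 M" "AE x in M. f x = g x"
  shows "AE x in M. T f x = T g x"
  using adj_cong[OF L2_adjoint_adj[OF T], of f g] eqv_iff_AE assms L2_adjoint_in[OF T] by metis

lemma L2_adjoint_contraction:
  assumes T: "L2_adjoint M T S" and c: "\<And>f. f \<in> L2 M \<Longrightarrow> L2_norm M (T f) \<le> L2_norm M f"
    and f: "f \<in> L2 M"
  shows "L2_norm M (S f) \<le> L2_norm M f"
proof -
  have Sf: "S f \<in> L2 M" by (rule L2_adjoint_in[OF L2_adjoint_sym[OF T] f])
  have "(L2_norm M (S f))\<^sup>2 = L2_ip M (T (S f)) f"
    using L2_adjoint_inner[OF T Sf f] nrm_sq[OF Sf] by (simp add: nrm_eq)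
  also have "\<dots> \<le> L2_norm M (T (S f)) * L2_norm M f"
    using ip_le[OF L2_adjoint_in[OF T Sf] f] by (simp add: nrm_eq)
  also have "\<dots> \<le> L2_norm M (S f) * L2_norm M f"
    by (intro mult_right_mono c Sf L2_norm_nonneg)
  finally have "L2_norm M (S f) * L2_norm M (S f) \<le> L2_norm M (S f) * L2_norm M f"
    by (simp add: power2_eq_square)
  then show ?thesis
    using L2_norm_nonneg[of "S f"] L2_norm_nonneg[of f] by (cases "L2_norm M (S f) = 0") auto
qed

lemma L2_inner_one: "L2_inner M f (\<lambda>x. 1) = (\<integral>x. f x \<partial>M)"
  by (simp add: L2_inner_def)

lemma integral_adjoint:
  assumes T: "L2_adjoint M T S" and S1: "AE x in M. S (\<lambda>x. 1) x = 1" and f: "f \<in> L2 M"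
  shows "(\<integral>x. T f x \<partial>M) = (\<integral>x. f x \<partial>M)"
proof -
  have [measurable]: "f \<in> borel_measurable M" "S (\<lambda>x. 1) \<in> borel_measurable M"
    using f L2_adjoint_in[OF L2_adjoint_sym[OF T] one_L2] L2_measurable by auto
  have cnj [measurable]: "cnj \<in> borel_measurable borel"
    by (intro borel_measurable_continuous_onI continuous_intros)
  have "(\<integral>x. T f x \<partial>M) = L2_inner M f (S (\<lambda>x. 1))"
    using L2_adjoint_inner[OF T f one_L2[of 1]] by (simp add: L2_inner_one)
  also have "\<dots> = (\<integral>x. f x \<partial>M)"
    unfolding L2_inner_def by (rule integral_cong_AE) (use S1 in auto)
  finally show ?thesis .
qed

lemma integral_L2_norm_le: "f \<in> L2 M \<Longrightarrow> cmod (\<integral>x. f x \<partial>M) \<le> L2_norm M f"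
  using order_trans[OF integral_norm_bound L1_le_L2(2)] by blast

text \<open>The orthogonal projection onto the complement of the constants.\<close>

definition centre :: "('a \<Rightarrow> complex) \<Rightarrow> 'a \<Rightarrow> complex" where
  "centre f x = f x - (\<integral>y. f y \<partial>M)"

lemma centre_L2: "f \<in> L2 M \<Longrightarrow> centre f \<in> L2 M"
  unfolding centre_def[abs_def] by (intro L2_diff one_L2)

lemma centre_centred: "f \<in> L2 M \<Longrightarrow> centre f \<in> L2_centred M"
  using centre_L2[of f] L1_le_L2(1)[of f] by (simp add: L2_centred_def centre_def[abs_def] prob_space)

lemma centre_adjoint: "L2_adjoint M centre centre"
  unfolding L2_adjoint_def
proof (intro conjI ballI centre_L2)
  fix f g assume fg: "f \<in> L2 M" "g \<in> L2 M"
  have i: "integrable M f" "integrable M g" using fg L1_le_L2 by auto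
  have ic: "integrable M (\<lambda>x. cnj (g x))" using i(2) by simp
  have ifg: "integrable M (\<lambda>x. f x * cnj (g x))" using L2_mult_integrable[OF fg] .
  show "L2_inner M (centre f) g = L2_inner M f (centre g)"
    unfolding L2_inner_def centre_def using i ic ifg by (simp add: algebra_simps)
qed

lemma centre_id: "f \<in> L2_centred M \<Longrightarrow> centre f = f"
  by (auto simp: L2_centred_def centre_def)

lemma centre_norm_le:
  assumes f: "f \<in> L2 M" shows "L2_norm M (centre f) \<le> L2_norm M f"
proof -
  have "(L2_norm M (centre f))\<^sup>2 = L2_ip M (centre f) (centre f)"
    using nrm_sq[OF centre_L2[OF f]] by (simp add: nrm_eq)
  also have "\<dots> = L2_ip M f (centre f)"
    using L2_adjoint_inner[OF centre_adjoint f centre_L2[OF f]] centre_id[OF centre_centred[OF f]] by simp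
  also have "\<dots> \<le> L2_norm M f * L2_norm M (centre f)"
    using ip_le[OF f centre_L2[OF f]] by (simp add: nrm_eq)
  finally have *: "L2_norm M (centre f) * L2_norm M (centre f) \<le> L2_norm M f * L2_norm M (centre f)"
    by (simp add: power2_eq_square)
  show ?thesis
  proof (cases "L2_norm M (centre f) = 0")
    case False
    then have "L2_norm M (centre f) > 0" using L2_norm_nonneg[of "centre f"] by simp
    then show ?thesis using * mult_right_le_imp_le by blast
  qed (simp add: L2_norm_nonneg)
qed

text \<open>The constant 1 is itself an eigenvector, so multiplicity one makes every fixed function
  constant almost everywhere.\<close>

lemma simple_eigenvalue_fixed_orthogonal:
  assumes simple: "simple_eigenvalue M Q 1" and Q1: "AE x in M. Q (\<lambda>x. 1) x = 1"
    and f: "f \<in> L2 M" "AE x in M. Q f x = f x" and g: "g \<in> L2_centred M"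
  shows "L2_inner M f g = 0"
proof -
  have gL: "g \<in> L2 M" and g0: "(\<integral>x. g x \<partial>M) = 0" using g by (auto simp: L2_centred_def)
  obtain h where h: "\<forall>g\<in>eigenspace M Q 1. \<exists>c. AE x in M. g x = c * h x"
    using simple unfolding simple_eigenvalue_def by blast
  have "f \<in> eigenspace M Q 1" "(\<lambda>x. 1) \<in> eigenspace M Q 1"
    using f Q1 one_L2 by (auto simp: eigenspace_def)
  from h[rule_format, OF this(1)] h[rule_format, OF this(2)]
  obtain c d where c: "AE x in M. f x = c * h x" and d: "AE x in M. 1 = d * h x" by blast
  have "d \<noteq> 0"
  proof
    assume "d = 0"
    then have "AE x in M. False" using d by simp
    then show False by simp
  qed
  have fc: "AE x in M. f x = c / d"
    using c d by eventually_elim (use \<open>d \<noteq> 0\<close> in \<open>simp add: field_simps\<close>)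
  have [measurable]: "f \<in> borel_measurable M" "g \<in> borel_measurable M" using f gL L2_measurable by auto
  have cnj [measurable]: "cnj \<in> borel_measurable borel"
    by (intro borel_measurable_continuous_onI continuous_intros)
  have "L2_inner M f g = (\<integral>x. c / d * cnj (g x) \<partial>M)"
    unfolding L2_inner_def by (rule integral_cong_AE) (use fc in auto)
  also have "\<dots> = 0" using g0 by simp
  finally show ?thesis .
qed

text \<open>The form of \<open>S \<circ> T\<close> at \<open>g\<close> is the squared norm of
  \<open>T g\<close>, and its square is dominated by it because the adjoint of a contraction is a
  contraction. A real \<open>r\<close> below the gap is used since the gap may be infinite.\<close>

lemma spectral_gap_contraction:
  assumes T: "L2_adjoint M T S" and contr: "\<And>f. f \<in> L2 M \<Longrightarrow> L2_norm M (T f) \<le> L2_norm M f"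
    and Q1: "AE x in M. S (T (\<lambda>x. 1)) x = 1"
    and r: "0 < r" "ereal r \<le> spectral_gap M (S \<circ> T)" and g: "g \<in> L2_centred M"
  shows "(L2_norm M (T g))\<^sup>2 \<le> (1 - r) * (L2_norm M g)\<^sup>2"
proof -
  let ?Q = "S \<circ> T"
  have Q: "L2_adjoint M ?Q ?Q" using L2_adjoint_comp[OF L2_adjoint_sym[OF T] T] .
  have gL: "g \<in> L2 M" using g by (simp add: L2_centred_def)
  \<comment> \<open>Otherwise the gap would be 0 by definition, contrary to
    \<open>0 < r\<close>.\<close>
  have simple: "simple_eigenvalue M ?Q 1" using r by (auto simp: spectral_gap_def split: if_splits)
  have gap: "ereal r \<le> 1 - (SUP l\<in>L2_spectrum M ?Q - {1}. ereal (Re l))"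
    using r(2) simple by (simp add: spectral_gap_def)
  have Re_le: "Re l \<le> 1 - r" if "l \<in> L2_spectrum M ?Q - {1}" for l
  proof -
    have "ereal (Re l) \<le> (SUP l\<in>L2_spectrum M ?Q - {1}. ereal (Re l))" by (rule SUP_upper[OF that])
    then have "ereal r \<le> 1 - ereal (Re l)" using gap by (meson ereal_minus_mono order_refl order_trans)
    then show ?thesis by (simp add: one_ereal_def)
  qed
  have TL: "T f \<in> L2 M" if "f \<in> L2 M" for f using L2_adjoint_in[OF T that] .
  have QL: "?Q f \<in> L2 M" if "f \<in> L2 M" for f using L2_adjoint_in[OF Q that] .
  have Qip: "L2_ip M (?Q f) f = (L2_norm M (T f))\<^sup>2" if f: "f \<in> L2 M" for f
    using L2_adjoint_inner[OF L2_adjoint_sym[OF T] TL[OF f] f] nrm_sq[OF TL[OF f]] by (simp add: nrm_eq)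
  have "L2_ip M (?Q g) g \<le> (1 - r) * L2_ip M g g"
  proof (rule spectral_gap_imp_contraction[OF L2_adjoint_adj[OF Q] _ _ _ gL])
    fix f assume f: "f \<in> L2 M"
    have "L2_ip M (?Q f) (?Q f) = (L2_norm M (S (T f)))\<^sup>2" using nrm_sq[OF QL[OF f]] by (simp add: nrm_eq)
    also have "\<dots> \<le> (L2_norm M (T f))\<^sup>2"
      by (intro power_mono L2_adjoint_contraction[OF T contr] TL f L2_norm_nonneg)
    finally show "L2_ip M (?Q f) (?Q f) \<le> L2_ip M (?Q f) f" using Qip[OF f] by simp
  next
    fix l :: real assume l: "1 - r < l" "l < 1"
    have "complex_of_real l \<notin> L2_spectrum M ?Q"
    proof
      assume *: "complex_of_real l \<in> L2_spectrum M ?Q"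
      moreover have "complex_of_real l \<noteq> 1" using l(2) by auto
      ultimately show False using Re_le[of "complex_of_real l"] l by simp
    qed
    from L2_spectrum_bounded_below[OF QL this]
    show "\<exists>\<kappa>>0. \<forall>x\<in>L2 M. \<kappa> * nrm x \<le> nrm (?Q x - L2_sc l x)"
      by (simp add: nrm_eq fun_diff_eq)
  next
    fix f assume f: "f \<in> L2 M" "eqv (?Q f) f"
    then have "AE x in M. ?Q f x = f x" using eqv_iff_AE[OF QL f(1)] by simp
    then have "L2_inner M f g = 0"
      using simple_eigenvalue_fixed_orthogonal[OF simple _ f(1) _ g] Q1 by simp
    then show "L2_ip M f g = 0" by simp
  qed (use r in simp)
  then show ?thesis using Qip[OF gL] nrm_sq[OF gL] by (simp add: nrm_eq)
qed

text \<open>The resolvent picks arbitrary preimages. By \<open>low\<close> two preimages of one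
  function agree almost everywhere, which yields linearity and the left inverse property;
  \<open>low\<close> also gives the norm bound \<open>1 / \<kappa>\<close>.\<close>

lemma not_in_spectrumI:
  assumes Q: "L2_adjoint M Q S" and \<kappa>: "\<kappa> > 0"
    and low: "\<And>f. f \<in> L2 M \<Longrightarrow> \<kappa> * L2_norm M f \<le> L2_norm M (\<lambda>x. Q f x - l * f x)"
    and surj: "\<And>f. f \<in> L2 M \<Longrightarrow> \<exists>h\<in>L2 M. AE x in M. Q h x - l * h x = f x"
  shows "l \<notin> L2_spectrum M Q"
proof -
  have QL: "Q f \<in> L2 M" if "f \<in> L2 M" for f using L2_adjoint_in[OF Q that] .
  define R where "R f = (SOME h. h \<in> L2 M \<and> (AE x in M. Q h x - l * h x = f x))" for f
  have R: "R f \<in> L2 M \<and> (AE x in M. Q (R f) x - l * R f x = f x)" if "f \<in> L2 M" for f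
  proof -
    from surj[OF that] have "\<exists>h. h \<in> L2 M \<and> (AE x in M. Q h x - l * h x = f x)" by blast
    then show ?thesis unfolding R_def by (rule someI_ex)
  qed
  have inj: "AE x in M. h x = h' x"
    if h: "h \<in> L2 M" "h' \<in> L2 M" and e: "AE x in M. Q h x - l * h x = Q h' x - l * h' x" for h h'
  proof -
    let ?d = "\<lambda>x. h x - h' x"
    have d: "?d \<in> L2 M" by (rule L2_diff[OF h])
    have "AE x in M. Q ?d x - l * ?d x = 0"
      using L2_adjoint_diff[OF Q h] e by eventually_elim algebra
    then have "L2_norm M (\<lambda>x. Q ?d x - l * ?d x) = 0"
      by (subst L2_norm_eq_0_iff) (intro L2_diff L2_cmult QL h)+
    then have "L2_norm M ?d \<le> 0" using low[OF d] \<kappa> by (simp add: mult_le_0_iff)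
    then have "L2_norm M ?d = 0" using L2_norm_nonneg[of ?d] by simp
    then show ?thesis using L2_norm_eq_0_iff[OF d] by simp
  qed
  have "bounded_op M R"
    unfolding bounded_op_def
  proof (intro conjI ballI allI)
    fix f assume f: "f \<in> L2 M" show "R f \<in> L2 M" using R[OF f] by blast
  next
    fix f g assume fg: "f \<in> L2 M" "g \<in> L2 M"
    note Rf = R[OF fg(1)] and Rg = R[OF fg(2)] and Rfg = R[OF L2_add[OF fg]]
    have "AE x in M. Q (\<lambda>y. R f y + R g y) x = Q (R f) x + Q (R g) x"
      using L2_adjoint_add[OF Q] Rf Rg by blast
    then have "AE x in M. Q (R (\<lambda>y. f y + g y)) x - l * R (\<lambda>y. f y + g y) x
       = Q (\<lambda>y. R f y + R g y) x - l * (R f x + R g x)"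
      using conjunct2[OF Rf] conjunct2[OF Rg] conjunct2[OF Rfg]
      by eventually_elim (simp add: algebra_simps)
    then show "AE x in M. R (\<lambda>y. f y + g y) x = R f x + R g x"
      by (rule inj[OF conjunct1[OF Rfg] L2_add[OF conjunct1[OF Rf] conjunct1[OF Rg]]])
  next
    fix c f assume f: "f \<in> L2 M"
    note Rf = R[OF f] and Rc = R[OF L2_cmult[OF f, of c]]
    have "AE x in M. Q (\<lambda>y. c * R f y) x = c * Q (R f) x"
      using L2_adjoint_scale[OF Q] Rf by blast
    then have "AE x in M. Q (R (\<lambda>y. c * f y)) x - l * R (\<lambda>y. c * f y) x
       = Q (\<lambda>y. c * R f y) x - l * (c * R f x)"
      using conjunct2[OF Rf] conjunct2[OF Rc]
      by eventually_elim algebra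
    then show "AE x in M. R (\<lambda>y. c * f y) x = c * R f x"
      by (rule inj[OF conjunct1[OF Rc] L2_cmult[OF conjunct1[OF Rf]]])
  next
    have "L2_norm M (R f) \<le> 1 / \<kappa> * L2_norm M f" if f: "f \<in> L2 M" for f
    proof -
      have "\<kappa> * L2_norm M (R f) \<le> L2_norm M (\<lambda>x. Q (R f) x - l * R f x)" using low R[OF f] by blast
      also have "\<dots> = L2_norm M f"
        by (rule L2_norm_cong[OF conjunct2[OF R[OF f]] _ f]) (intro L2_diff L2_cmult QL conjunct1[OF R[OF f]])
      finally show ?thesis using \<kappa> by (simp add: field_simps)
    qed
    then show "\<exists>C. \<forall>f\<in>L2 M. L2_norm M (R f) \<le> C * L2_norm M f" by blast
  qed
  moreover have "AE x in M. R (\<lambda>y. Q f y - l * f y) x = f x" if f: "f \<in> L2 M" for f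
  proof -
    have "(\<lambda>y. Q f y - l * f y) \<in> L2 M" by (intro L2_diff L2_cmult QL f)
    note Rg = R[OF this]
    show ?thesis by (rule inj[OF conjunct1[OF Rg] f conjunct2[OF Rg]])
  qed
  ultimately have "\<exists>R. bounded_op M R \<and> (\<forall>f\<in>L2 M. (AE x in M. R (\<lambda>y. Q f y - l * f y) x = f x) \<and>
      (AE x in M. Q (R f) x - l * R f x = f x))"
    using conjunct2[OF R] by (intro exI[of _ R]) simp
  then show ?thesis unfolding L2_spectrum_def by simp
qed

text \<open>The constants split off, so the resolvent only has to be constructed on centred functions.\<close>

lemma not_in_spectrum_centredI:
  assumes Q: "L2_adjoint M Q Q" and Q1: "AE x in M. Q (\<lambda>x. 1) x = 1" and l: "l \<noteq> 1" and \<kappa>: "\<kappa> > 0"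
    and low: "\<And>f. f \<in> L2_centred M \<Longrightarrow> \<kappa> * L2_norm M f \<le> L2_norm M (\<lambda>x. Q f x - l * f x)"
    and surj: "\<And>f. f \<in> L2_centred M \<Longrightarrow> \<exists>h\<in>L2 M. AE x in M. Q h x - l * h x = f x"
  shows "l \<notin> L2_spectrum M Q"
proof (rule not_in_spectrumI[OF Q])
  have QL: "Q f \<in> L2 M" if "f \<in> L2 M" for f using L2_adjoint_in[OF Q that] .
  have Qc: "AE x in M. Q (\<lambda>x. c) x = c" for c
    using L2_adjoint_scale[OF Q one_L2, of c 1] Q1 by eventually_elim simp
  \<comment> \<open>One term for the mean, on which \<open>Q - l\<close> acts as multiplication by
    \<open>1 - l\<close>, and one for the centred part.\<close>
  define K where "K = 1 / cmod (1 - l) + 1 / \<kappa>"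
  have K: "K > 0" using l \<kappa> by (simp add: K_def add_pos_pos)
  then show "1 / K > 0" by simp
  fix f assume f: "f \<in> L2 M"
  have split: "AE x in M. Q h x = Q (centre h) x + (\<integral>y. h y \<partial>M)" if h: "h \<in> L2 M" for h
  proof -
    have "AE x in M. Q (\<lambda>y. centre h y + (\<integral>y. h y \<partial>M)) x = Q (centre h) x + Q (\<lambda>y. (\<integral>y. h y \<partial>M)) x"
      by (rule L2_adjoint_add[OF Q centre_L2[OF h] one_L2])
    then show ?thesis using Qc[of "\<integral>y. h y \<partial>M"] by eventually_elim (simp add: centre_def)
  qed
  let ?g = "\<lambda>x. Q f x - l * f x"
  let ?m = "\<integral>y. f y \<partial>M"
  have g: "?g \<in> L2 M" by (intro L2_diff L2_cmult QL f)
  have intg: "(\<integral>x. ?g x \<partial>M) = (1 - l) * ?m"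
    using L1_le_L2(1)[OF f] L1_le_L2(1)[OF QL[OF f]] integral_adjoint[OF Q Q1 f] by (simp add: algebra_simps)
  have "AE x in M. centre ?g x = Q (centre f) x - l * centre f x"
    using split[OF f] unfolding centre_def[of ?g] intg by eventually_elim (simp add: centre_def[of f] algebra_simps)
  then have "L2_norm M (centre ?g) = L2_norm M (\<lambda>x. Q (centre f) x - l * centre f x)"
    by (rule L2_norm_cong) (intro centre_L2 g L2_diff L2_cmult QL f)+
  then have b1: "\<kappa> * L2_norm M (centre f) \<le> L2_norm M ?g"
    using low[OF centre_centred[OF f]] centre_norm_le[OF g] by simp
  have b2: "cmod (1 - l) * cmod ?m \<le> L2_norm M ?g"
    using integral_L2_norm_le[OF g] unfolding intg by (simp add: norm_mult)
  have "L2_norm M f \<le> L2_norm M (centre f) + L2_norm M (\<lambda>x. ?m)"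
    using nrm_triangle[OF centre_L2[OF f] one_L2, of ?m] by (simp add: nrm_eq fun_add_eq centre_def)
  also have "L2_norm M (\<lambda>x. ?m) = cmod ?m"
    by (simp add: L2_norm_def prob_space)
  also have "L2_norm M (centre f) + cmod ?m \<le> L2_norm M ?g / \<kappa> + L2_norm M ?g / cmod (1 - l)"
    using b1 b2 \<kappa> l by (intro add_mono) (auto simp: field_simps)
  also have "\<dots> = K * L2_norm M ?g" by (simp add: K_def algebra_simps)
  finally show "1 / K * L2_norm M f \<le> L2_norm M ?g" using K by (simp add: field_simps)
next
  have QL: "Q f \<in> L2 M" if "f \<in> L2 M" for f using L2_adjoint_in[OF Q that] .
  have Qc: "AE x in M. Q (\<lambda>x. c) x = c" for c
    using L2_adjoint_scale[OF Q one_L2, of c 1] Q1 by eventually_elim simp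
  fix f assume f: "f \<in> L2 M"
  let ?m = "\<integral>y. f y \<partial>M"
  obtain h where h: "h \<in> L2 M" "AE x in M. Q h x - l * h x = centre f x" using surj[OF centre_centred[OF f]] by blast
  \<comment> \<open>The preimage of the constant \<open>?m\<close>, as \<open>Q\<close> fixes
    constants.\<close>
  let ?c = "?m / (1 - l)"
  have "?c - l * ?c = (1 - l) * ?c" by (simp only: left_diff_distrib mult_1_left)
  then have c: "?c - l * ?c = ?m" using l by simp
  have "AE x in M. Q (\<lambda>y. h y + ?c) x = Q h x + Q (\<lambda>y. ?c) x"
    by (rule L2_adjoint_add[OF Q h(1) one_L2])
  then have "AE x in M. Q (\<lambda>y. h y + ?c) x - l * (h x + ?c) = f x"
    using Qc[of ?c] h(2)
  proof eventually_elim
    case (elim x)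
    then have "Q (\<lambda>y. h y + ?c) x - l * (h x + ?c) = (Q h x - l * h x) + (?c - l * ?c)" by (simp add: algebra_simps)
    then show ?case unfolding c using elim by (simp add: centre_def)
  qed
  then show "\<exists>h\<in>L2 M. AE x in M. Q h x - l * h x = f x" using L2_add[OF h(1) one_L2] by blast
qed

text \<open>If \<open>cmod l > q\<close>, then \<open>Q / l\<close> contracts centred functions, and
  the equation \<open>Q h - l * h = f\<close> is solved by a Neumann series.\<close>

lemma spectrum_Re_le:
  assumes Q: "L2_adjoint M Q Q" and Q1: "AE x in M. Q (\<lambda>x. 1) x = 1" and q: "0 \<le> q"
    and contr: "\<And>f. f \<in> L2_centred M \<Longrightarrow> L2_norm M (Q f) \<le> q * L2_norm M f"
    and l: "l \<in> L2_spectrum M Q" "l \<noteq> 1"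
  shows "Re l \<le> q"
proof (rule ccontr)
  assume "\<not> Re l \<le> q"
  then have lq: "q < cmod l" using complex_Re_le_cmod[of l] by linarith
  then have l0: "l \<noteq> 0" using q by auto
  have QL: "Q f \<in> L2 M" if "f \<in> L2 M" for f using L2_adjoint_in[OF Q that] .
  have "l \<notin> L2_spectrum M Q"
  proof (rule not_in_spectrum_centredI[OF Q Q1 l(2)])
    show "cmod l - q > 0" using lq by simp
    fix f assume f: "f \<in> L2_centred M"
    then have fL: "f \<in> L2 M" by (simp add: L2_centred_def)
    have "cmod l * L2_norm M f = L2_norm M (\<lambda>x. l * f x)" by (simp add: L2_norm_cmult)
    also have "\<dots> \<le> L2_norm M (Q f) + L2_norm M (\<lambda>x. l * f x - Q f x)"
      using nrm_le_add_diff[OF L2_cmult[OF fL] QL[OF fL], of l] by (simp add: nrm_eq fun_diff_eq)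
    also have "L2_norm M (\<lambda>x. l * f x - Q f x) = L2_norm M (\<lambda>x. Q f x - l * f x)"
      by (simp add: L2_norm_def norm_minus_commute)
    finally show "(cmod l - q) * L2_norm M f \<le> L2_norm M (\<lambda>x. Q f x - l * f x)"
      using contr[OF f] by (simp add: algebra_simps)
    \<comment> \<open>Composing with \<open>centre\<close> extends the contraction from centred
      functions to the whole space, where the Neumann series is available.\<close>
    define T where "T = (\<lambda>f x. (1 / l) * f x) \<circ> (Q \<circ> centre)"
    have T: "L2_adjoint M T ((centre \<circ> Q) \<circ> (\<lambda>f x. cnj (1 / l) * f x))"
      unfolding T_def by (intro L2_adjoint_comp L2_adjoint_cmult Q centre_adjoint)
    obtain x where x: "x \<in> L2 M" "eqv (x - T x) (\<lambda>t. (- 1 / l) * f t)"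
    proof -
      have "\<exists>x\<in>L2 M. eqv (x - T x) (\<lambda>t. (- 1 / l) * f t)"
      proof (rule neumann_series[OF L2_adjoint_adj[OF T], of "q / cmod l"])
        fix h assume h: "h \<in> L2 M"
        have "nrm (T h) = (1 / cmod l) * L2_norm M (Q (centre h))"
          using L2_norm_cmult[of "1 / l" "Q (centre h)"] by (simp add: nrm_eq T_def norm_divide)
        also have "\<dots> \<le> (1 / cmod l) * (q * L2_norm M h)"
          using contr[OF centre_centred[OF h]] mult_left_mono[OF centre_norm_le[OF h] q] by (intro mult_left_mono) auto
        finally show "nrm (T h) \<le> q / cmod l * nrm h" by (simp add: nrm_eq)
      next
        show "(\<lambda>t. (- 1 / l) * f t) \<in> L2 M" by (rule L2_cmult[OF fL])
      qed (use q lq l0 in auto)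
      then show ?thesis using that by blast
    qed
    have xT: "x - T x \<in> L2 M" unfolding fun_diff_eq by (intro L2_diff x L2_adjoint_in[OF T])
    have "AE t in M. (x - T x) t = (- 1 / l) * f t"
      using x(2) unfolding eqv_iff_AE[OF xT L2_cmult[OF fL]] .
    then have AE1: "AE t in M. Q (centre x) t - l * x t = f t"
    proof eventually_elim
      case (elim t)
      then have "l * Q (centre x) t = l * (f t + l * x t)" using l0 by (simp add: T_def field_simps)
      then have "Q (centre x) t = f t + l * x t" using l0 mult_left_cancel by blast
      then show ?case by simp
    qed
    have QcL: "Q (centre x) \<in> L2 M" by (intro QL centre_L2 x)
    \<comment> \<open>Integrating the equation shows that its solution has mean zero, so that the
      inserted \<open>centre\<close> had no effect on it.\<close>
    have "(\<integral>t. f t \<partial>M) = (\<integral>t. Q (centre x) t - l * x t \<partial>M)"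
      by (rule integral_cong_AE) (use AE1 QcL fL x(1) in \<open>auto intro!: L2_measurable L2_diff L2_cmult\<close>)
    also have "\<dots> = (\<integral>t. Q (centre x) t \<partial>M) - l * (\<integral>t. x t \<partial>M)"
      using L1_le_L2(1)[OF QcL] L1_le_L2(1)[OF x(1)] by simp
    also have "(\<integral>t. Q (centre x) t \<partial>M) = 0"
      using integral_adjoint[OF Q Q1 centre_L2[OF x(1)]] centre_centred[OF x(1)] by (simp add: L2_centred_def)
    finally have "(\<integral>t. x t \<partial>M) = 0" using f l0 by (simp add: L2_centred_def)
    then have "centre x = x" using x(1) by (intro centre_id) (simp add: L2_centred_def)
    then show "\<exists>h\<in>L2 M. AE t in M. Q h t - l * h t = f t" using AE1 x(1) by auto
  qed
  then show False using l by simp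
qed

text \<open>If \<open>g\<close> is fixed, so is its centred part, and a contraction with factor
  below 1 fixes only null vectors.\<close>

lemma simple_eigenvalue_one:
  assumes Q: "L2_adjoint M Q Q" and Q1: "AE x in M. Q (\<lambda>x. 1) x = 1" and q: "q < 1"
    and contr: "\<And>f. f \<in> L2_centred M \<Longrightarrow> L2_norm M (Q f) \<le> q * L2_norm M f"
  shows "simple_eigenvalue M Q 1"
  unfolding simple_eigenvalue_def
proof (intro bexI conjI ballI)
  show "(\<lambda>x. 1) \<in> eigenspace M Q 1" using one_L2 Q1 by (auto simp: eigenspace_def)
  show "\<not> (AE x in M. (1::complex) = 0)" by simp
  fix g assume "g \<in> eigenspace M Q 1"
  then have g: "g \<in> L2 M" "AE x in M. Q g x = g x" by (auto simp: eigenspace_def)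
  have Qc: "AE x in M. Q (\<lambda>x. c) x = c" for c
    using L2_adjoint_scale[OF Q one_L2, of c 1] Q1 by eventually_elim simp
  have "AE x in M. Q (\<lambda>y. g y - (\<integral>y. g y \<partial>M)) x = Q g x - Q (\<lambda>y. (\<integral>y. g y \<partial>M)) x"
    by (rule L2_adjoint_diff[OF Q g(1) one_L2])
  then have "AE x in M. Q (centre g) x = centre g x"
    using g(2) Qc[of "\<integral>y. g y \<partial>M"] by eventually_elim (simp add: centre_def[abs_def])
  then have "L2_norm M (Q (centre g)) = L2_norm M (centre g)"
    by (rule L2_norm_cong) (intro L2_adjoint_in[OF Q] centre_L2 g)+
  then have "L2_norm M (centre g) \<le> q * L2_norm M (centre g)" using contr[OF centre_centred[OF g(1)]] by simp
  then have "(1 - q) * L2_norm M (centre g) \<le> 0" by (simp add: algebra_simps)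
  then have "L2_norm M (centre g) = 0"
    using q L2_norm_nonneg[of "centre g"] by (simp add: mult_le_0_iff)
  then have "AE x in M. centre g x = 0" using L2_norm_eq_0_iff[OF centre_L2[OF g(1)]] by simp
  then have "AE x in M. g x = (\<integral>y. g y \<partial>M) * 1" by eventually_elim (simp add: centre_def)
  then show "\<exists>c. AE x in M. g x = c * 1" by blast
qed

lemma spectral_gap_ge:
  assumes Q: "L2_adjoint M Q Q" and Q1: "AE x in M. Q (\<lambda>x. 1) x = 1" and q: "0 \<le> q" "q < 1"
    and contr: "\<And>f. f \<in> L2_centred M \<Longrightarrow> L2_norm M (Q f) \<le> q * L2_norm M f"
  shows "ereal (1 - q) \<le> spectral_gap M Q"
proof -
  have "(SUP l\<in>L2_spectrum M Q - {1}. ereal (Re l)) \<le> ereal q"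
    using spectrum_Re_le[OF Q Q1 q(1) contr] by (intro SUP_least) auto
  then have "1 - ereal q \<le> 1 - (SUP l\<in>L2_spectrum M Q - {1}. ereal (Re l))" by (intro ereal_minus_mono) auto
  then show ?thesis using simple_eigenvalue_one[OF Q Q1 q(2) contr] by (simp add: spectral_gap_def one_ereal_def)
qed

lemma spectral_gap_nonneg:
  assumes Q: "L2_adjoint M Q Q" and Q1: "AE x in M. Q (\<lambda>x. 1) x = 1"
    and contr: "\<And>f. f \<in> L2 M \<Longrightarrow> L2_norm M (Q f) \<le> L2_norm M f"
  shows "0 \<le> spectral_gap M Q"
proof -
  have "(SUP l\<in>L2_spectrum M Q - {1}. ereal (Re l)) \<le> ereal 1"
    using spectrum_Re_le[OF Q Q1, of 1] contr by (intro SUP_least) (auto simp: L2_centred_def)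
  then have "1 - ereal 1 \<le> 1 - (SUP l\<in>L2_spectrum M Q - {1}. ereal (Re l))" by (intro ereal_minus_mono) auto
  then show ?thesis by (simp add: spectral_gap_def one_ereal_def zero_ereal_def)
qed

text \<open>In this degenerate case nothing but 1 can be spectral, and the supremum over the empty
  set is \<open>-\<infinity>\<close>.\<close>

lemma spectral_gap_infinite:
  assumes Q: "L2_adjoint M Q Q" and Q1: "AE x in M. Q (\<lambda>x. 1) x = 1"
    and triv: "\<And>f. f \<in> L2_centred M \<Longrightarrow> L2_norm M f = 0"
  shows "spectral_gap M Q = \<infinity>"
proof -
  have Q0: "L2_norm M (Q f) = 0" if f: "f \<in> L2_centred M" for f
  proof -
    have "f \<in> L2 M" using f by (simp add: L2_centred_def)
    then have "Q f \<in> L2_centred M"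
      using L2_adjoint_in[OF Q] integral_adjoint[OF Q Q1] f by (auto simp: L2_centred_def)
    then show ?thesis by (rule triv)
  qed
  have "l \<notin> L2_spectrum M Q" if l: "l \<noteq> 1" for l
  proof (rule not_in_spectrum_centredI[OF Q Q1 l, of 1])
    fix f assume f: "f \<in> L2_centred M"
    then show "1 * L2_norm M f \<le> L2_norm M (\<lambda>x. Q f x - l * f x)" using triv[OF f] L2_norm_nonneg by simp
    have fL: "f \<in> L2 M" using f by (simp add: L2_centred_def)
    have "AE x in M. f x = 0" "AE x in M. Q f x = 0"
      using triv[OF f] Q0[OF f] L2_norm_eq_0_iff fL L2_adjoint_in[OF Q fL] by auto
    then have "AE x in M. Q f x - l * f x = f x" by eventually_elim simp
    then show "\<exists>h\<in>L2 M. AE x in M. Q h x - l * h x = f x" using fL by blast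
  qed simp
  then have sp: "L2_spectrum M Q - {1} = {}" by blast
  moreover have "simple_eigenvalue M Q 1"
    by (rule simple_eigenvalue_one[OF Q Q1, of 0]) (simp_all add: Q0)
  ultimately show ?thesis unfolding spectral_gap_def sp by (simp add: bot_ereal_def)
qed

end

section \<open>The pseudo spectral gap of a stationary kernel\<close>

locale stationary_kernel =
  fixes P :: "'a::polish_space \<Rightarrow> 'a measure" and \<pi> :: "'a measure"
  assumes kernel: "markov_kernel P" and stationary: "stationary P \<pi>"
begin

abbreviation K :: "('a \<Rightarrow> complex) \<Rightarrow> 'a \<Rightarrow> complex" where "K \<equiv> kernel_op P"
abbreviation K_adj :: "('a \<Rightarrow> complex) \<Rightarrow> 'a \<Rightarrow> complex" where "K_adj \<equiv> adjoint_op \<pi> K"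

lemma sets_pi [measurable_cong, simp]: "sets \<pi> = sets borel"
  using stationary by (simp add: stationary_def distribution_def)

lemma space_pi [simp]: "space \<pi> = UNIV"
  using sets_eq_imp_space_eq[OF sets_pi] by simp

end

sublocale stationary_kernel \<subseteq> L2_prob_space \<pi>
  by (rule L2_prob_space.intro) (use stationary in \<open>simp add: stationary_def distribution_def\<close>)

context stationary_kernel begin

lemma prob_UNIV [simp]: "measure \<pi> UNIV = 1"
  using prob_space by simp

lemma P_subprob [measurable]: "P \<in> borel \<rightarrow>\<^sub>M subprob_algebra borel"
  using kernel unfolding markov_kernel_def by (rule measurable_prob_algebraD)

lemma P_prob: "prob_space (P x)" and sets_P [simp]: "sets (P x) = sets borel"
  using measurable_space[OF kernel[unfolded markov_kernel_def], of x] by (auto simp: space_prob_algebra)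

lemma space_P [simp]: "space (P x) = UNIV"
  using sets_eq_imp_space_eq[OF sets_P] by simp

lemma distribution_bind:
  assumes "distribution \<mu>" shows "distribution (\<mu> \<bind> P)"
proof -
  interpret m: prob_space \<mu> using assms by (simp add: distribution_def)
  have sets: "sets \<mu> = sets borel" using assms by (simp add: distribution_def)
  have m: "P \<in> \<mu> \<rightarrow>\<^sub>M subprob_algebra borel" using P_subprob measurable_cong_sets[OF sets refl] by blast
  have "prob_space (\<mu> \<bind> P)" by (rule m.prob_space_bind[OF _ m]) (simp add: P_prob)
  moreover have "sets (\<mu> \<bind> P) = sets borel" by (rule sets_bind) (auto simp: m.not_empty)
  ultimately show ?thesis by (simp add: distribution_def)
qed

lemma distribution_push: "distribution \<mu> \<Longrightarrow> distribution (push P n \<mu>)"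
  by (induction n) (auto simp: push_def distribution_bind)

lemma K_measurable:
  assumes "f \<in> borel_measurable borel" shows "K f \<in> borel_measurable borel"
  unfolding kernel_op_def[abs_def]
  by (rule measurable_compose[OF P_subprob integral_measurable_subprob_algebra[OF assms]])

lemma nn_integral_K:
  assumes "f \<in> borel_measurable borel"
  shows "(\<integral>\<^sup>+x. \<integral>\<^sup>+y. f y \<partial>P x \<partial>\<pi>) = (\<integral>\<^sup>+x. f x \<partial>\<pi>)"
proof -
  have "P \<in> \<pi> \<rightarrow>\<^sub>M subprob_algebra borel" using P_subprob measurable_cong_sets[OF sets_pi refl] by blast
  from nn_integral_bind[OF assms this] show ?thesis using stationary by (simp add: stationary_def)
qed

lemma L2_borel: "f \<in> L2 \<pi> \<Longrightarrow> f \<in> borel_measurable borel"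
  using L2_measurable[of f \<pi>] measurable_cong_sets[OF sets_pi refl] by blast

text \<open>Stationarity makes the iterated integral of the squared modulus finite. Hence
  \<open>kernel_op P f\<close> is a genuine integral at almost every point and not a default
  value.\<close>

lemma AE_L2_P:
  assumes f: "f \<in> L2 \<pi>" shows "AE x in \<pi>. f \<in> L2 (P x)"
proof -
  have [measurable]: "f \<in> borel_measurable borel" by (rule L2_borel[OF f])
  let ?g = "\<lambda>y. ennreal ((cmod (f y))\<^sup>2)"
  have g: "?g \<in> borel_measurable borel" by measurable
  have "(\<integral>\<^sup>+x. \<integral>\<^sup>+y. ?g y \<partial>P x \<partial>\<pi>) \<noteq> \<infinity>"
    unfolding nn_integral_K[OF g] nn_integral_L2[OF f] by simp
  moreover have "(\<lambda>x. \<integral>\<^sup>+y. ?g y \<partial>P x) \<in> borel_measurable \<pi>"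
    using measurable_compose[OF P_subprob nn_integral_measurable_subprob_algebra[OF g]]
      measurable_cong_sets[OF sets_pi refl] by blast
  ultimately have "AE x in \<pi>. (\<integral>\<^sup>+y. ?g y \<partial>P x) \<noteq> \<infinity>" by (intro nn_integral_noteq_infinite)
  then show ?thesis
  proof eventually_elim
    case (elim x)
    have fm: "f \<in> borel_measurable (P x)" using measurable_cong_sets[OF sets_P refl] L2_borel[OF f] by blast
    note [measurable] = fm
    show ?case
      by (rule L2I[OF fm], rule integrableI_bounded) (use elim in \<open>auto simp: ennreal_power less_top\<close>)
  qed
qed

text \<open>At almost every \<open>x\<close> the squared modulus of the average is at most the
  average of the squared modulus; stationarity integrates this inequality.\<close>

lemma K_L2: assumes f: "f \<in> L2 \<pi>" shows "K f \<in> L2 \<pi>" and K_norm_le: "L2_norm \<pi> (K f) \<le> L2_norm \<pi> f"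
proof -
  have [measurable]: "f \<in> borel_measurable borel" "K f \<in> borel_measurable borel"
    using L2_borel[OF f] K_measurable by auto
  let ?g = "\<lambda>y. ennreal ((cmod (f y))\<^sup>2)"
  have g: "?g \<in> borel_measurable borel" by measurable
  have "(\<integral>\<^sup>+x. ennreal ((cmod (K f x))\<^sup>2) \<partial>\<pi>) \<le> (\<integral>\<^sup>+x. \<integral>\<^sup>+y. ?g y \<partial>P x \<partial>\<pi>)"
  proof (rule nn_integral_mono_AE)
    show "AE x in \<pi>. ennreal ((cmod (K f x))\<^sup>2) \<le> (\<integral>\<^sup>+y. ?g y \<partial>P x)"
      using AE_L2_P[OF f]
    proof eventually_elim
      case (elim x)
      interpret Px: L2_prob_space "P x" by (simp add: L2_prob_space_def P_prob)
      have "(cmod (K f x))\<^sup>2 \<le> (L2_norm (P x) f)\<^sup>2"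
        unfolding kernel_op_def by (intro power_mono Px.integral_L2_norm_le elim) simp
      then show ?case unfolding nn_integral_L2[OF elim] by (rule ennreal_leI)
    qed
  qed
  also have "\<dots> = ennreal ((L2_norm \<pi> f)\<^sup>2)" unfolding nn_integral_K[OF g] nn_integral_L2[OF f] ..
  finally have *: "(\<integral>\<^sup>+x. ennreal ((cmod (K f x))\<^sup>2) \<partial>\<pi>) \<le> ennreal ((L2_norm \<pi> f)\<^sup>2)" .
  have "K f \<in> borel_measurable \<pi>" by measurable
  then show KL: "K f \<in> L2 \<pi>"
    by (rule L2I, intro integrableI_bounded) (use * in \<open>auto simp: ennreal_power le_less_trans\<close>)
  have "(L2_norm \<pi> (K f))\<^sup>2 \<le> (L2_norm \<pi> f)\<^sup>2"
    using * unfolding nn_integral_L2[OF KL] by (simp add: ennreal_le_iff)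
  then show "L2_norm \<pi> (K f) \<le> L2_norm \<pi> f" by (rule power2_le_imp_le) (rule L2_norm_nonneg)
qed

lemma K_cmult: "K (\<lambda>x. c * f x) = (\<lambda>x. c * K f x)"
  by (simp add: kernel_op_def fun_eq_iff)

lemma K_add:
  assumes "f \<in> L2 \<pi>" "g \<in> L2 \<pi>" shows "AE x in \<pi>. K (\<lambda>y. f y + g y) x = K f x + K g x"
  using AE_L2_P[OF assms(1)] AE_L2_P[OF assms(2)]
proof eventually_elim
  case (elim x)
  interpret Px: L2_prob_space "P x" by (simp add: L2_prob_space_def P_prob)
  show ?case using Px.L1_le_L2(1) elim by (simp add: kernel_op_def)
qed

text \<open>Shows that the choice in \<open>adjoint_op\<close> has a witness. Riesz representation
  provides it for real parts only; exact complex homogeneity of \<open>K\<close> upgrades it to the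
  complex inner product.\<close>

lemma K_adjoint: "L2_adjoint \<pi> K K_adj"
proof -
  have "\<exists>S. adj K S"
  proof (rule adjoint_exists)
    show "K f \<in> L2 \<pi>" if "f \<in> L2 \<pi>" for f by (rule K_L2(1)[OF that])
    show "nrm (K f) \<le> 1 * nrm f" if "f \<in> L2 \<pi>" for f using K_norm_le[OF that] by (simp add: nrm_eq)
    show "eqv (K (L2_sc a f)) (L2_sc a (K f))" for a f by (simp add: K_cmult eqv_def)
    fix f g assume fg: "f \<in> L2 \<pi>" "g \<in> L2 \<pi>"
    have L: "K (f + g) \<in> L2 \<pi>" "K f + K g \<in> L2 \<pi>" using fg K_L2 by (auto intro!: add_in)
    show "eqv (K (f + g)) (K f + K g)"
      unfolding eqv_iff_AE[OF L] using K_add[OF fg] by (simp add: fun_add_eq)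
  qed
  then obtain S where S: "adj K S" by blast
  have SL: "S g \<in> L2 \<pi>" if "g \<in> L2 \<pi>" for g using adj_in[OF adj_sym[OF S] that] .
  have "L2_inner \<pi> (K f) g = L2_inner \<pi> f (S g)" if fg: "f \<in> L2 \<pi>" "g \<in> L2 \<pi>" for f g
  proof (rule L2_inner_eqI[OF K_L2(1)[OF fg(1)] fg(2) fg(1) SL[OF fg(2)]])
    fix c show "L2_ip \<pi> (\<lambda>x. c * K f x) g = L2_ip \<pi> (\<lambda>x. c * f x) (S g)"
      using adj_ip[OF S L2_cmult[OF fg(1)] fg(2), of c] by (simp add: K_cmult)
  qed
  then have "\<exists>R. (\<forall>g\<in>L2 \<pi>. R g \<in> L2 \<pi>) \<and> (\<forall>f\<in>L2 \<pi>. \<forall>g\<in>L2 \<pi>. L2_inner \<pi> (K f) g = L2_inner \<pi> f (R g))"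
    using SL by (intro exI[of _ S]) blast
  from someI_ex[OF this] show ?thesis
    unfolding adjoint_op_def L2_adjoint_def using K_L2 by blast
qed

lemma K_const: "K (\<lambda>x. c) = (\<lambda>x. c)"
proof
  fix x interpret Px: prob_space "P x" by (rule P_prob)
  show "K (\<lambda>x. c) x = c" using Px.prob_space by (simp add: kernel_op_def)
qed

lemma K_pow_const: "(K ^^ n) (\<lambda>x. c) = (\<lambda>x. c)"
  by (induction n) (simp_all add: K_const)

lemma K_pow_adjoint: "L2_adjoint \<pi> (K ^^ n) (K_adj ^^ n)"
  by (rule L2_adjoint_funpow[OF K_adjoint])

lemma K_pow_L2: "f \<in> L2 \<pi> \<Longrightarrow> (K ^^ n) f \<in> L2 \<pi>"
  by (rule L2_adjoint_in[OF K_pow_adjoint])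

lemma K_pow_norm_le: "f \<in> L2 \<pi> \<Longrightarrow> L2_norm \<pi> ((K ^^ n) f) \<le> L2_norm \<pi> f"
proof (induction n)
  case (Suc n)
  then show ?case using K_norm_le[OF K_pow_L2, of f n] by simp
qed simp

text \<open>The image of 1 has norm at most 1 and inner product 1 with 1, so the squared norm of the
  difference is at most \<open>1 - 1 - 1 + 1\<close>.\<close>

lemma K_adj_pow_const: "AE x in \<pi>. (K_adj ^^ n) (\<lambda>x. 1) x = 1"
proof -
  have one: "(\<lambda>x. 1) \<in> L2 \<pi>" by (rule one_L2)
  let ?f = "(K_adj ^^ n) (\<lambda>x. 1)"
  have f: "?f \<in> L2 \<pi>" by (rule L2_adjoint_in[OF L2_adjoint_sym[OF K_pow_adjoint] one])
  have n1: "L2_ip \<pi> (\<lambda>x. 1) (\<lambda>x. 1) = 1" by (simp add: L2_inner_def prob_space)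
  have "L2_ip \<pi> ?f (\<lambda>x. 1) = 1"
    using L2_adjoint_inner[OF L2_adjoint_sym[OF K_pow_adjoint] one one, of n] n1 by (simp add: K_pow_const)
  moreover have "L2_ip \<pi> (\<lambda>x. 1) ?f = 1" using calculation ip_sym[OF f one] by simp
  moreover have "L2_ip \<pi> ?f ?f \<le> 1"
  proof -
    have "L2_norm \<pi> ?f \<le> L2_norm \<pi> (\<lambda>x. 1)"
      by (rule L2_adjoint_contraction[OF K_pow_adjoint K_pow_norm_le one])
    then have "(L2_norm \<pi> ?f)\<^sup>2 \<le> 1" using L2_norm_nonneg[of ?f] by (simp add: L2_norm_one power_le_one)
    then show ?thesis using nrm_sq[OF f] by (simp add: nrm_eq)
  qed
  moreover have "(nrm (?f - (\<lambda>x. 1)))\<^sup>2 = L2_ip \<pi> ?f ?f - L2_ip \<pi> ?f (\<lambda>x. 1) - (L2_ip \<pi> (\<lambda>x. 1) ?f - L2_ip \<pi> (\<lambda>x. 1) (\<lambda>x. 1))"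
    unfolding nrm_sq[OF diff_in[OF f one]] using f one by (simp add: ip_lin in_V)
  ultimately have "(nrm (?f - (\<lambda>x. 1)))\<^sup>2 \<le> 0" using n1 by linarith
  then have "nrm (?f - (\<lambda>x. 1)) = 0" by simp
  then show ?thesis using eqv_iff[OF f one] eqv_iff_AE[OF f one] by simp
qed

lemma K_pow_centred:
  assumes "f \<in> L2_centred \<pi>" shows "(K ^^ n) f \<in> L2_centred \<pi>"
  using assms K_pow_L2[of f n] integral_adjoint[OF K_pow_adjoint K_adj_pow_const, of f n]
  by (simp add: L2_centred_def)

definition K_sym :: "nat \<Rightarrow> ('a \<Rightarrow> complex) \<Rightarrow> 'a \<Rightarrow> complex" where
  "K_sym k = (K_adj ^^ k) \<circ> (K ^^ k)"

lemma K_sym_adjoint: "L2_adjoint \<pi> (K_sym k) (K_sym k)"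
  unfolding K_sym_def using L2_adjoint_comp[OF L2_adjoint_sym[OF K_pow_adjoint] K_pow_adjoint] .

lemma K_sym_const: "AE x in \<pi>. K_sym k (\<lambda>x. 1) x = 1"
  using K_adj_pow_const[of k] by (simp add: K_sym_def K_pow_const)

lemma K_sym_norm_le: "f \<in> L2 \<pi> \<Longrightarrow> L2_norm \<pi> (K_sym k f) \<le> L2_norm \<pi> f"
  unfolding K_sym_def comp_def
  using L2_adjoint_contraction[OF K_pow_adjoint K_pow_norm_le K_pow_L2, of f k k] K_pow_norm_le[of f k]
  by linarith

section \<open>The pseudo spectral gap and the decay of powers on centred functions\<close>

lemma pseudo_spectral_gap_eq:
  "pseudo_spectral_gap P \<pi> = (SUP k\<in>{1..}. spectral_gap \<pi> (K_sym k) / ereal (real k))"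
  by (simp add: pseudo_spectral_gap_def K_sym_def)

lemma pseudo_spectral_gap_upper:
  "k \<ge> 1 \<Longrightarrow> spectral_gap \<pi> (K_sym k) / ereal (real k) \<le> pseudo_spectral_gap P \<pi>"
  unfolding pseudo_spectral_gap_eq by (rule SUP_upper) simp

lemma K_sym_gap_nonneg: "0 \<le> spectral_gap \<pi> (K_sym k)"
  by (rule spectral_gap_nonneg[OF K_sym_adjoint K_sym_const K_sym_norm_le])

lemma pseudo_spectral_gap_nonneg: "0 \<le> pseudo_spectral_gap P \<pi>"
  using pseudo_spectral_gap_upper[of 1] K_sym_gap_nonneg[of 1] by (simp add: one_ereal_def[symmetric])

lemma pseudo_spectral_gap_infinite:
  assumes "\<And>f. f \<in> L2_centred \<pi> \<Longrightarrow> L2_norm \<pi> f = 0"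
  shows "pseudo_spectral_gap P \<pi> = \<infinity>"
  using pseudo_spectral_gap_upper[of 1] spectral_gap_infinite[OF K_sym_adjoint K_sym_const assms, of 1] by simp

lemma K_pow_gap_contraction:
  assumes "0 < r" "ereal r \<le> spectral_gap \<pi> (K_sym k)" "f \<in> L2_centred \<pi>"
  shows "(L2_norm \<pi> ((K ^^ k) f))\<^sup>2 \<le> (1 - r) * (L2_norm \<pi> f)\<^sup>2"
  using spectral_gap_contraction[OF K_pow_adjoint K_pow_norm_le _ assms(1) _ assms(3)] assms(2)
    K_sym_const[of k] by (simp add: K_sym_def)

text \<open>The supremum defining the pseudo spectral gap is attained because the \<open>k\<close>-th term is at
  most \<open>1 / k\<close>.\<close>

lemma pseudo_spectral_gap_attained:
  assumes pos: "0 < pseudo_spectral_gap P \<pi>" and f: "f \<in> L2_centred \<pi>" "L2_norm \<pi> f \<noteq> 0"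
  obtains \<gamma> k where "pseudo_spectral_gap P \<pi> = ereal \<gamma>" "0 < \<gamma>" "k \<ge> 1" "real k * \<gamma> \<le> 1"
    "\<And>g. g \<in> L2_centred \<pi> \<Longrightarrow> (L2_norm \<pi> ((K ^^ k) g))\<^sup>2 \<le> (1 - real k * \<gamma>) * (L2_norm \<pi> g)\<^sup>2"
proof -
  \<comment> \<open>The non-null \<open>f\<close> excludes the degenerate case: a gap above 1 would
    bound a square by a negative number.\<close>
  have le1: "spectral_gap \<pi> (K_sym k) \<le> 1" for k
  proof (rule ccontr)
    assume "\<not> ?thesis"
    then have "ereal 1 < spectral_gap \<pi> (K_sym k)" by (simp add: one_ereal_def)
    then obtain r where r: "ereal 1 < ereal r" "ereal r < spectral_gap \<pi> (K_sym k)" using ereal_dense2 by blast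
    then have "(L2_norm \<pi> ((K ^^ k) f))\<^sup>2 \<le> (1 - r) * (L2_norm \<pi> f)\<^sup>2"
      by (intro K_pow_gap_contraction f) auto
    moreover have "(1 - r) * (L2_norm \<pi> f)\<^sup>2 < 0" using r(1) f(2) by (simp add: mult_neg_pos)
    ultimately show False using zero_le_power2[of "L2_norm \<pi> ((K ^^ k) f)"] by linarith
  qed
  define u where "u k = real_of_ereal (spectral_gap \<pi> (K_sym k))" for k
  have u: "spectral_gap \<pi> (K_sym k) = ereal (u k)" for k
    unfolding u_def using le1[of k] K_sym_gap_nonneg[of k]
    by (cases "spectral_gap \<pi> (K_sym k)") (auto simp: one_ereal_def)
  have u01: "0 \<le> u k" "u k \<le> 1" for k
    using le1[of k] K_sym_gap_nonneg[of k] unfolding u by (auto simp: one_ereal_def zero_ereal_def)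
  define v where "v k = u k / real k" for k
  have SUPv: "pseudo_spectral_gap P \<pi> = (SUP k\<in>{1..}. ereal (v k))"
    unfolding pseudo_spectral_gap_eq by (rule SUP_cong) (auto simp: u v_def)
  obtain j where j: "j \<ge> 1" "v j > 0"
    using pos unfolding SUPv less_SUP_iff by auto
  \<comment> \<open>Only indices up to \<open>1 / v j\<close> can match the positive term
    \<open>v j\<close>, so a maximum over this finite set is a maximum over all
    \<open>k\<close>.\<close>
  define F where "F = {k. 1 \<le> k \<and> v j \<le> v k}"
  have "finite F"
  proof (rule finite_subset)
    show "F \<subseteq> {..nat \<lceil>1 / v j\<rceil>}"
    proof
      fix k assume "k \<in> F"
      then have k: "1 \<le> k" "v j \<le> v k" by (auto simp: F_def)
      have "v j * real k \<le> v k * real k" using k by (intro mult_right_mono) auto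
      also have "\<dots> \<le> 1" using k u01(2)[of k] by (simp add: v_def)
      finally have "real k \<le> 1 / v j" using j by (simp add: field_simps)
      then show "k \<in> {..nat \<lceil>1 / v j\<rceil>}" by simp linarith
    qed
  qed simp
  have "j \<in> F" using j by (simp add: F_def)
  then have "F \<noteq> {}" by blast
  then obtain k where "k \<in> F" and kMax: "v k = Max (v ` F)" by (rule obtains_MAX[OF \<open>finite F\<close>, where f = v]) metis
  have k: "k \<in> F" "\<And>i. i \<in> F \<Longrightarrow> v i \<le> v k"
    by fact (use Max_ge[OF finite_imageI[OF \<open>finite F\<close>] imageI, of _ v] kMax in metis)
  have k1: "k \<ge> 1" and vk: "v k > 0" using k(1) j by (auto simp: F_def)
  have kv: "real k * v k = u k" using k1 by (simp add: v_def)
  have "pseudo_spectral_gap P \<pi> = ereal (v k)"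
    unfolding SUPv
  proof (rule antisym)
    show "(SUP k\<in>{1..}. ereal (v k)) \<le> ereal (v k)"
    proof (rule SUP_least)
      fix i :: nat assume "i \<in> {1..}"
      then show "ereal (v i) \<le> ereal (v k)"
        using k \<open>j \<in> F\<close> by (cases "i \<in> F") (force simp: F_def)+
    qed
    show "ereal (v k) \<le> (SUP k\<in>{1..}. ereal (v k))" by (rule SUP_upper) (use k1 in simp)
  qed
  moreover have "(L2_norm \<pi> ((K ^^ k) g))\<^sup>2 \<le> (1 - real k * v k) * (L2_norm \<pi> g)\<^sup>2"
    if "g \<in> L2_centred \<pi>" for g
  proof -
    have "u k > 0" using vk k1 by (simp add: v_def zero_less_divide_iff)
    then show ?thesis unfolding kv using u[of k] by (intro K_pow_gap_contraction that) auto
  qed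
  ultimately show ?thesis using that[of "v k" k] vk k1 kv u01(2)[of k] by simp
qed

text \<open>Each complete block of \<open>k\<close> steps contributes a factor \<open>c\<close>; the
  remaining \<open>n mod k\<close> steps do not increase the norm.\<close>

lemma K_pow_decay:
  assumes k: "k \<ge> 1" and c: "0 \<le> c"
    and contr: "\<And>g. g \<in> L2_centred \<pi> \<Longrightarrow> (L2_norm \<pi> ((K ^^ k) g))\<^sup>2 \<le> c * (L2_norm \<pi> g)\<^sup>2"
    and f: "f \<in> L2_centred \<pi>"
  shows "(L2_norm \<pi> ((K ^^ n) f))\<^sup>2 \<le> c ^ (n div k) * (L2_norm \<pi> f)\<^sup>2"
proof -
  have *: "(L2_norm \<pi> ((K ^^ (k * m)) f))\<^sup>2 \<le> c ^ m * (L2_norm \<pi> f)\<^sup>2" for m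
  proof (induction m)
    case (Suc m)
    have "(K ^^ (k * Suc m)) f = (K ^^ k) ((K ^^ (k * m)) f)" by (simp add: funpow_add)
    then have "(L2_norm \<pi> ((K ^^ (k * Suc m)) f))\<^sup>2 \<le> c * (L2_norm \<pi> ((K ^^ (k * m)) f))\<^sup>2"
      using contr[OF K_pow_centred[OF f]] by simp
    also have "\<dots> \<le> c * (c ^ m * (L2_norm \<pi> f)\<^sup>2)" using Suc c by (rule mult_left_mono)
    finally show ?case by simp
  qed simp
  have fL: "f \<in> L2 \<pi>" using f by (simp add: L2_centred_def)
  have "(K ^^ n) f = (K ^^ (n mod k)) ((K ^^ (k * (n div k))) f)"
    by (metis comp_apply funpow_add mod_mult_div_eq)
  then have "L2_norm \<pi> ((K ^^ n) f) \<le> L2_norm \<pi> ((K ^^ (k * (n div k))) f)"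
    using K_pow_norm_le[OF K_pow_L2[OF fL]] by simp
  then have "(L2_norm \<pi> ((K ^^ n) f))\<^sup>2 \<le> (L2_norm \<pi> ((K ^^ (k * (n div k))) f))\<^sup>2"
    by (rule power_mono) (rule L2_norm_nonneg)
  then show ?thesis using *[of "n div k"] by linarith
qed

lemma K_pow_bounded:
  assumes f: "f \<in> borel_measurable borel" "\<And>x. cmod (f x) \<le> B"
  shows "(K ^^ n) f \<in> borel_measurable borel \<and> (\<forall>x. cmod ((K ^^ n) f x) \<le> B)"
proof (induction n)
  case (Suc n)
  let ?g = "(K ^^ n) f"
  have g: "?g \<in> borel_measurable borel" "\<And>x. cmod (?g x) \<le> B" using Suc by auto
  have "cmod (K ?g x) \<le> B" for x
  proof -
    interpret Px: prob_space "P x" by (rule P_prob)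
    have gm: "?g \<in> borel_measurable (P x)" using measurable_cong_sets[OF sets_P refl] g(1) by blast
    have "integrable (P x) ?g" by (rule Px.integrable_const_bound[of _ B]) (use g gm in auto)
    then have "(\<integral>y. cmod (?g y) \<partial>P x) \<le> (\<integral>y. B \<partial>P x)" using g(2) by (intro integral_mono) auto
    then show ?thesis
      unfolding kernel_op_def[of P ?g] using Px.prob_space by (intro order_trans[OF integral_norm_bound]) simp
  qed
  then show ?case using K_measurable[OF g(1)] by simp
qed (use f in simp)

text \<open>Duality between the actions on measures and on functions. The induction moves one step
  of \<open>P\<close> from the measure to the function, hence the generalisation over
  \<open>f\<close>; boundedness of \<open>f\<close> survives by
  \<open>K_pow_bounded\<close>.\<close>

lemma integral_push:
  assumes \<mu>: "distribution \<mu>" and f: "f \<in> borel_measurable borel" "\<And>x. cmod (f x) \<le> B"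
  shows "(\<integral>x. f x \<partial>push P n \<mu>) = (\<integral>x. (K ^^ n) f x \<partial>\<mu>)"
  using f
proof (induction n arbitrary: f)
  case 0 then show ?case by (simp add: push_def)
next
  case (Suc n)
  let ?\<nu> = "push P n \<mu>"
  have \<nu>: "prob_space ?\<nu>" "sets ?\<nu> = sets borel" using distribution_push[OF \<mu>, of n] by (auto simp: distribution_def)
  interpret \<nu>: prob_space ?\<nu> by (rule \<nu>)
  have m: "P \<in> ?\<nu> \<rightarrow>\<^sub>M subprob_algebra borel" using P_subprob measurable_cong_sets[OF \<nu>(2) refl] by blast
  have "(\<integral>x. f x \<partial>push P (Suc n) \<mu>) = (\<integral>x. f x \<partial>(?\<nu> \<bind> P))" by (simp add: push_def)
  also have "\<dots> = (\<integral>x. K f x \<partial>?\<nu>)"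
  proof (rule complex_eqI)
    have int: "integrable (?\<nu> \<bind> P) f" "integrable ?\<nu> (K f)" "\<And>x. integrable (P x) f"
    proof -
      have D: "distribution (?\<nu> \<bind> P)" "distribution ?\<nu>" "distribution (P x)" for x
        using distribution_bind[OF distribution_push[OF \<mu>]] distribution_push[OF \<mu>] P_prob[of x] by (simp_all add: distribution_def)
      have int: "integrable \<rho> g" if "distribution \<rho>" "g \<in> borel_measurable borel" "\<And>x. cmod (g x) \<le> B" for \<rho> g
      proof -
        interpret r: prob_space \<rho> using that by (simp add: distribution_def)
        have s: "sets \<rho> = sets borel" using that(1) by (simp add: distribution_def)
        have "g \<in> borel_measurable \<rho>" using that(2) unfolding measurable_cong_sets[OF s refl] .
        then show ?thesis using that(3) by (intro r.integrable_const_bound[of _ B] AE_I2)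
      qed
      show "integrable (?\<nu> \<bind> P) f" by (rule int[OF D(1) Suc.prems])
      show "integrable ?\<nu> (K f)" by (rule int[OF D(2)]) (use K_pow_bounded[OF Suc.prems, of 1] in simp_all)
      show "integrable (P x) f" for x by (rule int[OF D(3) Suc.prems])
    qed
    have gen: "(\<integral>x. g x \<partial>(?\<nu> \<bind> P)) = (\<integral>x. \<integral>y. g y \<partial>P x \<partial>?\<nu>)"
      if "g \<in> borel_measurable borel" "\<And>x. \<bar>g x\<bar> \<le> B" for g :: "'a \<Rightarrow> real"
    proof (rule integral_bind[OF that(1) _ m])
      show "AE x in ?\<nu>. emeasure (P x) (space (P x)) \<le> ennreal 1"
        using prob_space.emeasure_space_1[OF P_prob] by (simp del: space_P)
      show "finite_measure ?\<nu>" by (rule \<nu>.finite_measure_axioms)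
    qed (rule that(2))
    have [measurable]: "f \<in> borel_measurable borel" by (rule Suc.prems)
    have "(\<integral>x. Re (f x) \<partial>(?\<nu> \<bind> P)) = (\<integral>x. \<integral>y. Re (f y) \<partial>P x \<partial>?\<nu>)"
      using order_trans[OF abs_Re_le_cmod Suc.prems(2)] by (intro gen) auto
    then show "Re (\<integral>x. f x \<partial>(?\<nu> \<bind> P)) = Re (\<integral>x. K f x \<partial>?\<nu>)"
      using int by (simp add: kernel_op_def[abs_def])
    have "(\<integral>x. Im (f x) \<partial>(?\<nu> \<bind> P)) = (\<integral>x. \<integral>y. Im (f y) \<partial>P x \<partial>?\<nu>)"
      using order_trans[OF abs_Im_le_cmod Suc.prems(2)] by (intro gen) auto
    then show "Im (\<integral>x. f x \<partial>(?\<nu> \<bind> P)) = Im (\<integral>x. K f x \<partial>?\<nu>)"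
      using int by (simp add: kernel_op_def[abs_def])
  qed
  also have "\<dots> = (\<integral>x. (K ^^ n) (K f) x \<partial>\<mu>)"
    by (rule Suc.IH) (use K_pow_bounded[OF Suc.prems, of 1] in auto)
  finally show ?case by (simp add: funpow_Suc_right del: funpow.simps(2))
qed

end

section \<open>Convergence to stationarity\<close>

lemma d_TV_leI:
  "(\<And>A. A \<in> sets borel \<Longrightarrow> \<bar>measure \<mu> A - measure \<nu> A\<bar> \<le> c) \<Longrightarrow> d_TV \<mu> \<nu> \<le> c"
  unfolding d_TV_def by (rule cSUP_least) (auto intro: sets.top)

lemma epowr_nonneg: "0 \<le> epowr b a"
  by (simp add: epowr_def)

section \<open>Centred indicators, the chi-square bound and mixing times\<close>

context stationary_kernel begin

lemma real_indicator_L2: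
  assumes "A \<in> sets borel" shows "(\<lambda>x. complex_of_real (indicator A x)) \<in> L2 \<pi>"
proof (rule L2I)
  show "(\<lambda>x. complex_of_real (indicator A x)) \<in> borel_measurable \<pi>" using assms by measurable
  show "integrable \<pi> (\<lambda>x. (cmod (complex_of_real (indicator A x)))\<^sup>2)"
    by (rule integrable_const_bound[of _ 1]) (use assms in \<open>auto split: split_indicator\<close>)
qed

definition test_fun :: "'a set \<Rightarrow> 'a \<Rightarrow> complex" where
  "test_fun A x = complex_of_real (indicator A x - measure \<pi> A)"

lemma test_fun_eq_centre:
  assumes "A \<in> sets borel" shows "test_fun A = centre (\<lambda>x. complex_of_real (indicator A x))"
  using assms by (simp add: fun_eq_iff test_fun_def centre_def)

lemma test_fun_centred: "A \<in> sets borel \<Longrightarrow> test_fun A \<in> L2_centred \<pi>"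
  using test_fun_eq_centre[of A] centre_centred[OF real_indicator_L2, of A] by simp

lemma test_fun_bounded:
  assumes "A \<in> sets borel"
  shows "test_fun A \<in> borel_measurable borel" "cmod (test_fun A x) \<le> 1"
proof -
  show "test_fun A \<in> borel_measurable borel" unfolding test_fun_def[abs_def] using assms by measurable
  have "\<bar>indicator A x - measure \<pi> A\<bar> \<le> 1"
    using prob_le_1[of A] measure_nonneg[of \<pi> A] by (auto simp: indicator_def)
  then show "cmod (test_fun A x) \<le> 1" unfolding test_fun_def norm_of_real .
qed

lemma test_fun_norm:
  assumes A: "A \<in> sets borel"
  shows "(L2_norm \<pi> (test_fun A))\<^sup>2 = measure \<pi> A * (1 - measure \<pi> A)"
proof -
  let ?p = "measure \<pi> A"
  have "(L2_norm \<pi> (test_fun A))\<^sup>2 = (\<integral>x. (1 - 2 * ?p) * indicator A x + ?p\<^sup>2 \<partial>\<pi>)"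
    unfolding L2_norm_sq test_fun_def norm_of_real
    by (rule Bochner_Integration.integral_cong) (auto simp: indicator_def power2_eq_square algebra_simps)
  also have "\<dots> = (1 - 2 * ?p) * ?p + ?p\<^sup>2"
  proof -
    have "integrable \<pi> (indicator A :: 'a \<Rightarrow> real)"
      by (rule integrable_const_bound[of _ 1]) (use A in \<open>auto split: split_indicator\<close>)
    then show ?thesis using A by simp
  qed
  finally show ?thesis by (simp add: power2_eq_square algebra_simps)
qed

lemma test_fun_norm_le:
  assumes A: "A \<in> sets borel" shows "L2_norm \<pi> (test_fun A) \<le> 1 / 2"
proof (rule power2_le_imp_le)
  have "0 \<le> (measure \<pi> A - 1 / 2)\<^sup>2" by simp
  then show "(L2_norm \<pi> (test_fun A))\<^sup>2 \<le> (1 / 2)\<^sup>2"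
    unfolding test_fun_norm[OF A] by (simp add: power2_eq_square algebra_simps)
qed simp

lemma measure_push_diff:
  assumes \<mu>: "distribution \<mu>" and A: "A \<in> sets borel"
  shows "measure (push P n \<mu>) A - measure \<pi> A = Re (\<integral>x. (K ^^ n) (test_fun A) x \<partial>\<mu>)"
proof -
  let ?\<nu> = "push P n \<mu>"
  have \<nu>: "prob_space ?\<nu>" "sets ?\<nu> = sets borel" using distribution_push[OF \<mu>, of n] by (auto simp: distribution_def)
  interpret n: prob_space ?\<nu> by (rule \<nu>)
  have sp: "space ?\<nu> = UNIV" using sets_eq_imp_space_eq[OF \<nu>(2)] by simp
  have i: "integrable ?\<nu> (indicator A :: 'a \<Rightarrow> real)"
    by (rule n.integrable_const_bound[of _ 1]) (use A \<nu>(2) in \<open>auto split: split_indicator\<close>)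
  have "(\<integral>x. test_fun A x \<partial>?\<nu>) = complex_of_real (\<integral>x. indicator A x - measure \<pi> A \<partial>?\<nu>)"
    unfolding test_fun_def by (rule integral_complex_of_real)
  also have "(\<integral>x. indicator A x - measure \<pi> A \<partial>?\<nu>) = measure ?\<nu> A - measure \<pi> A"
    using i n.prob_space sp by simp
  finally show ?thesis
    using integral_push[OF \<mu> test_fun_bounded[OF A], of n] by simp
qed

text \<open>\<open>g\<close> is the density minus 1. The subtraction is invisible to centred
  functions and lowers the squared norm from \<open>N_init \<pi> q\<close> to that number minus 1,
  as the density has integral 1.\<close>

lemma chi_square_representation:
  assumes q: "distribution q" and N: "N_init \<pi> q \<noteq> \<infinity>"
  obtains g where "g \<in> L2 \<pi>" "L2_norm \<pi> g = sqrt (enn2real (N_init \<pi> q) - 1)"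
    "\<And>f. f \<in> borel_measurable borel \<Longrightarrow> f \<in> L2_centred \<pi> \<Longrightarrow> (\<integral>x. f x \<partial>q) = L2_inner \<pi> f g"
proof -
  have ac: "absolutely_continuous \<pi> q" and Nd: "N_init \<pi> q = (\<integral>\<^sup>+x. (RN_deriv \<pi> q x)\<^sup>2 \<partial>\<pi>)"
    using N by (auto simp: N_init_def split: if_splits)
  have sq: "sets q = sets \<pi>" using q by (simp add: distribution_def)
  interpret q: prob_space q using q by (simp add: distribution_def)
  have "AE x in \<pi>. (RN_deriv \<pi> q x)\<^sup>2 \<noteq> \<infinity>"
    using N unfolding Nd by (intro nn_integral_noteq_infinite) auto
  then have fin: "AE x in \<pi>. RN_deriv \<pi> q x = ennreal (enn2real (RN_deriv \<pi> q x))"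
    by eventually_elim (auto simp: less_top power2_eq_square ennreal_mult_eq_top_iff)
  define h where "h x = enn2real (RN_deriv \<pi> q x)" for x
  have h0: "h x \<ge> 0" for x by (simp add: h_def)
  have [measurable]: "h \<in> borel_measurable \<pi>" unfolding h_def by measurable
  have "density \<pi> (RN_deriv \<pi> q) = density \<pi> (\<lambda>x. ennreal (h x))"
    by (rule density_cong) (use fin in \<open>auto simp: h_def\<close>)
  then have qd: "q = density \<pi> (\<lambda>x. ennreal (h x))" using density_RN_deriv[OF ac sq] by simp
  have Nh: "N_init \<pi> q = (\<integral>\<^sup>+x. ennreal ((h x)\<^sup>2) \<partial>\<pi>)"
    unfolding Nd
  proof (rule nn_integral_cong_AE)
    show "AE x in \<pi>. (RN_deriv \<pi> q x)\<^sup>2 = ennreal ((h x)\<^sup>2)"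
      using fin by eventually_elim (metis ennreal_power h0 h_def)
  qed
  have h2: "integrable \<pi> (\<lambda>x. (h x)\<^sup>2)"
    by (rule integrableI_bounded) (use N in \<open>auto simp: Nh less_top\<close>)
  have Nr: "enn2real (N_init \<pi> q) = (\<integral>x. (h x)\<^sup>2 \<partial>\<pi>)"
    unfolding Nh by (subst nn_integral_eq_integral[OF h2]) auto
  have hL: "(\<lambda>x. complex_of_real (h x)) \<in> L2 \<pi>" by (rule L2I) (use h2 in auto)
  have hi: "integrable \<pi> h" using L1_le_L2(1)[OF hL] by (simp add: complex_of_real_integrable_eq)
  have "emeasure q (space q) = 1" by (rule q.emeasure_space_1)
  then have "(\<integral>\<^sup>+x. ennreal (h x) \<partial>\<pi>) = 1"
    using sets_eq_imp_space_eq[OF sq] by (subst (asm) (1) qd) (simp add: emeasure_density)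
  then have h1: "(\<integral>x. h x \<partial>\<pi>) = 1"
    using hi h0 by (simp add: nn_integral_eq_integral)
  define g where "g x = complex_of_real (h x) - 1" for x
  have gL: "g \<in> L2 \<pi>" unfolding g_def[abs_def] by (intro L2_diff hL one_L2)
  have "(\<integral>x. (cmod (g x))\<^sup>2 \<partial>\<pi>) = (\<integral>x. (h x)\<^sup>2 - 2 * h x + 1 \<partial>\<pi>)"
  proof (rule Bochner_Integration.integral_cong[OF refl])
    fix x
    have "g x = complex_of_real (h x - 1)" by (simp add: g_def)
    then have "cmod (g x) = \<bar>h x - 1\<bar>" by (simp only: norm_of_real)
    then show "(cmod (g x))\<^sup>2 = (h x)\<^sup>2 - 2 * h x + 1" by (simp add: power2_eq_square algebra_simps)
  qed
  also have "\<dots> = enn2real (N_init \<pi> q) - 1" using hi h2 h1 by (simp add: Nr)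
  finally have "L2_norm \<pi> g = sqrt (enn2real (N_init \<pi> q) - 1)" by (simp add: L2_norm_def)
  moreover have "(\<integral>x. f x \<partial>q) = L2_inner \<pi> f g" if f: "f \<in> borel_measurable borel" "f \<in> L2_centred \<pi>" for f
  proof -
    have fL: "f \<in> L2 \<pi>" and f0: "(\<integral>x. f x \<partial>\<pi>) = 0" using f by (auto simp: L2_centred_def)
    have fi: "integrable \<pi> f" using L1_le_L2(1)[OF fL] .
    have [measurable]: "f \<in> borel_measurable \<pi>" using f(1) by measurable
    have "(\<integral>x. f x \<partial>q) = (\<integral>x. h x *\<^sub>R f x \<partial>\<pi>)"
      by (subst qd, rule integral_density) (use h0 in auto)
    also have "\<dots> = (\<integral>x. f x * cnj (g x) + f x \<partial>\<pi>)"
      by (rule Bochner_Integration.integral_cong) (auto simp: g_def scaleR_conv_of_real algebra_simps)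
    also have "\<dots> = L2_inner \<pi> f g"
      using fi L2_mult_integrable[OF fL gL] f0 by (simp add: L2_inner_def)
    finally show ?thesis .
  qed
  ultimately show ?thesis using that gL by blast
qed

text \<open>Converts the gain of a block of \<open>k\<close> steps into a rate per step, through
  \<open>1 - k * \<gamma> \<le> (1 - \<gamma>) ^ k\<close>.\<close>

lemma Bernoulli_power_bound:
  assumes "0 < \<gamma>" "\<gamma> \<le> 1" "real k * \<gamma> \<le> 1"
  shows "(1 - real k * \<gamma>) ^ m \<le> (1 - \<gamma>) ^ (k * m)"
  using Bernoulli_inequality[of "- \<gamma>" k] assms by (simp add: power_mult power_mono)

text \<open>The spare \<open>+ 1\<close> absorbs the rounding of the mixing time to an integer.\<close>

lemma quotient_lower_bound:
  assumes "k \<ge> 1" "0 < \<gamma>" "real k * \<gamma> \<le> 1"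
  shows "real n + 1 - 1 / \<gamma> \<le> real (k * (n div k))"
proof -
  have "n mod k < k" using assms by simp
  then have "n + 1 \<le> k * (n div k) + k" by (metis Suc_eq_plus1 Suc_leI add_less_cancel_left mult_div_mod_eq)
  then have "real n + 1 \<le> real (k * (n div k)) + real k" by (metis of_nat_1 of_nat_add of_nat_mono)
  moreover have "real k \<le> 1 / \<gamma>" using assms by (simp add: field_simps)
  ultimately show ?thesis by linarith
qed

lemma pseudo_spectral_gap_decay:
  assumes k: "k \<ge> 1" "real k * \<gamma> \<le> 1"
    and contr: "\<And>g. g \<in> L2_centred \<pi> \<Longrightarrow> (L2_norm \<pi> ((K ^^ k) g))\<^sup>2 \<le> (1 - real k * \<gamma>) * (L2_norm \<pi> g)\<^sup>2"
    and f: "f \<in> L2_centred \<pi>" "L2_norm \<pi> f \<le> c"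
  shows "L2_norm \<pi> ((K ^^ n) f) \<le> c * sqrt ((1 - real k * \<gamma>) ^ (n div k))"
proof (rule power2_le_imp_le)
  have c: "0 \<le> c" using f(2) L2_norm_nonneg[of f] by linarith
  have "(L2_norm \<pi> ((K ^^ n) f))\<^sup>2 \<le> (1 - real k * \<gamma>) ^ (n div k) * (L2_norm \<pi> f)\<^sup>2"
    by (rule K_pow_decay[OF k(1) _ contr f(1)]) (use k in simp)
  also have "\<dots> \<le> (1 - real k * \<gamma>) ^ (n div k) * c\<^sup>2"
    using k(2) by (intro mult_left_mono power_mono f(2) L2_norm_nonneg) simp
  finally show "(L2_norm \<pi> ((K ^^ n) f))\<^sup>2 \<le> (c * sqrt ((1 - real k * \<gamma>) ^ (n div k)))\<^sup>2"
    using k(2) by (simp add: power_mult_distrib mult.commute)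
  show "0 \<le> c * sqrt ((1 - real k * \<gamma>) ^ (n div k))" using c k(2) by simp
qed

text \<open>The deviation on \<open>A\<close> is an inner product of the evolved centred indicator
  with the centred density. The factor 1/2 is the bound for the norm of the indicator. The cases of
  infinite gap and of gap 1 need the conventions of \<open>epowr\<close>.\<close>

lemma d_TV_push_le:
  assumes q: "distribution q" and pos: "0 < pseudo_spectral_gap P \<pi>" and N: "N_init \<pi> q \<noteq> \<infinity>"
  shows "ereal (d_TV (push P n q) \<pi>) \<le> 1/2 * epowr (1 - pseudo_spectral_gap P \<pi>) ((ereal (real n) - 1 / pseudo_spectral_gap P \<pi>) / 2)
                  * ereal (sqrt (enn2real (N_init \<pi> q) - 1))"
proof -
  let ?s = "sqrt (enn2real (N_init \<pi> q) - 1)"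
  let ?E = "epowr (1 - pseudo_spectral_gap P \<pi>) ((ereal (real n) - 1 / pseudo_spectral_gap P \<pi>) / 2)"
  obtain g where g: "g \<in> L2 \<pi>" "L2_norm \<pi> g = ?s"
    "\<And>f. f \<in> borel_measurable borel \<Longrightarrow> f \<in> L2_centred \<pi> \<Longrightarrow> (\<integral>x. f x \<partial>q) = L2_inner \<pi> f g"
    by (rule chi_square_representation[OF q N]) blast
  have s0: "0 \<le> ?s" using g(2) L2_norm_nonneg[of g] by simp
  have bound: "\<bar>measure (push P n q) A - measure \<pi> A\<bar> \<le> L2_norm \<pi> ((K ^^ n) (test_fun A)) * ?s"
    if A: "A \<in> sets borel" for A
  proof -
    let ?f = "(K ^^ n) (test_fun A)"
    have f: "?f \<in> borel_measurable borel" "?f \<in> L2_centred \<pi>"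
      using K_pow_bounded[OF test_fun_bounded[OF A]] K_pow_centred[OF test_fun_centred[OF A]] by auto
    have "\<bar>L2_ip \<pi> ?f g\<bar> \<le> L2_norm \<pi> ?f * ?s"
      using abs_ip_le[of ?f g] f(2) g(1,2) by (simp add: nrm_eq L2_centred_def)
    then show ?thesis unfolding measure_push_diff[OF q A] g(3)[OF f] .
  qed
  have E0: "0 \<le> 1/2 * ?E * ereal ?s" using epowr_nonneg[of "1 - pseudo_spectral_gap P \<pi>" "(ereal (real n) - 1 / pseudo_spectral_gap P \<pi>) / 2"] s0 by simp
  show ?thesis
  proof (cases "\<forall>f\<in>L2_centred \<pi>. L2_norm \<pi> f = 0")
    \<comment> \<open>Here the gap is infinite, but the left side vanishes and the right side is
      nonnegative.\<close>
    case True
    have "d_TV (push P n q) \<pi> \<le> 0"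
    proof (rule d_TV_leI)
      fix A :: "'a set" assume A: "A \<in> sets borel"
      have "L2_norm \<pi> ((K ^^ n) (test_fun A)) = 0" using True K_pow_centred[OF test_fun_centred[OF A]] by blast
      then show "\<bar>measure (push P n q) A - measure \<pi> A\<bar> \<le> 0" using bound[OF A] by simp
    qed
    then have "ereal (d_TV (push P n q) \<pi>) \<le> 0" by (simp add: zero_ereal_def)
    then show ?thesis using E0 by (rule order_trans)
  next
    case False
    then obtain f where f: "f \<in> L2_centred \<pi>" "L2_norm \<pi> f \<noteq> 0" by blast
    obtain \<gamma> k where \<gamma>: "pseudo_spectral_gap P \<pi> = ereal \<gamma>" "0 < \<gamma>" and k: "k \<ge> 1" "real k * \<gamma> \<le> 1"
      and contr: "\<And>g. g \<in> L2_centred \<pi> \<Longrightarrow> (L2_norm \<pi> ((K ^^ k) g))\<^sup>2 \<le> (1 - real k * \<gamma>) * (L2_norm \<pi> g)\<^sup>2"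
      by (rule pseudo_spectral_gap_attained[OF pos f]) blast
    let ?m = "n div k"
    let ?r = "sqrt ((1 - real k * \<gamma>) ^ ?m)"
    have TV: "d_TV (push P n q) \<pi> \<le> 1/2 * ?r * ?s"
    proof (rule d_TV_leI)
      fix A :: "'a set" assume A: "A \<in> sets borel"
      have "L2_norm \<pi> ((K ^^ n) (test_fun A)) \<le> 1/2 * ?r"
        by (rule pseudo_spectral_gap_decay[OF k contr test_fun_centred[OF A] test_fun_norm_le[OF A]])
      then show "\<bar>measure (push P n q) A - measure \<pi> A\<bar> \<le> 1/2 * ?r * ?s"
        using bound[OF A] s0 by (meson mult_right_mono order_trans)
    qed
    have "1 * \<gamma> \<le> real k * \<gamma>" using k \<gamma>(2) by (intro mult_right_mono) auto
    then have \<gamma>1: "\<gamma> \<le> 1" using k(2) by simp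
    have E: "?E = epowr (ereal (1 - \<gamma>)) (ereal ((real n - 1 / \<gamma>) / 2))"
      using \<gamma> by (simp add: one_ereal_def numeral_eq_ereal)
    show ?thesis
    proof (cases "\<gamma> = 1")
      case False
      then have b: "0 < 1 - \<gamma>" "1 - \<gamma> \<le> 1" using \<gamma>1 \<gamma>(2) by auto
      have "?r \<le> sqrt ((1 - \<gamma>) ^ (k * ?m))"
        using Bernoulli_power_bound[OF \<gamma>(2) \<gamma>1 k(2)] by simp
      also have "\<dots> = (1 - \<gamma>) powr (real (k * ?m) / 2)"
        using b by (simp add: powr_realpow[symmetric] powr_half_sqrt[symmetric] powr_powr del: of_nat_mult)
      \<comment> \<open>The base is below 1, so the exponent may be lowered; the spare 1 of
        \<open>quotient_lower_bound\<close> is given away.\<close>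
      also have "\<dots> \<le> (1 - \<gamma>) powr ((real n - 1 / \<gamma>) / 2)"
        using quotient_lower_bound[OF k(1) \<gamma>(2) k(2), of n] b by (intro powr_mono') auto
      finally have "1/2 * ?r * ?s \<le> 1/2 * (1 - \<gamma>) powr ((real n - 1 / \<gamma>) / 2) * ?s"
        using s0 by (intro mult_right_mono) auto
      with TV have "ereal (d_TV (push P n q) \<pi>) \<le> ereal (1/2 * (1 - \<gamma>) powr ((real n - 1 / \<gamma>) / 2) * ?s)" by simp
      also have "\<dots> = 1/2 * ?E * ereal ?s"
        using b unfolding E by (simp add: epowr_def one_ereal_def numeral_eq_ereal)
      finally show ?thesis .
    next
      \<comment> \<open>With gap 1 the block length is 1 and one step annihilates centred functions.
        For \<open>n = 0\<close> the exponent is \<open>-1 / 2\<close> over base 0, so the right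
        side is infinite unless \<open>q\<close> has chi-square distance 0.\<close>
      case True
      then have k1: "k = 1" using k by simp
      show ?thesis
      proof (cases "n = 0 \<and> ?s \<noteq> 0")
        case False
        then have "1/2 * ?r * ?s = 0" using True k1 by auto
        then have "ereal (d_TV (push P n q) \<pi>) \<le> 0" using TV by (simp only: zero_ereal_def ereal_less_eq)
        then show ?thesis using E0 by (rule order_trans)
      next
        case inf: True
        have Einf: "?E = \<infinity>" unfolding E using inf True by (simp add: epowr_def zero_ereal_def)
        have "1/2 * \<infinity> * ereal s = \<infinity>" if "0 < s" for s
          using that by (simp add: one_ereal_def numeral_eq_ereal)
        moreover have "0 < ?s" using inf s0 by linarith
        ultimately have "1/2 * ?E * ereal ?s = \<infinity>" unfolding Einf by blast
        then show ?thesis by simp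
      qed
    qed
  qed
qed

text \<open>Source of the term \<open>ln (1 / pi_min \<pi>)\<close>: values at points are controlled
  by the norm at the price of the mass of the point.\<close>

lemma point_evaluation_le:
  assumes f: "f \<in> L2 \<pi>" shows "(cmod (f x))\<^sup>2 * measure \<pi> {x} \<le> (L2_norm \<pi> f)\<^sup>2"
proof -
  have "(cmod (f x))\<^sup>2 * measure \<pi> {x} = (\<integral>y. (cmod (f x))\<^sup>2 * indicator {x} y \<partial>\<pi>)" by simp
  also have "\<dots> \<le> (\<integral>y. (cmod (f y))\<^sup>2 \<partial>\<pi>)"
  proof (rule integral_mono[OF _ L2_integrable[OF f]])
    have "integrable \<pi> (indicator {x} :: 'a \<Rightarrow> real)"
      by (rule integrable_const_bound[of _ 1]) (auto split: split_indicator)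
    then show "integrable \<pi> (\<lambda>y. (cmod (f x))\<^sup>2 * indicator {x} y)" by (rule integrable_mult_right)
  qed (auto simp: indicator_def)
  finally show ?thesis by (simp add: L2_norm_sq)
qed

lemma distribution_return: "distribution (return borel (x::'a))"
  by (simp add: distribution_def prob_space_return)

lemma measure_kernel_pow_diff:
  assumes A: "A \<in> sets borel"
  shows "measure (kernel_pow P n x) A - measure \<pi> A = Re ((K ^^ n) (test_fun A) x)"
proof -
  have "(K ^^ n) (test_fun A) \<in> borel_measurable borel"
    using K_pow_bounded[OF test_fun_bounded[OF A]] by blast
  then show ?thesis
    unfolding kernel_pow_def measure_push_diff[OF distribution_return A] by (simp add: integral_return)
qed

lemma mix_dist_le:
  assumes "\<And>x A. A \<in> sets borel \<Longrightarrow> \<bar>measure (kernel_pow P n x) A - measure \<pi> A\<bar> \<le> c"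
  shows "mix_dist P \<pi> n \<le> c"
  unfolding mix_dist_def using assms by (intro cSUP_least d_TV_leI) auto

lemma t_mix_le: "mix_dist P \<pi> n \<le> \<epsilon> \<Longrightarrow> t_mix P \<pi> \<epsilon> \<le> enat n"
  unfolding t_mix_def by (rule INF_lower) simp

text \<open>For the degenerate cases: only here can \<open>tau P \<epsilon>\<close> be 0 when
  \<open>\<epsilon> < 1\<close>, and here the right side of the mixing time bound is 0.\<close>

lemma singleton_space:
  assumes "UNIV = {a :: 'a}"
  shows "pseudo_spectral_gap P \<pi> = \<infinity>" "mix_dist P \<pi> 0 \<le> 0"
proof -
  have f_const: "f = (\<lambda>x. f a)" for f :: "'a \<Rightarrow> complex" using assms by (metis (full_types) UNIV_I ext singletonD)
  show "pseudo_spectral_gap P \<pi> = \<infinity>"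
  proof (rule pseudo_spectral_gap_infinite)
    fix f assume "f \<in> L2_centred \<pi>"
    then have "(\<integral>x. f a \<partial>\<pi>) = 0" using f_const[of f] by (simp add: L2_centred_def)
    then have "f a = 0" by simp
    then have "f = (\<lambda>x. 0)" using f_const[of f] by simp
    then show "L2_norm \<pi> f = 0" by (simp add: L2_norm_def)
  qed
  show "mix_dist P \<pi> 0 \<le> 0"
  proof (rule mix_dist_le)
    fix x :: 'a and A :: "'a set" assume A: "A \<in> sets borel"
    have "A = {} \<or> A = UNIV" using assms by (metis subset_singletonD top_greatest)
    then show "\<bar>measure (kernel_pow P 0 x) A - measure \<pi> A\<bar> \<le> 0"
      by (auto simp: kernel_pow_def push_def measure_return)
  qed
qed

text \<open>\<open>L\<close> is chosen so that
  \<open>exp (- L) = (2 * \<epsilon>)\<^sup>2 * pi_min \<pi>\<close>. A centred indicator has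
  squared norm at most 1/4, so after decay by \<open>exp (- L)\<close> point evaluation gives at
  most \<open>\<epsilon>\<^sup>2\<close>.\<close>

lemma t_mix_upper_bound:
  assumes fin: "finite (UNIV :: 'a set)" and \<epsilon>: "0 < \<epsilon>" "\<epsilon> \<le> 1" and pm: "pi_min \<pi> \<noteq> 0"
  shows "ereal_of_enat (t_mix P \<pi> \<epsilon>) \<le> ereal (1 + 2 * ln (1 / (2 * \<epsilon>)) + ln (1 / pi_min \<pi>)) / pseudo_spectral_gap P \<pi>"
proof -
  let ?p = "pi_min \<pi>"
  have p_le: "?p \<le> measure \<pi> {x}" for x using fin by (simp add: pi_min_def)
  have "?p \<in> range (\<lambda>x. measure \<pi> {x})" unfolding pi_min_def using fin by (intro Min_in) auto
  then have p: "0 < ?p" using pm measure_nonneg[of \<pi>] by (smt (verit) imageE)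
  define L where "L = 2 * ln (1 / (2 * \<epsilon>)) + ln (1 / ?p)"
  show ?thesis
  proof (cases "\<exists>a::'a. UNIV = {a}")
    case True
    then obtain a :: 'a where a: "UNIV = {a}" by blast
    have "t_mix P \<pi> \<epsilon> \<le> enat 0" using singleton_space(2)[OF a] \<epsilon> by (intro t_mix_le) linarith
    then have "t_mix P \<pi> \<epsilon> = 0" by (simp add: zero_enat_def[symmetric])
    then show ?thesis using singleton_space(1)[OF a] by simp
  next
    case False
    obtain x y :: 'a where xy: "x \<noteq> y" using False by (metis (full_types) UNIV_eq_I singletonI)
    have "measure \<pi> {x} + measure \<pi> {y} = measure \<pi> {x, y}"
      using finite_measure_Union[of "{x}" "{y}"] xy by (simp add: insert_commute)
    then have sum: "measure \<pi> {x} + measure \<pi> {y} \<le> 1" using prob_le_1[of "{x, y}"] by simp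
    have p2: "?p \<le> 1 / 2" using sum p_le[of x] p_le[of y] by linarith
    \<comment> \<open>Two points force \<open>pi_min \<pi> \<le> 1 / 2\<close>, and
      \<open>\<epsilon> \<le> 1\<close>, so \<open>L \<ge> ln 2 - 2 * ln 2 > - 1\<close>. This makes
      the bound infinite for gap 0 and nonnegative otherwise.\<close>
    have L: "0 < 1 + L"
    proof -
      have "ln (1 / 2) \<le> ln (1 / (2 * \<epsilon>))" using \<epsilon> by (intro ln_mono) (auto simp: field_simps)
      moreover have "ln 2 \<le> ln (1 / ?p)" using p p2 by (intro ln_mono) (auto simp: field_simps)
      ultimately show ?thesis using ln_2_less_1 by (simp add: L_def ln_div)
    qed
    have px: "measure \<pi> {x} * (1 - measure \<pi> {x}) \<noteq> 0" using sum p p_le[of x] p_le[of y] by simp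
    \<comment> \<open>A non-null centred function, as \<open>pseudo_spectral_gap_attained\<close>
      requires.\<close>
    have nontriv: "L2_norm \<pi> (test_fun {x}) \<noteq> 0" using px test_fun_norm[of "{x}"] by force
    show ?thesis
    proof (cases "pseudo_spectral_gap P \<pi> = 0")
      case True
      moreover have "ereal (1 + L) / 0 = \<infinity>" using L by (simp add: divide_ereal_def)
      ultimately show ?thesis by (simp add: L_def add.assoc)
    next
      case False
      then have pos: "0 < pseudo_spectral_gap P \<pi>" using pseudo_spectral_gap_nonneg by (simp add: less_le)
      obtain \<gamma> k where \<gamma>: "pseudo_spectral_gap P \<pi> = ereal \<gamma>" "0 < \<gamma>" and k: "k \<ge> 1" "real k * \<gamma> \<le> 1"
        and contr: "\<And>g. g \<in> L2_centred \<pi> \<Longrightarrow> (L2_norm \<pi> ((K ^^ k) g))\<^sup>2 \<le> (1 - real k * \<gamma>) * (L2_norm \<pi> g)\<^sup>2"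
        by (rule pseudo_spectral_gap_attained[OF pos test_fun_centred nontriv]) auto
      \<comment> \<open>Rounding down keeps \<open>n\<close> below the claimed bound. It suffices
        because the decay estimate sees \<open>n + 1\<close>:
        \<open>\<gamma> * (n + 1) - 1 \<ge> L\<close>.\<close>
      define n where "n = nat \<lfloor>(1 + L) / \<gamma>\<rfloor>"
      have n: "real n \<le> (1 + L) / \<gamma>" "(1 + L) / \<gamma> \<le> real n + 1"
        using L \<gamma>(2) by (auto simp: n_def of_nat_nat real_of_int_floor_add_one_ge)
      have "(1 - real k * \<gamma>) ^ (n div k) \<le> exp (- (real k * \<gamma>)) ^ (n div k)"
        using k(2) exp_ge_add_one_self[of "- (real k * \<gamma>)"] by (intro power_mono) auto
      also have "\<dots> = exp (- (\<gamma> * real (k * (n div k))))"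
        by (simp add: exp_of_nat_mult[symmetric] algebra_simps)
      also have "\<dots> \<le> exp (- L)"
      proof -
        have "\<gamma> * (real n + 1 - 1 / \<gamma>) \<le> \<gamma> * real (k * (n div k))"
          using quotient_lower_bound[OF k(1) \<gamma>(2) k(2), of n] \<gamma>(2) by (intro mult_left_mono) auto
        moreover have "\<gamma> * (real n + 1 - 1 / \<gamma>) = \<gamma> * (real n + 1) - 1" using \<gamma>(2) by (simp add: field_simps)
        moreover have "1 + L \<le> \<gamma> * (real n + 1)" using n(2) \<gamma>(2) by (simp add: field_simps)
        ultimately show ?thesis by simp
      qed
      also have "\<dots> = (2 * \<epsilon>)\<^sup>2 * ?p"
      proof -
        have "ln (1 / w) = - ln w" "ln (w\<^sup>2 * ?p) = 2 * ln w + ln ?p" if "0 < w" for w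
          using that p by (simp_all add: ln_div ln_mult ln_realpow)
        from this[of "2 * \<epsilon>"] have "- L = ln ((2 * \<epsilon>)\<^sup>2 * ?p)"
          using \<epsilon> p by (simp add: L_def ln_div)
        then show ?thesis using \<epsilon> p by simp
      qed
      finally have decay: "sqrt ((1 - real k * \<gamma>) ^ (n div k)) \<le> 2 * \<epsilon> * sqrt ?p"
        using \<epsilon> real_sqrt_le_mono by (fastforce simp: real_sqrt_mult)
      have "mix_dist P \<pi> n \<le> \<epsilon>"
      proof (rule mix_dist_le)
        fix z :: 'a and A :: "'a set" assume A: "A \<in> sets borel"
        let ?f = "(K ^^ n) (test_fun A)"
        have fL: "?f \<in> L2 \<pi>" using K_pow_centred[OF test_fun_centred[OF A]] by (simp add: L2_centred_def)
        have "L2_norm \<pi> ?f \<le> 1/2 * sqrt ((1 - real k * \<gamma>) ^ (n div k))"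
          by (rule pseudo_spectral_gap_decay[OF k contr test_fun_centred[OF A] test_fun_norm_le[OF A]])
        also have "\<dots> \<le> \<epsilon> * sqrt ?p" using decay by simp
        finally have "(L2_norm \<pi> ?f)\<^sup>2 \<le> (\<epsilon> * sqrt ?p)\<^sup>2" by (intro power_mono L2_norm_nonneg)
        also have "\<dots> = \<epsilon>\<^sup>2 * ?p" using p by (simp add: power_mult_distrib)
        finally have "(L2_norm \<pi> ?f)\<^sup>2 \<le> \<epsilon>\<^sup>2 * ?p" .
        moreover have "(cmod (?f z))\<^sup>2 * ?p \<le> (cmod (?f z))\<^sup>2 * measure \<pi> {z}" by (intro mult_left_mono p_le) simp
        ultimately have "(cmod (?f z))\<^sup>2 * ?p \<le> \<epsilon>\<^sup>2 * ?p" using point_evaluation_le[OF fL, of z] by linarith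
        then have "(cmod (?f z))\<^sup>2 \<le> \<epsilon>\<^sup>2" using p by (rule mult_right_le_imp_le)
        then have "cmod (?f z) \<le> \<epsilon>" by (rule power2_le_imp_le) (use \<epsilon> in simp)
        then show "\<bar>measure (kernel_pow P n z) A - measure \<pi> A\<bar> \<le> \<epsilon>"
          unfolding measure_kernel_pow_diff[OF A] by (rule order_trans[OF abs_Re_le_cmod])
      qed
      then have "ereal_of_enat (t_mix P \<pi> \<epsilon>) \<le> ereal_of_enat (enat n)"
        unfolding ereal_of_enat_le_iff by (rule t_mix_le)
      also have "\<dots> \<le> ereal ((1 + L) / \<gamma>)" using n(1) by simp
      also have "\<dots> = ereal (1 + 2 * ln (1 / (2 * \<epsilon>)) + ln (1 / ?p)) / pseudo_spectral_gap P \<pi>"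
        using \<gamma> by (simp add: L_def add.assoc)
      finally show ?thesis .
    qed
  qed
qed

end

section \<open>Contraction of oscillations\<close>

lemma distribution_abs_diff_le_1:
  assumes "distribution \<mu>" "distribution \<nu>"
  shows "\<bar>measure \<mu> A - measure \<nu> A\<bar> \<le> 1"
proof -
  have "measure \<mu> A \<le> 1" "measure \<nu> A \<le> 1"
    using assms prob_space.prob_le_1 by (auto simp: distribution_def)
  then show ?thesis using measure_nonneg[of \<mu> A] measure_nonneg[of \<nu> A] by linarith
qed

lemma d_TV_upper:
  assumes "distribution \<mu>" "distribution \<nu>" "A \<in> sets borel"
  shows "\<bar>measure \<mu> A - measure \<nu> A\<bar> \<le> d_TV \<mu> \<nu>"
  unfolding d_TV_def
  by (rule cSUP_upper[OF assms(3)]) (auto intro!: bdd_aboveI[of _ 1] distribution_abs_diff_le_1 assms)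

lemma d_TV_le_1: "distribution \<mu> \<Longrightarrow> distribution \<nu> \<Longrightarrow> d_TV \<mu> \<nu> \<le> 1"
  by (rule d_TV_leI) (rule distribution_abs_diff_le_1)

lemma d_TV_triangle:
  assumes "distribution \<mu>" "distribution \<nu>" "distribution \<rho>"
  shows "d_TV \<mu> \<nu> \<le> d_TV \<mu> \<rho> + d_TV \<nu> \<rho>"
proof (rule d_TV_leI)
  fix A :: "'a set" assume A: "A \<in> sets borel"
  show "\<bar>measure \<mu> A - measure \<nu> A\<bar> \<le> d_TV \<mu> \<rho> + d_TV \<nu> \<rho>"
    using d_TV_upper[OF assms(1,3) A] d_TV_upper[OF assms(2,3) A] by linarith
qed

text \<open>A discrete layer-cake formula, used at \<open>y = n * f x\<close> to write a rounding of
  \<open>f\<close> through superlevel sets.\<close>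

lemma floor_eq_sum_indicator:
  assumes "0 \<le> y" "y \<le> real n"
  shows "(\<Sum>i\<in>{1..n}. indicator {x. real i \<le> x} y :: real) = real_of_int \<lfloor>y\<rfloor>"
proof -
  have "(\<Sum>i\<in>{1..n}. indicator {x. real i \<le> x} y :: real) = (\<Sum>i\<in>{1..n} \<inter> {i. real i \<le> y}. 1)"
    by (simp add: sum.inter_restrict indicator_def if_distrib cong: if_cong)
  also have "{1..n} \<inter> {i. real i \<le> y} = {1..nat \<lfloor>y\<rfloor>}"
    using assms by (auto simp: le_nat_iff le_floor_iff)
  finally show ?thesis using assms by simp
qed

text \<open>Approximating \<open>f\<close> by averages of indicators of its superlevel sets keeps the sharp constant
  \<open>1\<close>.\<close>

lemma d_TV_integral_unit:
  fixes f :: "'a::polish_space \<Rightarrow> real"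
  assumes \<mu>: "distribution \<mu>" and \<nu>: "distribution \<nu>"
    and f: "f \<in> borel_measurable borel" "\<And>x. 0 \<le> f x" "\<And>x. f x \<le> 1"
  shows "\<bar>(\<integral>x. f x \<partial>\<mu>) - (\<integral>x. f x \<partial>\<nu>)\<bar> \<le> d_TV \<mu> \<nu>"
proof -
  have approx: "\<bar>(\<integral>x. f x \<partial>\<rho>) - (\<Sum>i\<in>{1..n}. measure \<rho> {x. real i \<le> real n * f x}) / real n\<bar> \<le> 1 / real n"
    if \<rho>: "distribution \<rho>" and n: "n \<ge> 1" for \<rho> n
  proof -
    interpret r: prob_space \<rho> using \<rho> by (simp add: distribution_def)
    have sets: "sets \<rho> = sets borel" using \<rho> by (simp add: distribution_def)
    have fm [measurable]: "f \<in> borel_measurable \<rho>" using f(1) unfolding measurable_cong_sets[OF sets refl] .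
    have S: "{x. real i \<le> real n * f x} \<in> sets \<rho>" for i
    proof -
      have "{x \<in> space \<rho>. real i \<le> real n * f x} \<in> sets \<rho>" by measurable
      then show ?thesis using sets_eq_imp_space_eq[OF sets] by simp
    qed
    let ?s = "\<lambda>x. (\<Sum>i\<in>{1..n}. indicator {x. real i \<le> real n * f x} x) / real n"
    have ind: "integrable \<rho> (indicator {x. real i \<le> real n * f x} :: 'a \<Rightarrow> real)" for i
      by (rule r.integrable_const_bound[of _ 1]) (use S in \<open>auto split: split_indicator\<close>)
    have int_s: "integrable \<rho> ?s" using ind by simp
    have int_f: "integrable \<rho> f" by (rule r.integrable_const_bound[of _ 1]) (use f in auto)
    have ints: "(\<integral>x. ?s x \<partial>\<rho>) = (\<Sum>i\<in>{1..n}. measure \<rho> {x. real i \<le> real n * f x}) / real n"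
      using ind S by simp
    have close: "\<bar>f x - ?s x\<bar> \<le> 1 / real n" for x
    proof -
      have "0 \<le> real n * f x" "real n * f x \<le> real n" using f(2,3)[of x] by (auto simp: mult_left_le)
      from floor_eq_sum_indicator[OF this]
      have s: "?s x = real_of_int \<lfloor>real n * f x\<rfloor> / real n" by (simp add: indicator_def)
      have "f x - ?s x = (real n * f x - real_of_int \<lfloor>real n * f x\<rfloor>) / real n"
        unfolding s using n by (simp add: field_simps)
      moreover have "\<bar>real n * f x - real_of_int \<lfloor>real n * f x\<rfloor>\<bar> \<le> 1" by linarith
      ultimately show ?thesis using n by (simp add: divide_right_mono)
    qed
    have "\<bar>(\<integral>x. f x \<partial>\<rho>) - (\<integral>x. ?s x \<partial>\<rho>)\<bar> = \<bar>\<integral>x. f x - ?s x \<partial>\<rho>\<bar>"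
      using int_s int_f by simp
    also have "\<dots> \<le> (\<integral>x. \<bar>f x - ?s x\<bar> \<partial>\<rho>)" by (rule integral_abs_bound)
    also have "\<dots> \<le> (\<integral>x. 1 / real n \<partial>\<rho>)"
      using int_s int_f close by (intro integral_mono integrable_abs Bochner_Integration.integrable_diff) auto
    also have "\<dots> = 1 / real n" using r.prob_space by simp
    finally show ?thesis unfolding ints .
  qed
  \<comment> \<open>Every superlevel set contributes at most \<open>d_TV \<mu> \<nu>\<close> and the
    average over levels keeps this constant; the two rounding errors vanish in the limit.\<close>
  have le: "\<bar>(\<integral>x. f x \<partial>\<mu>) - (\<integral>x. f x \<partial>\<nu>)\<bar> \<le> d_TV \<mu> \<nu> + 2 / real (Suc n)" for n
  proof -
    let ?n = "Suc n"
    let ?S = "\<lambda>i. {x. real i \<le> real ?n * f x}"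
    have S: "?S i \<in> sets borel" for i
    proof -
      have "{x \<in> space borel. real i \<le> real ?n * f x} \<in> sets borel" using f(1) by measurable
      then show ?thesis by simp
    qed
    have "\<bar>(\<Sum>i\<in>{1..?n}. measure \<mu> (?S i)) / real ?n - (\<Sum>i\<in>{1..?n}. measure \<nu> (?S i)) / real ?n\<bar>
       = \<bar>\<Sum>i\<in>{1..?n}. measure \<mu> (?S i) - measure \<nu> (?S i)\<bar> / real ?n"
      by (simp only: sum_subtractf diff_divide_distrib[symmetric] abs_divide abs_of_nat)
    also have "\<dots> \<le> (\<Sum>i\<in>{1..?n}. d_TV \<mu> \<nu>) / real ?n"
      by (intro divide_right_mono order_trans[OF sum_abs] sum_mono d_TV_upper \<mu> \<nu> S) simp
    also have "\<dots> = d_TV \<mu> \<nu>" by simp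
    finally have "\<bar>(\<Sum>i\<in>{1..?n}. measure \<mu> (?S i)) / real ?n - (\<Sum>i\<in>{1..?n}. measure \<nu> (?S i)) / real ?n\<bar> \<le> d_TV \<mu> \<nu>" .
    moreover have "2 / real ?n = 1 / real ?n + 1 / real ?n" by simp
    ultimately show ?thesis using approx[OF \<mu>, of ?n] approx[OF \<nu>, of ?n] by linarith
  qed
  have "(\<lambda>n. d_TV \<mu> \<nu> + 2 / real (Suc n)) \<longlonglongrightarrow> d_TV \<mu> \<nu> + 0"
    by (intro tendsto_add tendsto_const LIMSEQ_Suc[OF lim_const_over_n])
  then show ?thesis using LIMSEQ_le_const[of _ "d_TV \<mu> \<nu> + 0"] le by auto
qed

lemma d_TV_integral_le:
  fixes f :: "'a::polish_space \<Rightarrow> real"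
  assumes \<mu>: "distribution \<mu>" and \<nu>: "distribution \<nu>"
    and f: "f \<in> borel_measurable borel" "\<And>x. a \<le> f x" "\<And>x. f x \<le> b"
  shows "\<bar>(\<integral>x. f x \<partial>\<mu>) - (\<integral>x. f x \<partial>\<nu>)\<bar> \<le> (b - a) * d_TV \<mu> \<nu>"
proof (cases "a < b")
  case True
  let ?g = "\<lambda>x. (f x - a) / (b - a)"
  have *: "(\<integral>x. ?g x \<partial>\<rho>) = ((\<integral>x. f x \<partial>\<rho>) - a) / (b - a)" if "distribution \<rho>" for \<rho>
  proof -
    interpret r: prob_space \<rho> using that by (simp add: distribution_def)
    have sets: "sets \<rho> = sets borel" using that by (simp add: distribution_def)
    have fm: "f \<in> borel_measurable \<rho>" using f(1) unfolding measurable_cong_sets[OF sets refl] .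
    have "\<bar>f x\<bar> \<le> \<bar>a\<bar> + \<bar>b\<bar>" for x using f(2,3)[of x] by linarith
    then have "integrable \<rho> f" using fm by (intro r.integrable_const_bound[of _ "\<bar>a\<bar> + \<bar>b\<bar>"]) auto
    then show ?thesis using r.prob_space by simp
  qed
  have "\<bar>(\<integral>x. ?g x \<partial>\<mu>) - (\<integral>x. ?g x \<partial>\<nu>)\<bar> \<le> d_TV \<mu> \<nu>"
    using f True by (intro d_TV_integral_unit[OF \<mu> \<nu>]) (auto simp: field_simps)
  then have "\<bar>(\<integral>x. f x \<partial>\<mu>) - (\<integral>x. f x \<partial>\<nu>)\<bar> / (b - a) \<le> d_TV \<mu> \<nu>"
    unfolding *[OF \<mu>] *[OF \<nu>] diff_divide_distrib[symmetric] using True by simp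
  then show ?thesis using True by (simp add: field_simps)
next
  case False
  have fa: "f x = a" "a = b" for x using f(2,3)[of x] False by linarith+
  then have "f = (\<lambda>x. a)" by blast
  then show ?thesis
    using prob_space.prob_space[of \<mu>] prob_space.prob_space[of \<nu>] \<mu> \<nu> fa(2) by (simp add: distribution_def)
qed

section \<open>Action of the kernel and its adjoint on functions with values in an interval\<close>

context stationary_kernel begin

lemma K_indicator:
  assumes "A \<in> sets borel"
  shows "K (\<lambda>x. complex_of_real (indicator A x)) x = complex_of_real (measure (P x) A)"
proof -
  have "K (\<lambda>x. complex_of_real (indicator A x)) x = complex_of_real (\<integral>y. indicator A y \<partial>P x)"
    unfolding kernel_op_def by (rule integral_complex_of_real)
  then show ?thesis using assms by simp
qed

text \<open>Pair with the indicator of the set \<open>A\<close> where the claim fails. Moving the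
  adjoint over gives the integral of \<open>Re (c * f x) - b\<close> against the nonnegative weight
  \<open>measure (P x) A\<close>, which is at most 0. Half planes express real-valuedness and both
  interval bounds at once.\<close>

lemma K_adj_half_plane:
  assumes f: "f \<in> L2 \<pi>" and b: "AE x in \<pi>. Re (c * f x) \<le> b"
  shows "AE x in \<pi>. Re (c * K_adj f x) \<le> b"
proof -
  let ?g = "K_adj f"
  have g: "?g \<in> L2 \<pi>" by (rule L2_adjoint_in[OF L2_adjoint_sym[OF K_adjoint] f])
  have gm [measurable]: "?g \<in> borel_measurable borel" by (rule L2_borel[OF g])
  define A where "A = {x. b < Re (c * ?g x)}"
  have A: "A \<in> sets borel"
  proof -
    have "{x \<in> space borel. b < Re (c * ?g x)} \<in> sets borel" by measurable
    then show ?thesis by (simp add: A_def)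
  qed
  let ?i = "\<lambda>x. complex_of_real (indicator A x)"
  have iL: "?i \<in> L2 \<pi>" by (rule real_indicator_L2[OF A])
  have KL: "K ?i \<in> L2 \<pi>" by (rule K_L2[OF iL])
  have Ki: "K ?i x = complex_of_real (measure (P x) A)" for x by (rule K_indicator[OF A])
  have inner: "L2_inner \<pi> ?g ?i = L2_inner \<pi> f (K ?i)"
    by (rule L2_adjoint_inner[OF L2_adjoint_sym[OF K_adjoint] f iL])
  have int_i: "(\<integral>x. K ?i x \<partial>\<pi>) = (\<integral>x. ?i x \<partial>\<pi>)"
    using integral_adjoint[OF K_adjoint _ iL] K_adj_pow_const[of 1] by simp
  have ig: "integrable \<pi> (\<lambda>x. ?g x * cnj (?i x))" by (rule L2_mult_integrable[OF g iL])
  have ik: "integrable \<pi> (\<lambda>x. f x * cnj (K ?i x))" by (rule L2_mult_integrable[OF f KL])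
  have ii: "integrable \<pi> ?i" "integrable \<pi> (K ?i)" using L1_le_L2(1) iL KL by auto
  let ?G = "\<lambda>x. Re (c * (?g x * cnj (?i x)) - b * ?i x)"
  let ?F = "\<lambda>x. Re (c * (f x * cnj (K ?i x)) - b * K ?i x)"
  have iG: "integrable \<pi> ?G" using ig ii by (intro integrable_Re Bochner_Integration.integrable_diff integrable_mult_right)
  have "(\<integral>x. ?G x \<partial>\<pi>) = Re (\<integral>x. c * (?g x * cnj (?i x)) - b * ?i x \<partial>\<pi>)"
    using ig ii by (intro integral_Re Bochner_Integration.integrable_diff integrable_mult_right)
  also have "(\<integral>x. c * (?g x * cnj (?i x)) - b * ?i x \<partial>\<pi>) = c * L2_inner \<pi> ?g ?i - b * (\<integral>x. ?i x \<partial>\<pi>)"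
    unfolding L2_inner_def by (subst Bochner_Integration.integral_diff) (use ig ii in \<open>simp_all only: integrable_mult_right integral_mult_right_zero\<close>)
  also have "\<dots> = c * L2_inner \<pi> f (K ?i) - b * (\<integral>x. K ?i x \<partial>\<pi>)" by (simp only: inner int_i)
  also have "\<dots> = (\<integral>x. c * (f x * cnj (K ?i x)) - b * K ?i x \<partial>\<pi>)"
    unfolding L2_inner_def by (subst Bochner_Integration.integral_diff) (use ik ii in \<open>simp_all only: integrable_mult_right integral_mult_right_zero\<close>)
  also have "Re \<dots> = (\<integral>x. ?F x \<partial>\<pi>)"
    using ik ii by (intro integral_Re[symmetric] Bochner_Integration.integrable_diff integrable_mult_right)
  also have "\<dots> \<le> (\<integral>x. 0 \<partial>\<pi>)"
  proof (rule integral_mono_AE)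
    show "integrable \<pi> ?F" using ik ii by (intro integrable_Re Bochner_Integration.integrable_diff integrable_mult_right)
    show "AE x in \<pi>. ?F x \<le> 0"
      using b
    proof eventually_elim
      case (elim x)
      have "?F x = (Re (c * f x) - b) * measure (P x) A" by (simp add: Ki algebra_simps)
      then show ?case using elim by (simp add: mult_nonpos_nonneg)
    qed
  qed simp
  finally have le0: "(\<integral>x. ?G x \<partial>\<pi>) \<le> 0" by simp
  \<comment> \<open>The integrand is strictly positive on \<open>A\<close> and zero elsewhere, while
    its integral is at most 0; so \<open>A\<close> is null.\<close>
  have G: "?G x = (Re (c * ?g x) - b) * indicator A x" for x by (simp add: algebra_simps split: split_indicator)
  then have G0: "0 \<le> ?G x" for x by (auto simp: A_def indicator_def)
  have "(\<integral>x. ?G x \<partial>\<pi>) = 0"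
    by (rule antisym[OF le0 Bochner_Integration.integral_nonneg[OF G0]])
  then have "AE x in \<pi>. ?G x = 0" unfolding integral_nonneg_eq_0_iff_AE[OF iG AE_I2[OF G0]] .
  then show ?thesis
  proof eventually_elim
    case (elim x)
    have "(Re (c * ?g x) - b) * indicator A x = 0" by (rule trans[OF G[symmetric] elim])
    then show ?case by (cases "x \<in> A") (auto simp: A_def)
  qed
qed

lemma K_adj_pow_half_plane:
  assumes f: "f \<in> L2 \<pi>" and b: "AE x in \<pi>. Re (c * f x) \<le> b"
  shows "AE x in \<pi>. Re (c * (K_adj ^^ n) f x) \<le> b"
proof (induction n)
  case (Suc n)
  have "(K_adj ^^ n) f \<in> L2 \<pi>" by (rule L2_adjoint_in[OF L2_adjoint_sym[OF K_pow_adjoint] f])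
  from K_adj_half_plane[OF this Suc] show ?case by simp
qed (use b in simp)

text \<open>Bounds on the essential range. They hold almost everywhere because \<open>K_adj\<close>
  is determined only up to null sets.\<close>

definition real_range :: "real \<Rightarrow> real \<Rightarrow> ('a \<Rightarrow> complex) \<Rightarrow> bool" where
  "real_range a b f \<longleftrightarrow> f \<in> L2 \<pi> \<and> (AE x in \<pi>. Im (f x) = 0 \<and> a \<le> Re (f x) \<and> Re (f x) \<le> b)"

lemma real_range_le:
  assumes "real_range a b f" shows "a \<le> b"
proof -
  have "AE x in \<pi>. Im (f x) = 0 \<and> a \<le> Re (f x) \<and> Re (f x) \<le> b" using assms by (simp only: real_range_def)
  then have "AE x in \<pi>. a \<le> b" by eventually_elim linarith
  then show ?thesis by simp
qed

lemma real_range_K_adj_pow: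
  assumes f: "real_range a b f" shows "real_range a b ((K_adj ^^ n) f)"
proof -
  have fL: "f \<in> L2 \<pi>" and AE: "AE x in \<pi>. Im (f x) = 0 \<and> a \<le> Re (f x) \<and> Re (f x) \<le> b" using f by (auto simp: real_range_def)
  \<comment> \<open>Four half planes cut out the segment from \<open>a\<close> to \<open>b\<close>
    on the real axis; the two with \<open>\<i>\<close> make the imaginary part vanish.\<close>
  have "AE x in \<pi>. Re (1 * f x) \<le> b" "AE x in \<pi>. Re (- 1 * f x) \<le> - a"
    "AE x in \<pi>. Re (\<i> * f x) \<le> 0" "AE x in \<pi>. Re (- \<i> * f x) \<le> 0"
    using AE by (eventually_elim, simp)+
  from this[THEN K_adj_pow_half_plane[OF fL, where n = n]]
  have "AE x in \<pi>. Im ((K_adj ^^ n) f x) = 0 \<and> a \<le> Re ((K_adj ^^ n) f x) \<and> Re ((K_adj ^^ n) f x) \<le> b"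
    by eventually_elim simp
  then show ?thesis
    using L2_adjoint_in[OF L2_adjoint_sym[OF K_pow_adjoint] fL] by (simp add: real_range_def)
qed

lemma kernel_pow_distribution: "distribution (kernel_pow P n x)"
  unfolding kernel_pow_def by (rule distribution_push[OF distribution_return])

text \<open>The values at two points are integrals of one function against two distributions at
  distance at most \<epsilon>, so they differ by at most \<epsilon> times its oscillation. The
  position \<open>a'\<close> of the new interval is not controlled, only its length.\<close>

lemma real_range_K_pow:
  assumes f: "real_range a b f"
    and \<epsilon>: "\<And>x y. d_TV (kernel_pow P t x) (kernel_pow P t y) \<le> \<epsilon>"
  shows "\<exists>a'. real_range a' (a' + \<epsilon> * (b - a)) ((K ^^ t) f)"
proof -
  have ab: "a \<le> b" by (rule real_range_le[OF f])
  have fL: "f \<in> L2 \<pi>" and AE: "AE x in \<pi>. Im (f x) = 0 \<and> a \<le> Re (f x) \<and> Re (f x) \<le> b" using f by (auto simp: real_range_def)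
  have [measurable]: "f \<in> borel_measurable borel" by (rule L2_borel[OF fL])
  \<comment> \<open>The distributions \<open>kernel_pow P t x\<close> may charge null sets of \<pi>,
    so bounds valid almost everywhere are first made to hold everywhere.\<close>
  define r where "r x = max a (min b (Re (f x)))" for x
  have r: "r \<in> borel_measurable borel" "\<And>x. a \<le> r x" "\<And>x. r x \<le> b"
    using ab unfolding r_def[abs_def] by auto
  let ?f = "\<lambda>x. complex_of_real (r x)"
  have fm: "?f \<in> borel_measurable borel" using r(1) by measurable
  have fb: "cmod (?f x) \<le> \<bar>a\<bar> + \<bar>b\<bar>" for x
    unfolding norm_of_real using r(2,3)[of x] by linarith
  have ff: "AE x in \<pi>. f x = ?f x"
    using AE by eventually_elim (simp add: r_def complex_eq_iff)
  have f'L: "?f \<in> L2 \<pi>" by (rule L2_cong[OF fL _ ff]) (use fm in measurable)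
  define R where "R x = (\<integral>y. r y \<partial>kernel_pow P t x)" for x
  have Kf: "(K ^^ t) ?f x = complex_of_real (R x)" for x
  proof -
    have "(K ^^ t) ?f \<in> borel_measurable borel" using K_pow_bounded[OF fm fb] by blast
    then have "(K ^^ t) ?f x = (\<integral>y. ?f y \<partial>kernel_pow P t x)"
      unfolding kernel_pow_def integral_push[OF distribution_return fm fb] by (simp add: integral_return)
    then show ?thesis by (simp add: R_def)
  qed
  have osc: "R x - \<epsilon> * (b - a) \<le> R y" for x y
  proof -
    have "\<bar>R x - R y\<bar> \<le> (b - a) * d_TV (kernel_pow P t x) (kernel_pow P t y)"
      unfolding R_def by (rule d_TV_integral_le[OF kernel_pow_distribution kernel_pow_distribution r])
    also have "\<dots> \<le> (b - a) * \<epsilon>" using ab by (intro mult_left_mono \<epsilon>) simp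
    finally show ?thesis by (simp add: algebra_simps)
  qed
  have bdd: "bdd_below (range R)" using osc by (intro bdd_belowI2[of _ "R undefined - \<epsilon> * (b - a)"]) blast
  define a' where "a' = (INF x. R x)"
  have a': "a' \<le> R x" "R x \<le> a' + \<epsilon> * (b - a)" for x
  proof -
    show "a' \<le> R x" unfolding a'_def by (rule cINF_lower[OF bdd]) simp
    have "R x - \<epsilon> * (b - a) \<le> a'" unfolding a'_def by (rule cINF_greatest) (use osc in auto)
    then show "R x \<le> a' + \<epsilon> * (b - a)" by simp
  qed
  have "AE x in \<pi>. (K ^^ t) f x = (K ^^ t) ?f x"
    by (rule L2_adjoint_AE_cong[OF K_pow_adjoint fL f'L ff])
  then have "AE x in \<pi>. Im ((K ^^ t) f x) = 0 \<and> a' \<le> Re ((K ^^ t) f x) \<and> Re ((K ^^ t) f x) \<le> a' + \<epsilon> * (b - a)"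
    by eventually_elim (simp add: Kf a')
  then show ?thesis using K_pow_L2[OF fL] by (auto simp: real_range_def)
qed

text \<open>Mean zero puts 0 between \<open>a\<close> and \<open>b\<close>. The constant is crude,
  which is harmless because only the geometric rate enters
  \<open>nrm_iterate_log_convex\<close>.\<close>

lemma real_range_centred_norm_le:
  assumes f: "real_range a b f" "f \<in> L2_centred \<pi>" shows "L2_norm \<pi> f \<le> b - a"
proof -
  have fL: "f \<in> L2 \<pi>" and AE: "AE x in \<pi>. Im (f x) = 0 \<and> a \<le> Re (f x) \<and> Re (f x) \<le> b" using f by (auto simp: real_range_def)
  have i: "integrable \<pi> f" by (rule L1_le_L2(1)[OF fL])
  have I0: "(\<integral>x. Re (f x) \<partial>\<pi>) = 0" using f(2) i by (simp add: L2_centred_def)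
  have "(\<integral>x. a \<partial>\<pi>) \<le> (\<integral>x. Re (f x) \<partial>\<pi>)" "(\<integral>x. Re (f x) \<partial>\<pi>) \<le> (\<integral>x. b \<partial>\<pi>)"
    by (rule integral_mono_AE, simp, use i in simp, use AE in eventually_elim, simp)
      (rule integral_mono_AE, use i in simp, simp, use AE in eventually_elim, simp)
  then have ab: "a \<le> 0" "0 \<le> b" using I0 by simp_all
  have "(L2_norm \<pi> f)\<^sup>2 \<le> (\<integral>x. (b - a)\<^sup>2 \<partial>\<pi>)"
    unfolding L2_norm_sq
  proof (rule integral_mono_AE[OF L2_integrable[OF fL]])
    show "AE x in \<pi>. (cmod (f x))\<^sup>2 \<le> (b - a)\<^sup>2"
      using AE
    proof eventually_elim
      case (elim x)
      then have "cmod (f x) = \<bar>Re (f x)\<bar>" by (simp add: cmod_def)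
      also have "\<dots> \<le> b - a" using elim ab by linarith
      finally show ?case by (intro power_mono) auto
    qed
  qed simp
  also have "\<dots> = (b - a)\<^sup>2" by simp
  finally show ?thesis by (rule power2_le_imp_le) (use ab in simp)
qed

lemma K_sym_centred: "f \<in> L2_centred \<pi> \<Longrightarrow> K_sym t f \<in> L2_centred \<pi>"
  using L2_adjoint_in[OF K_sym_adjoint] integral_adjoint[OF K_sym_adjoint K_sym_const, of f t]
  by (simp add: L2_centred_def)

text \<open>In each round the powers of \<open>K\<close> shorten the interval by the factor
  \<epsilon> and those of the adjoint keep it.\<close>

lemma K_sym_iterate_norm_le:
  assumes \<epsilon>: "\<And>x y. d_TV (kernel_pow P t x) (kernel_pow P t y) \<le> \<epsilon>"
    and f: "real_range a b f" "f \<in> L2_centred \<pi>"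
  shows "L2_norm \<pi> ((K_sym t ^^ n) f) \<le> (b - a) * \<epsilon> ^ n"
proof -
  have "\<exists>a'. real_range a' (a' + (b - a) * \<epsilon> ^ n) ((K_sym t ^^ n) f) \<and> (K_sym t ^^ n) f \<in> L2_centred \<pi>"
  proof (induction n)
    case 0
    show ?case using f by (intro exI[of _ a]) simp
  next
    case (Suc n)
    let ?g = "(K_sym t ^^ n) f"
    obtain a' where g: "real_range a' (a' + (b - a) * \<epsilon> ^ n) ?g" "?g \<in> L2_centred \<pi>" using Suc by blast
    from real_range_K_pow[OF g(1) \<epsilon>] obtain a'' where
      "real_range a'' (a'' + \<epsilon> * (a' + (b - a) * \<epsilon> ^ n - a')) ((K ^^ t) ?g)" by blast
    from real_range_K_adj_pow[OF this, of t]
    have "real_range a'' (a'' + (b - a) * \<epsilon> ^ Suc n) ((K_sym t ^^ Suc n) f)"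
      by (simp add: K_sym_def algebra_simps)
    then show ?case using K_sym_centred[OF g(2), of t] by auto
  qed
  then obtain a' where "real_range a' (a' + (b - a) * \<epsilon> ^ n) ((K_sym t ^^ n) f)" "(K_sym t ^^ n) f \<in> L2_centred \<pi>" by blast
  from real_range_centred_norm_le[OF this] show ?thesis by simp
qed

lemma K_sym_contraction_bounded:
  assumes \<epsilon>: "\<And>x y. d_TV (kernel_pow P t x) (kernel_pow P t y) \<le> \<epsilon>" and \<epsilon>0: "0 \<le> \<epsilon>"
    and f: "f \<in> L2_centred \<pi>" "\<And>x. cmod (f x) \<le> B"
  shows "L2_norm \<pi> (K_sym t f) \<le> \<epsilon> * L2_norm \<pi> f"
proof -
  have fL: "f \<in> L2 \<pi>" and f0: "(\<integral>x. f x \<partial>\<pi>) = 0" using f(1) by (auto simp: L2_centred_def)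
  have [measurable]: "f \<in> borel_measurable \<pi>" by (rule L2_measurable[OF fL])
  have fi: "integrable \<pi> f" by (rule L1_le_L2(1)[OF fL])
  have part: "real_range (- B) B (\<lambda>x. complex_of_real (h x)) \<and> (\<lambda>x. complex_of_real (h x)) \<in> L2_centred \<pi>"
    if h: "h \<in> borel_measurable \<pi>" "\<And>x. \<bar>h x\<bar> \<le> B" "(\<integral>x. h x \<partial>\<pi>) = 0" for h
  proof -
    have L: "(\<lambda>x. complex_of_real (h x)) \<in> L2 \<pi>"
    proof (rule L2I)
      show "(\<lambda>x. complex_of_real (h x)) \<in> borel_measurable \<pi>" using h(1) by measurable
      have "\<bar>h x\<bar>\<^sup>2 \<le> B\<^sup>2" for x using h(2)[of x] by (intro power_mono) auto
      then show "integrable \<pi> (\<lambda>x. (cmod (complex_of_real (h x)))\<^sup>2)"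
        using h(1) by (intro integrable_const_bound[of _ "B\<^sup>2"]) auto
    qed
    have "- B \<le> h x \<and> h x \<le> B" for x using h(2)[of x] by linarith
    then show ?thesis using L h(3) by (simp add: real_range_def L2_centred_def)
  qed
  let ?u = "\<lambda>x. complex_of_real (Re (f x))" and ?v = "\<lambda>x. complex_of_real (Im (f x))"
  have "(\<integral>x. Re (f x) \<partial>\<pi>) = 0" "(\<integral>x. Im (f x) \<partial>\<pi>) = 0" using fi f0 by simp_all
  then have u: "real_range (- B) B ?u" "?u \<in> L2_centred \<pi>" and v: "real_range (- B) B ?v" "?v \<in> L2_centred \<pi>"
    using part[of "\<lambda>x. Re (f x)"] part[of "\<lambda>x. Im (f x)"] order_trans[OF abs_Re_le_cmod f(2)] order_trans[OF abs_Im_le_cmod f(2)]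
    by auto
  have uL: "?u \<in> L2 \<pi>" and vL: "?v \<in> L2 \<pi>" using u v by (auto simp: L2_centred_def)
  \<comment> \<open>Real and imaginary part each have range in an interval of length
    \<open>2 * B\<close>.\<close>
  have "nrm ((K_sym t ^^ n) f) \<le> (4 * B) * \<epsilon> ^ n" for n
  proof -
    have T: "L2_adjoint \<pi> (K_sym t ^^ n) (K_sym t ^^ n)" by (rule L2_adjoint_funpow[OF K_sym_adjoint])
    have fuv: "f = (\<lambda>x. ?u x + \<i> * ?v x)" by (simp add: fun_eq_iff complex_eq_iff)
    have "AE x in \<pi>. (K_sym t ^^ n) f x = (K_sym t ^^ n) ?u x + \<i> * (K_sym t ^^ n) ?v x"
      using L2_adjoint_add[OF T uL L2_cmult[OF vL, of \<i>]] L2_adjoint_scale[OF T vL, of \<i>]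
      unfolding fuv[symmetric] by eventually_elim simp
    then have "L2_norm \<pi> ((K_sym t ^^ n) f) = L2_norm \<pi> (\<lambda>x. (K_sym t ^^ n) ?u x + \<i> * (K_sym t ^^ n) ?v x)"
      by (rule L2_norm_cong) (intro L2_add L2_cmult L2_adjoint_in[OF T] fL uL vL)+
    also have "\<dots> \<le> L2_norm \<pi> ((K_sym t ^^ n) ?u) + L2_norm \<pi> (\<lambda>x. \<i> * (K_sym t ^^ n) ?v x)"
      using nrm_triangle[OF L2_adjoint_in[OF T uL] L2_cmult[OF L2_adjoint_in[OF T vL], of \<i>]] by (simp add: nrm_eq fun_add_eq)
    also have "\<dots> = L2_norm \<pi> ((K_sym t ^^ n) ?u) + L2_norm \<pi> ((K_sym t ^^ n) ?v)"
      by (simp add: L2_norm_cmult)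
    also have "\<dots> \<le> (B - - B) * \<epsilon> ^ n + (B - - B) * \<epsilon> ^ n"
      by (intro add_mono K_sym_iterate_norm_le \<epsilon> u v)
    finally show ?thesis by (simp add: nrm_eq)
  qed
  from nrm_iterate_log_convex[OF L2_adjoint_adj[OF K_sym_adjoint] fL this \<epsilon>0] show ?thesis by (simp add: nrm_eq)
qed

lemma L2_truncation_tendsto:
  assumes f: "f \<in> L2 \<pi>"
  shows "(\<lambda>n. L2_norm \<pi> (\<lambda>x. f x - f x * indicator {x. cmod (f x) \<le> real n} x)) \<longlonglongrightarrow> 0"
proof -
  have [measurable]: "f \<in> borel_measurable \<pi>" by (rule L2_measurable[OF f])
  let ?g = "\<lambda>n x. f x - f x * indicator {x. cmod (f x) \<le> real n} x"
  have "(\<lambda>n. \<integral>x. (cmod (?g n x))\<^sup>2 \<partial>\<pi>) \<longlonglongrightarrow> (\<integral>x. 0 \<partial>\<pi>)"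
  proof (rule integral_dominated_convergence[where w = "\<lambda>x. (cmod (f x))\<^sup>2"])
    show "integrable \<pi> (\<lambda>x. (cmod (f x))\<^sup>2)" by (rule L2_integrable[OF f])
    show "(\<lambda>x. (cmod (?g n x))\<^sup>2) \<in> borel_measurable \<pi>" for n by measurable
    show "AE x in \<pi>. (\<lambda>n. (cmod (?g n x))\<^sup>2) \<longlonglongrightarrow> 0"
    proof (rule AE_I2)
      fix x
      obtain N :: nat where N: "cmod (f x) \<le> real N" using real_arch_simple by blast
      have "\<forall>\<^sub>F n in sequentially. (cmod (?g n x))\<^sup>2 = 0"
        using eventually_ge_at_top[of N] by eventually_elim (use N in \<open>auto simp: indicator_def\<close>)
      then show "(\<lambda>n. (cmod (?g n x))\<^sup>2) \<longlonglongrightarrow> 0" by (rule tendsto_eventually)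
    qed
  qed (auto simp: indicator_def)
  then show ?thesis unfolding L2_norm_def using tendsto_real_sqrt by fastforce
qed

text \<open>Bounded centred functions are dense among the centred ones: truncate and centre
  again.\<close>

lemma K_sym_contraction:
  assumes \<epsilon>: "\<And>x y. d_TV (kernel_pow P t x) (kernel_pow P t y) \<le> \<epsilon>" and \<epsilon>0: "0 \<le> \<epsilon>"
    and f: "f \<in> L2_centred \<pi>"
  shows "L2_norm \<pi> (K_sym t f) \<le> \<epsilon> * L2_norm \<pi> f"
proof -
  have fL: "f \<in> L2 \<pi>" using f by (simp add: L2_centred_def)
  have [measurable]: "f \<in> borel_measurable \<pi>" by (rule L2_measurable[OF fL])
  define h where "h n x = f x * indicator {x. cmod (f x) \<le> real n} x" for n x
  have hL: "h n \<in> L2 \<pi>" for n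
  proof (rule L2I)
    show m: "h n \<in> borel_measurable \<pi>" unfolding h_def by measurable
    show "integrable \<pi> (\<lambda>x. (cmod (h n x))\<^sup>2)"
      by (rule Bochner_Integration.integrable_bound[OF L2_integrable[OF fL]]) (use m in \<open>auto simp: h_def indicator_def\<close>)
  qed
  have hb: "cmod (centre (h n) x) \<le> real n + cmod (\<integral>x. h n x \<partial>\<pi>)" for n x
    unfolding centre_def by (rule order_trans[OF norm_triangle_ineq4]) (rule add_mono[OF _ order_refl], simp add: h_def indicator_def)
  define d where "d n = L2_norm \<pi> (\<lambda>x. f x - h n x)" for n
  have d: "d \<longlonglongrightarrow> 0" unfolding d_def[abs_def] h_def by (rule L2_truncation_tendsto[OF fL])
  \<comment> \<open>As \<open>f\<close> is already centred, the difference is the centred part of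
    \<open>f - h n\<close>, and centring does not increase the norm.\<close>
  have dist: "L2_norm \<pi> (\<lambda>x. f x - centre (h n) x) \<le> d n" for n
  proof -
    have "centre (\<lambda>x. f x - h n x) = (\<lambda>x. f x - centre (h n) x)"
      using f L1_le_L2(1)[OF fL] L1_le_L2(1)[OF hL[of n]] by (simp add: fun_eq_iff centre_def L2_centred_def)
    then show ?thesis using centre_norm_le[OF L2_diff[OF fL hL[of n]]] by (simp add: d_def)
  qed
  have QL: "K_sym t g \<in> L2 \<pi>" if "g \<in> L2 \<pi>" for g by (rule L2_adjoint_in[OF K_sym_adjoint that])
  have le: "L2_norm \<pi> (K_sym t f) \<le> \<epsilon> * (L2_norm \<pi> f + d n) + d n" for n
  proof -
    let ?c = "centre (h n)"
    have c: "?c \<in> L2 \<pi>" "?c \<in> L2_centred \<pi>" using hL centre_L2 centre_centred by auto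
    have "nrm (K_sym t f) \<le> nrm (K_sym t ?c) + nrm (K_sym t f - K_sym t ?c)"
      by (rule nrm_le_add_diff[OF QL[OF fL] QL[OF c(1)]])
    also have "nrm (K_sym t f - K_sym t ?c) \<le> 1 * nrm (f - ?c)"
      by (rule adj_diff_nrm_le[OF L2_adjoint_adj[OF K_sym_adjoint] _ fL c(1)]) (simp add: nrm_eq K_sym_norm_le)
    also have "nrm (f - ?c) \<le> d n" using dist[of n] by (simp add: nrm_eq fun_diff_eq)
    also have "nrm (K_sym t ?c) \<le> \<epsilon> * nrm ?c"
      using K_sym_contraction_bounded[OF \<epsilon> \<epsilon>0 c(2) hb[of n]] by (simp add: nrm_eq)
    also have "nrm ?c \<le> nrm f + nrm (?c - f)" by (rule nrm_le_add_diff[OF c(1) fL])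
    also have "nrm (?c - f) \<le> d n" using dist[of n] nrm_diff_commute[OF c(1) fL] by (simp add: nrm_eq fun_diff_eq)
    finally show ?thesis using \<epsilon>0 by (simp add: nrm_eq mult_left_mono)
  qed
  have "(\<lambda>n. \<epsilon> * (L2_norm \<pi> f + d n) + d n) \<longlonglongrightarrow> \<epsilon> * (L2_norm \<pi> f + 0) + 0"
    by (intro tendsto_intros d)
  from LIMSEQ_le_const[OF this] le show ?thesis by simp
qed

section \<open>Bounds in terms of \<open>tau\<close> and \<open>t_mix\<close>\<close>

lemma mix_dist_bar_upper: "d_TV (kernel_pow P t x) (kernel_pow P t y) \<le> mix_dist_bar P t"
proof -
  have "bdd_above (range (\<lambda>(x, y). d_TV (kernel_pow P t x) (kernel_pow P t y)))"
    by (rule bdd_aboveI[of _ 1]) (auto intro: d_TV_le_1 kernel_pow_distribution)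
  from cSUP_upper[OF _ this, of "(x, y)"] show ?thesis unfolding mix_dist_bar_def by simp
qed

lemma mix_dist_upper: "d_TV (kernel_pow P t x) \<pi> \<le> mix_dist P \<pi> t"
proof -
  have "distribution \<pi>" using stationary by (simp add: stationary_def)
  then have "bdd_above (range (\<lambda>x. d_TV (kernel_pow P t x) \<pi>))"
    by (intro bdd_aboveI[of _ 1]) (auto intro: d_TV_le_1 kernel_pow_distribution)
  from cSUP_upper[OF _ this] show ?thesis unfolding mix_dist_def by simp
qed

lemma mix_dist_bar_le: "mix_dist_bar P t \<le> 2 * mix_dist P \<pi> t"
  unfolding mix_dist_bar_def
proof (rule cSUP_least)
  have pi: "distribution \<pi>" using stationary by (simp add: stationary_def)
  fix z :: "'a \<times> 'a"
  show "(case z of (x, y) \<Rightarrow> d_TV (kernel_pow P t x) (kernel_pow P t y)) \<le> 2 * mix_dist P \<pi> t"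
  proof (cases z)
    case (Pair x y)
    then show ?thesis
      using d_TV_triangle[OF kernel_pow_distribution kernel_pow_distribution pi, of t x t y]
        mix_dist_upper[of t x] mix_dist_upper[of t y] by simp
  qed
qed simp

lemma enat_INF_cases:
  "(INF t\<in>S. enat t) = \<infinity> \<or> (\<exists>t\<in>S. (INF t\<in>S. enat t) = enat t)"
proof (cases "S = {}")
  case False
  then have "Inf (enat ` S) \<in> enat ` S" by (meson Inf_enat_def LeastI_ex all_not_in_conv image_is_empty wellorder_InfI)
  then show ?thesis by auto
qed (simp add: top_enat_def)

lemma pseudo_spectral_gap_tau_bound:
  assumes \<epsilon>: "0 \<le> \<epsilon>" "\<epsilon> < 1"
  shows "ereal (1 - \<epsilon>) / ereal_of_enat (tau P \<epsilon>) \<le> pseudo_spectral_gap P \<pi>"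
proof -
  consider "tau P \<epsilon> = \<infinity>" | t where "mix_dist_bar P t \<le> \<epsilon>" "tau P \<epsilon> = enat t"
    using enat_INF_cases[of "{t. mix_dist_bar P t \<le> \<epsilon>}"] unfolding tau_def by auto
  then show ?thesis
  proof cases
    case 1
    then show ?thesis using pseudo_spectral_gap_nonneg by simp
  next
    case (2 t)
    have TV: "d_TV (kernel_pow P t x) (kernel_pow P t y) \<le> \<epsilon>" for x y
      using mix_dist_bar_upper[of t x y] 2(1) by linarith
    show ?thesis
    proof (cases "t = 0")
      \<comment> \<open>Distinct points have 0-step distributions at distance 1, so
        \<open>\<epsilon> < 1\<close> leaves only a one-point space, whose gap is infinite.\<close>
      case True
      have "x = y" for x y :: 'a
      proof (rule ccontr)
        assume "x \<noteq> y"
        then have "\<bar>measure (kernel_pow P 0 x) {x} - measure (kernel_pow P 0 y) {x}\<bar> = 1"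
          by (simp add: kernel_pow_def push_def measure_return)
        then show False
          using d_TV_upper[OF kernel_pow_distribution kernel_pow_distribution, of "{x}" 0 x 0 y] TV[of x y] \<epsilon> True by simp
      qed
      then have "UNIV = {undefined :: 'a}" by auto
      from singleton_space(1)[OF this] show ?thesis by simp
    next
      case False
      then have t: "t \<ge> 1" by simp
      have "ereal (1 - \<epsilon>) \<le> spectral_gap \<pi> (K_sym t)"
        by (rule spectral_gap_ge[OF K_sym_adjoint K_sym_const \<epsilon> K_sym_contraction[OF TV \<epsilon>(1)]])
      then have "ereal (1 - \<epsilon>) / ereal (real t) \<le> spectral_gap \<pi> (K_sym t) / ereal (real t)"
        using t by (intro ereal_divide_right_mono) auto
      also note pseudo_spectral_gap_upper[OF t]
      finally show ?thesis using 2(2) by simp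
    qed
  qed
qed

lemma tau_half_le_t_mix: "tau P (1/2) \<le> t_mix P \<pi> (1/4)"
  unfolding tau_def t_mix_def
proof (rule INF_superset_mono)
  show "{t. mix_dist P \<pi> t \<le> 1/4} \<subseteq> {t. mix_dist_bar P t \<le> 1/2}"
  proof safe
    fix t assume "mix_dist P \<pi> t \<le> 1/4"
    then show "mix_dist_bar P t \<le> 1/2" using mix_dist_bar_le[of t] by linarith
  qed
qed simp

text \<open>The case \<open>\<epsilon> = 1 / 2\<close> of the bound by \<open>tau\<close>: the
  triangle inequality through \<pi> turns distance 1/4 to \<pi> into mutual distance 1/2.\<close>

lemma pseudo_spectral_gap_t_mix_bound:
  "1 / (2 * ereal_of_enat (t_mix P \<pi> (1/4))) \<le> pseudo_spectral_gap P \<pi>"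
proof -
  have half: "1 / (2 * ereal_of_enat n) = ereal (1 - 1/2) / ereal_of_enat n" for n
    by (cases n) (auto simp: one_ereal_def numeral_eq_ereal divide_ereal_def zero_ereal_def)
  have "ereal (1 - 1/2) / ereal_of_enat (t_mix P \<pi> (1/4)) \<le> ereal (1 - 1/2) / ereal_of_enat (tau P (1/2))"
    using tau_half_le_t_mix
    unfolding divide_ereal_def by (intro ereal_mult_left_mono ereal_inverse_antimono) auto
  also have "\<dots> \<le> pseudo_spectral_gap P \<pi>" by (rule pseudo_spectral_gap_tau_bound) auto
  finally show ?thesis unfolding half .
qed

end

theorem proposition3p4:
  fixes P :: "'a::polish_space \<Rightarrow> 'a measure" and \<pi> :: "'a measure"
  defines "\<gamma>ps \<equiv> pseudo_spectral_gap P \<pi>"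
  assumes kernel: "markov_kernel P"
    and irreducible: "phi_irreducible P"
    and aperiodic: "aperiodic P \<pi>"
    and stationary: "stationary P \<pi>"
    and unique: "\<And>\<mu>. stationary P \<mu> \<Longrightarrow> \<mu> = \<pi>"
  shows
    "(uniformly_ergodic P \<pi> \<longrightarrow>
        (\<forall>\<epsilon>::real. 0 \<le> \<epsilon> \<and> \<epsilon> < 1 \<longrightarrow>
           \<gamma>ps \<ge> ereal (1 - \<epsilon>) / ereal_of_enat (tau P \<epsilon>)) \<and>
        \<gamma>ps \<ge> 1 / (2 * ereal_of_enat (t_mix P \<pi> (1/4))))
     \<and> (\<forall>(q :: 'a measure) (n :: nat). distribution q \<and> \<gamma>ps > 0 \<longrightarrow>
          ereal (d_TV (push P n q) \<pi>) \<le>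
            (if N_init \<pi> q = \<infinity> then \<infinity>
             else 1/2 * epowr (1 - \<gamma>ps) ((ereal (real n) - 1 / \<gamma>ps) / 2)
                  * ereal (sqrt (enn2real (N_init \<pi> q) - 1))))
     \<and> (finite (UNIV :: 'a set) \<longrightarrow>
          (\<forall>\<epsilon>::real. 0 \<le> \<epsilon> \<and> \<epsilon> \<le> 1 \<longrightarrow>
             ereal_of_enat (t_mix P \<pi> \<epsilon>) \<le>
               (if \<epsilon> = 0 \<or> pi_min \<pi> = 0 then \<infinity>
                else ereal (1 + 2 * ln (1 / (2 * \<epsilon>)) + ln (1 / pi_min \<pi>)) / \<gamma>ps)) \<and>
          ereal_of_enat (t_mix P \<pi> (1/4)) \<le>
            (if pi_min \<pi> = 0 then \<infinity>
             else ereal (1 + 2 * ln 2 + ln (1 / pi_min \<pi>)) / \<gamma>ps))"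
proof -
  interpret stationary_kernel P \<pi> by unfold_locales (rule kernel, rule stationary)
  have mix: "ereal_of_enat (t_mix P \<pi> \<epsilon>) \<le>
               (if \<epsilon> = 0 \<or> pi_min \<pi> = 0 then \<infinity>
                else ereal (1 + 2 * ln (1 / (2 * \<epsilon>)) + ln (1 / pi_min \<pi>)) / \<gamma>ps)"
    if "finite (UNIV :: 'a set)" "0 \<le> \<epsilon>" "\<epsilon> \<le> 1" for \<epsilon>
    using t_mix_upper_bound[of \<epsilon>] that by (auto simp: \<gamma>ps_def)
  show ?thesis
  proof (intro conjI impI allI)
    fix \<epsilon> :: real assume "0 \<le> \<epsilon> \<and> \<epsilon> < 1"
    then show "ereal (1 - \<epsilon>) / ereal_of_enat (tau P \<epsilon>) \<le> \<gamma>ps"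
      using pseudo_spectral_gap_tau_bound by (simp add: \<gamma>ps_def)
  next
    show "1 / (2 * ereal_of_enat (t_mix P \<pi> (1/4))) \<le> \<gamma>ps"
      using pseudo_spectral_gap_t_mix_bound by (simp add: \<gamma>ps_def)
  next
    fix q :: "'a measure" and n :: nat assume "distribution q \<and> 0 < \<gamma>ps"
    then have q: "distribution q" "0 < pseudo_spectral_gap P \<pi>" by (simp_all add: \<gamma>ps_def)
    show "ereal (d_TV (push P n q) \<pi>) \<le>
            (if N_init \<pi> q = \<infinity> then \<infinity>
             else 1/2 * epowr (1 - \<gamma>ps) ((ereal (real n) - 1 / \<gamma>ps) / 2)
                  * ereal (sqrt (enn2real (N_init \<pi> q) - 1)))"
      using d_TV_push_le[OF q, of n] unfolding \<gamma>ps_def by simp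
  next
    fix \<epsilon> :: real assume "finite (UNIV :: 'a set)" "0 \<le> \<epsilon> \<and> \<epsilon> \<le> 1"
    then show "ereal_of_enat (t_mix P \<pi> \<epsilon>) \<le>
               (if \<epsilon> = 0 \<or> pi_min \<pi> = 0 then \<infinity>
                else ereal (1 + 2 * ln (1 / (2 * \<epsilon>)) + ln (1 / pi_min \<pi>)) / \<gamma>ps)"
      using mix by blast
  next
    assume fin: "finite (UNIV :: 'a set)"
    have eq: "1 / (2 * (1/4)) = (2::real)" by simp
    show "ereal_of_enat (t_mix P \<pi> (1/4)) \<le>
            (if pi_min \<pi> = 0 then \<infinity>
             else ereal (1 + 2 * ln 2 + ln (1 / pi_min \<pi>)) / \<gamma>ps)"
      using mix[OF fin, of "1/4", unfolded eq] by simp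
  qed
qed

end
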